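(* Let $q=e^{2\pi i z}$, $\eta(z)=q^{1/24}\prod_{n\ge1}(1-q^n)$, and define \[ g_1(z)=\eta^8(3z),\qquad L_1(z)=\frac{\eta^3(z)}{\eta^3(9z)}+3,\qquad G(z)=g_1(z)L_1^2(z)=\sum_{n\ge -1}C(n)q^n . \] Let $p\equiv 2\pmod 3$ be prime. Then for each integer $m\ge 0$, \[ v_p\big(C(p^{2m+1})\big)=\begin{cases}3m+1,& p=2,\\ 3m,& p\ne 2,\end{cases} \qquad v_p\!\left(\frac{G\,|\,U(p^{2m+1})}{C(p^{2m+1})}-g_1\right)\ge\begin{cases}3m+2,& p=2,\\ 3m+3,& p\ne 2.\end{cases} \]
   Context: $\sum a(n)q^n\,|\,U(m)=\sum a(mn)q^n$. For a formal Laurent series in $q$ with rational coefficients, $v_p$ is the minimum of the $p$-adic valuations of its coefficients ($v_p(0)=\infty$); for a rational number it is the usual $p$-adic valuation. $G$ has integer coefficients, $G=q^{-1}+2q^2-49q^5+\cdots$. *)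

theory Defs
  imports "HOL-Computational_Algebra.Computational_Algebra"
begin

text \<open>The formal infinite product \<open>\<Prod>_{k\<ge>1} (1 - q^(d*k))\<close> (d \<ge> 1) as a formal power series:
  its n-th coefficient is that of the finite product over k = 1..n
  (factors with k > n are congruent to 1 modulo q^(n+1)).\<close>
definition eta_prod :: "nat \<Rightarrow> rat fps" where
  "eta_prod d = Abs_fps (\<lambda>n. fps_nth (\<Prod>k\<in>{1..n}. 1 - fps_X ^ (d * k)) n)"

text \<open>g_1 = eta(3z)^8 = q * \<Prod>(1-q^(3n))^8\<close>
definition g1 :: "rat fls" where
  "g1 = fls_X * fps_to_fls (eta_prod 3 ^ 8)"

text \<open>L_1 = eta(z)^3/eta(9z)^3 + 3 = q^(-1) \<Prod>(1-q^n)^3 / \<Prod>(1-q^(9n))^3 + 3\<close>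
definition L1 :: "rat fls" where
  "L1 = fls_X_inv * fps_to_fls (eta_prod 1 ^ 3) / fps_to_fls (eta_prod 9 ^ 3) + 3"

definition G :: "rat fls" where
  "G = g1 * L1 ^ 2"

definition C :: "int \<Rightarrow> rat" where
  "C n = fls_nth G n"

definition U_op :: "rat fls \<Rightarrow> nat \<Rightarrow> int \<Rightarrow> rat" where
  "U_op F m n = fls_nth F (int m * n)"

definition vp_rat :: "nat \<Rightarrow> rat \<Rightarrow> int" where
  "vp_rat p r = (case quotient_of r of (a, b) \<Rightarrow>
      int (multiplicity (int p) a) - int (multiplicity (int p) b))"

text \<open>v_p of a series given by its coefficient function is at least k
  (zero coefficients have valuation \<infinity>)\<close>
definition vp_series_ge :: "nat \<Rightarrow> (int \<Rightarrow> rat) \<Rightarrow> int \<Rightarrow> bool" where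
  "vp_series_ge p f k \<longleftrightarrow> (\<forall>n. f n \<noteq> 0 \<longrightarrow> vp_rat p (f n) \<ge> k)"

end

theory Submission
  imports Defs "HOL-Complex_Analysis.Complex_Analysis" "HOL-Number_Theory.Cong"
begin

text \<open>
  Put \<open>t = 3 z\<close>. Then \<open>L = L\<^sub>1\<close>, \<open>B = \<eta>(t)\<^sup>9 / \<eta>(3 t)\<^sup>3\<close> and \<open>g\<^sub>1\<close> are modular for \<open>\<Gamma>(3)\<close>; their
  transformation laws are those of the Klein forms at the 3-division points. A Liouville theorem for
  \<open>\<Gamma>(3)\<close> gives, with \<open>\<theta> = q d/dq\<close>, the identities \<open>(\<theta> L)\<^sup>3 = - B\<^sup>2 (L\<^sup>3 - 27)\<close>, \<open>g\<^sub>1 \<theta> L = - B\<^sup>2\<close> and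
  \<open>\<theta>\<^sup>2 (- \<theta> L / B) = B L\<close>, and it shows that a form of weight 4 that is holomorphic on the upper half
  plane, meromorphic at \<open>\<infinity>\<close> and zero at the other cusps is \<open>g\<^sub>1\<close> times a polynomial in \<open>L\<close>.

  The Hecke operators \<open>T(p\<^sup>k)\<close> act on these forms. The principal part of \<open>G | T(p\<^sup>k)\<close> is divisible by
  \<open>p\<close> to the power \<open>3 k\<close>, hence so is \<open>G | T(p\<^sup>k)\<close> up to a multiple of \<open>g\<^sub>1\<close>, which is absent for even \<open>k\<close>.
  Comparing coefficients yields the congruence for \<open>G | U(p\<^sup>2\<^sup>m\<^sup>+\<^sup>1)\<close> and, by a two-term recursion
  modulo a high power of \<open>p\<close>, reduces the valuation of \<open>C(p\<^sup>2\<^sup>m\<^sup>+\<^sup>1)\<close> to that of \<open>C(p)\<close>.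

  For odd \<open>p\<close>, the differential identities express \<open>- B / \<theta> L\<close> as \<open>F(u) u\<close> with \<open>u = 1 / L\<close> and
  \<open>F = \<Sum>n. (3 n)! / n!\<^sup>3 X\<^sup>3\<^sup>n\<close>, and \<open>C(p)\<close> is congruent to the coefficient of \<open>X\<^sup>p\<^sup>+\<^sup>1\<close> in \<open>F\<^sup>2\<close>. If \<open>p\<close>
  divided it, then the recurrence for \<open>F\<^sup>2\<close> would make \<open>p\<close> divide the coefficient of index \<open>2 (p - 2)\<close>,
  which modulo \<open>p\<close> is the square of the unit \<open>(3 k)! / k!\<^sup>3\<close> with \<open>3 k = p - 2\<close>.
\<close>

section \<open>Infinite products\<close>

text \<open>The exponents come from the pole. \<open>G\<close> has a single term with nonpositive
  exponent, q^(-1). Each step of T(p^k) either multiplies an exponent by p at the price of p^3 or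
  divides it by p, and p^k n = -1 has no integral solution for k > 0; so the one surviving term with
  nonpositive exponent is p^(3k) q^(-p^k). The forms \<open>g1 * L1 ^ i\<close> are integral with
  leading term q^(1-i), hence divisibility of the coefficients up to q^1 forces divisibility of all.
  The coefficient of q^1 in G | T(p^k) is C(p^k). The exponents of \<open>G\<close> are 2 modulo 3,
  so it vanishes for even k; for odd k it is the multiple of \<open>g1\<close> to be removed.
  Dividing the congruence modulo p^(6m+3) by C(p^(2m+1)) loses the exponent 3m, or 3m+1 for p = 2,
  which explains the second bound. This argument cannot start itself: it says nothing about whether
  an odd p divides C(p). That is what the differential identities are for; they turn C(p) modulo p
  into a coefficient of an explicit series. For p = 2 the value C(2) = 2 is computed.\<close>

definition qpoch :: "complex \<Rightarrow> complex \<Rightarrow> complex" where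
  "qpoch x q = (\<Prod>n. 1 - x * q ^ n)"

lemma convergent_qpoch:
  fixes x q :: complex
  assumes "norm q < 1"
  shows "convergent_prod (\<lambda>n. 1 - x * q ^ n)"
proof -
  have "summable (\<lambda>n. norm x * norm q ^ n)"
    using assms by (intro summable_mult summable_geometric) auto
  hence "summable (\<lambda>n. norm ((1 - x * q ^ n) - 1))"
    by (simp add: norm_mult norm_power)
  thus ?thesis
    by (intro abs_convergent_prod_imp_convergent_prod summable_imp_abs_convergent_prod)
qed

lemma has_prod_qpoch: "norm q < 1 \<Longrightarrow> (\<lambda>n. 1 - x * q ^ n) has_prod qpoch x q"
  unfolding qpoch_def using convergent_qpoch convergent_prod_has_prod_iff by blast

lemma LIMSEQ_qpoch: "norm q < 1 \<Longrightarrow> (\<lambda>N. \<Prod>n<N. 1 - x * q ^ n) \<longlonglongrightarrow> qpoch x q"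
  unfolding qpoch_def using convergent_prod_LIMSEQ[OF convergent_qpoch[of q x]]
  by (simp add: LIMSEQ_lessThan_iff_atMost)

lemma qpoch_eq_0_iff: "norm q < 1 \<Longrightarrow> qpoch x q = 0 \<longleftrightarrow> (\<exists>n. x * q ^ n = 1)"
  using has_prod_eq_0_iff[OF has_prod_qpoch[of q x]] by (auto simp: image_iff)

lemma qpoch_unfold:
  assumes "norm q < 1"
  shows "qpoch x q = (1 - x) * qpoch (x * q) q"
proof -
  have "(\<lambda>N. (1 - x) * (\<Prod>n<N. 1 - (x * q) * q ^ n)) \<longlonglongrightarrow> (1 - x) * qpoch (x * q) q"
    by (intro tendsto_intros LIMSEQ_qpoch assms)
  also have "(\<lambda>N. (1 - x) * (\<Prod>n<N. 1 - (x * q) * q ^ n)) = (\<lambda>N. \<Prod>n<Suc N. 1 - x * q ^ n)"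
    by (subst prod.lessThan_Suc_shift) (simp add: mult_ac)
  finally have "(\<lambda>N. \<Prod>n<Suc N. 1 - x * q ^ n) \<longlonglongrightarrow> (1 - x) * qpoch (x * q) q" .
  moreover have "(\<lambda>N. \<Prod>n<Suc N. 1 - x * q ^ n) \<longlonglongrightarrow> qpoch x q"
    by (rule LIMSEQ_Suc[OF LIMSEQ_qpoch[OF assms]])
  ultimately show ?thesis using LIMSEQ_unique by blast
qed

text \<open>The exponents of \<open>r\<close> are sorted by residue modulo 3, which is exact on
  partial products of length \<open>3 * N\<close>.\<close>

lemma qpoch_trisect:
  fixes r x :: complex
  assumes "norm r < 1"
  shows "qpoch x (r ^ 3) * qpoch (x * r) (r ^ 3) * qpoch (x * r\<^sup>2) (r ^ 3) = qpoch x r"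
proof -
  have r3: "norm (r ^ 3) < 1"
    using assms by (simp add: norm_power power_less_one_iff)
  have *: "(\<Prod>n<3*N. 1 - x * r ^ n) = (\<Prod>n<N. 1 - x * (r ^ 3) ^ n) *
      (\<Prod>n<N. 1 - x * r * (r ^ 3) ^ n) * (\<Prod>n<N. 1 - x * r\<^sup>2 * (r ^ 3) ^ n)" for N
  proof (induction N)
    case (Suc N)
    have "(\<Prod>n<3*Suc N. 1 - x * r ^ n) = (\<Prod>n<3*N. 1 - x * r ^ n) * (1 - x * r ^ (3*N)) *
        (1 - x * r ^ Suc (3*N)) * (1 - x * r ^ Suc (Suc (3*N)))"
    proof -
      have "3 * Suc N = Suc (Suc (Suc (3 * N)))" by simp
      thus ?thesis by (simp only: prod.lessThan_Suc)
    qed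
    thus ?case unfolding Suc
      by (simp add: power_mult[symmetric] power2_eq_square mult_ac)
  qed simp
  have "(\<lambda>N. \<Prod>n<3*N. 1 - x * r ^ n) \<longlonglongrightarrow> qpoch x r"
    by (rule filterlim_compose[OF LIMSEQ_qpoch[OF assms]])
       (auto intro!: filterlim_subseq simp: strict_mono_def)
  moreover have "(\<lambda>N. \<Prod>n<3*N. 1 - x * r ^ n) \<longlonglongrightarrow>
      qpoch x (r ^ 3) * qpoch (x * r) (r ^ 3) * qpoch (x * r\<^sup>2) (r ^ 3)"
    unfolding * by (intro tendsto_intros LIMSEQ_qpoch r3)
  ultimately show ?thesis using LIMSEQ_unique by blast
qed

section \<open>Products over the cube roots of unity\<close>

definition omg :: complex where "omg = exp (2 * of_real pi * \<i> / 3)"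

lemma omg_cube: "omg ^ 3 = 1"
  by (simp add: omg_def exp_of_nat_mult[symmetric] mult_ac)

lemma omg_Complex: "omg = Complex (-1/2) (sqrt 3 / 2)"
proof -
  have "omg = cis (2 * pi / 3)" by (simp add: omg_def cis_conv_exp mult_ac)
  thus ?thesis by (simp add: cis.code cos_120 sin_120)
qed

lemma omg_ne [simp]: "omg \<noteq> 0" "omg \<noteq> 1"
  by (simp_all add: omg_Complex complex_eq_iff)

lemma omg_sum: "omg\<^sup>2 + omg + 1 = 0"
proof -
  have "(omg - 1) * (omg\<^sup>2 + omg + 1) = omg ^ 3 - 1"
    by (simp add: algebra_simps power2_eq_square power3_eq_cube)
  thus ?thesis by (simp add: omg_cube)
qed

lemma omg_factor: "(1 - y) * (1 - omg * y) * (1 - omg\<^sup>2 * y) = 1 - y ^ 3"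
proof -
  have "(1 - y) * (1 - omg * y) * (1 - omg\<^sup>2 * y) =
     1 - (omg\<^sup>2 + omg + 1) * y + omg * (omg\<^sup>2 + omg + 1) * y\<^sup>2 - omg ^ 3 * y ^ 3"
    by (simp add: algebra_simps power2_eq_square power3_eq_cube)
  thus ?thesis by (simp add: omg_sum omg_cube)
qed

lemma qpoch_cube:
  assumes "norm q < 1"
  shows "qpoch x q * qpoch (omg * x) q * qpoch (omg\<^sup>2 * x) q = qpoch (x ^ 3) (q ^ 3)"
proof -
  have q3: "norm (q ^ 3) < 1"
    using assms by (simp add: norm_power power_less_one_iff)
  have "(1 - x * q ^ n) * (1 - omg * x * q ^ n) * (1 - omg\<^sup>2 * x * q ^ n) = 1 - x ^ 3 * (q ^ 3) ^ n" for n
    using omg_factor[of "x * q ^ n"]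
    by (simp add: mult_ac power_mult_distrib power_mult[symmetric])
  hence "(\<lambda>N. (\<Prod>n<N. 1 - x * q ^ n) * (\<Prod>n<N. 1 - omg * x * q ^ n) *
      (\<Prod>n<N. 1 - omg\<^sup>2 * x * q ^ n)) = (\<lambda>N. \<Prod>n<N. 1 - x ^ 3 * (q ^ 3) ^ n)"
    by (simp flip: prod.distrib)
  moreover have "(\<lambda>N. (\<Prod>n<N. 1 - x * q ^ n) * (\<Prod>n<N. 1 - omg * x * q ^ n) *
      (\<Prod>n<N. 1 - omg\<^sup>2 * x * q ^ n)) \<longlonglongrightarrow> qpoch x q * qpoch (omg * x) q * qpoch (omg\<^sup>2 * x) q"
    by (intro tendsto_intros LIMSEQ_qpoch assms)
  ultimately show ?thesis
    using LIMSEQ_qpoch[OF q3, of "x ^ 3"] LIMSEQ_unique by metis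
qed

text \<open>Weierstrass test: on a compact set the maxima of the norms of \<open>g\<close> and
  \<open>h\<close> give a geometric majorant. Uniformity is what transports holomorphy and Taylor
  coefficients from the partial products to the limit.\<close>

lemma uniform_limit_qpoch:
  assumes "compact K" "continuous_on K g" "continuous_on K h" "\<And>z. z \<in> K \<Longrightarrow> norm (h z) < 1"
  shows "uniform_limit K (\<lambda>N z. \<Prod>n<N. 1 - g z * h z ^ n) (\<lambda>z. qpoch (g z) (h z)) sequentially"
proof -
  have "uniformly_convergent_on K (\<lambda>N z. \<Prod>n<N. 1 - g z * h z ^ n)"
  proof (rule uniformly_convergent_on_prod')
    show "uniformly_convergent_on K (\<lambda>N x. \<Sum>n<N. norm (1 - g x * h x ^ n - 1))"
    proof (cases "K = {}")
      case False
      obtain z1 where z1: "z1 \<in> K" "\<And>z. z \<in> K \<Longrightarrow> norm (g z) \<le> norm (g z1)"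
        using continuous_attains_sup[OF assms(1) False, of "\<lambda>z. norm (g z)"] assms
        by (auto intro: continuous_intros)
      obtain z2 where z2: "z2 \<in> K" "\<And>z. z \<in> K \<Longrightarrow> norm (h z) \<le> norm (h z2)"
        using continuous_attains_sup[OF assms(1) False, of "\<lambda>z. norm (h z)"] assms
        by (auto intro: continuous_intros)
      show ?thesis
      proof (rule Weierstrass_m_test'_ev)
        show "\<forall>\<^sub>F n in sequentially. \<forall>x\<in>K. norm (norm (1 - g x * h x ^ n - 1)) \<le> norm (g z1) * norm (h z2) ^ n"
          using z1 z2 by (auto intro!: always_eventually mult_mono power_mono simp: norm_mult norm_power)
        show "summable (\<lambda>n. norm (g z1) * norm (h z2) ^ n)"
          using assms(4)[OF z2(1)] by (intro summable_mult summable_geometric) auto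
      qed
    qed auto
  qed (use assms in \<open>auto intro!: continuous_intros\<close>)
  then obtain l where l: "uniform_limit K (\<lambda>N z. \<Prod>n<N. 1 - g z * h z ^ n) l sequentially"
    by (auto simp: uniformly_convergent_on_def)
  have "l z = qpoch (g z) (h z)" if "z \<in> K" for z
    using tendsto_uniform_limitI[OF l that] LIMSEQ_qpoch[OF assms(4)[OF that], of "g z"] LIMSEQ_unique
    by blast
  thus ?thesis using l uniform_limit_cong'[of K _ _ l] by (metis (no_types, lifting) uniform_limit_cong')
qed

lemma holomorphic_qpoch [holomorphic_intros]:
  assumes "open A" "g holomorphic_on A" "h holomorphic_on A" "\<And>z. z \<in> A \<Longrightarrow> norm (h z) < 1"
  shows "(\<lambda>z. qpoch (g z) (h z)) holomorphic_on A"
proof (rule holomorphic_uniform_sequence[OF assms(1), of "\<lambda>N z. \<Prod>n<N. 1 - g z * h z ^ n"])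
  show "(\<lambda>z. \<Prod>n<N. 1 - g z * h z ^ n) holomorphic_on A" for N
    by (intro holomorphic_intros assms)
next
  fix x assume x: "x \<in> A"
  then obtain d where d: "d > 0" "cball x d \<subseteq> A"
    using assms(1) open_contains_cball by blast
  have "uniform_limit (cball x d) (\<lambda>N z. \<Prod>n<N. 1 - g z * h z ^ n) (\<lambda>z. qpoch (g z) (h z)) sequentially"
    using d assms by (intro uniform_limit_qpoch)
      (auto intro!: holomorphic_on_imp_continuous_on holomorphic_on_subset[OF assms(2)] holomorphic_on_subset[OF assms(3)])
  thus "\<exists>d>0. cball x d \<subseteq> A \<and> uniform_limit (cball x d) (\<lambda>N z. \<Prod>n<N. 1 - g z * h z ^ n) (\<lambda>z. qpoch (g z) (h z)) sequentially"
    using d by blast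
qed

definition eulerP :: "complex \<Rightarrow> complex" where "eulerP q = qpoch q q"

lemma eulerP_nonzero: assumes "norm q < 1" shows "eulerP q \<noteq> 0"
proof
  assume "eulerP q = 0"
  then obtain n where "q * q ^ n = 1"
    using assms by (auto simp: eulerP_def qpoch_eq_0_iff)
  hence "norm q ^ Suc n = 1"
    by (metis norm_one norm_power power_Suc)
  moreover have "norm q ^ Suc n < 1"
    using assms power_less_one_iff[of "norm q" "Suc n"] by simp
  ultimately show False by simp
qed

lemma eulerP_0 [simp]: "eulerP 0 = 1"
  by (simp add: eulerP_def qpoch_def)

lemma holomorphic_eulerP [holomorphic_intros]:
  assumes "open A" "h holomorphic_on A" "\<And>z. z \<in> A \<Longrightarrow> norm (h z) < 1"
  shows "(\<lambda>z. eulerP (h z)) holomorphic_on A"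
  unfolding eulerP_def by (intro holomorphic_intros assms)

lemma eulerP_trisect:
  assumes "norm r < 1"
  shows "qpoch r (r ^ 3) * qpoch (r\<^sup>2) (r ^ 3) * eulerP (r ^ 3) = eulerP r"
  using qpoch_trisect[OF assms, of r] by (simp add: eulerP_def power2_eq_square power3_eq_cube mult_ac)

text \<open>In terms of eta this is the product over z, z + 1/3 and z + 2/3. After trisecting each
  factor, the parts with exponents 1 and 2 modulo 3 recombine over the cube roots of unity into
  products in \<open>q ^ 9\<close>. It will evaluate L^3 - 27.\<close>

lemma eulerP_omg:
  assumes "norm q < 1"
  shows "eulerP q * eulerP (omg * q) * eulerP (omg\<^sup>2 * q) * eulerP (q ^ 9) = eulerP (q ^ 3) ^ 4"
proof -
  have n1: "norm omg = 1" by (simp add: omg_def)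
  have n3: "norm (q ^ 3) < 1" 
    using assms by (simp add: norm_power power_less_one_iff)
  have 1: "qpoch (omg * q) (q ^ 3) * qpoch (omg\<^sup>2 * q\<^sup>2) (q ^ 3) * eulerP (q ^ 3) = eulerP (omg * q)"
    using eulerP_trisect[of "omg * q"] assms by (simp add: norm_mult n1 power_mult_distrib omg_cube)
  have w4: "(omg\<^sup>2)\<^sup>2 = omg" "(omg\<^sup>2) ^ 3 = 1"
  proof -
    have "(omg\<^sup>2)\<^sup>2 = omg ^ 3 * omg" by (simp add: eval_nat_numeral)
    thus "(omg\<^sup>2)\<^sup>2 = omg" by (simp add: omg_cube)
    have "(omg\<^sup>2) ^ 3 = (omg ^ 3)\<^sup>2" by (simp add: power_mult[symmetric])
    thus "(omg\<^sup>2) ^ 3 = 1" by (simp add: omg_cube)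
  qed
  have 2: "qpoch (omg\<^sup>2 * q) (q ^ 3) * qpoch (omg * q\<^sup>2) (q ^ 3) * eulerP (q ^ 3) = eulerP (omg\<^sup>2 * q)"
    using eulerP_trisect[of "omg\<^sup>2 * q"] assms w4
    unfolding power_mult_distrib by (simp add: norm_mult norm_power n1 del: power_mult power_mult_numeral)
  have 3: "qpoch q (q ^ 3) * qpoch (omg * q) (q ^ 3) * qpoch (omg\<^sup>2 * q) (q ^ 3) = qpoch (q ^ 3) (q ^ 9)"
    using qpoch_cube[OF n3, of q] by simp
  have 4: "qpoch (q\<^sup>2) (q ^ 3) * qpoch (omg * q\<^sup>2) (q ^ 3) * qpoch (omg\<^sup>2 * q\<^sup>2) (q ^ 3) = qpoch (q ^ 6) (q ^ 9)"
    using qpoch_cube[OF n3, of "q\<^sup>2"] by simp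
  have 5: "qpoch (q ^ 3) (q ^ 9) * qpoch (q ^ 6) (q ^ 9) * eulerP (q ^ 9) = eulerP (q ^ 3)"
    using eulerP_trisect[OF n3] by simp
  have "eulerP q * eulerP (omg * q) * eulerP (omg\<^sup>2 * q) * eulerP (q ^ 9) =
     (qpoch q (q ^ 3) * qpoch (omg * q) (q ^ 3) * qpoch (omg\<^sup>2 * q) (q ^ 3)) *
     (qpoch (q\<^sup>2) (q ^ 3) * qpoch (omg * q\<^sup>2) (q ^ 3) * qpoch (omg\<^sup>2 * q\<^sup>2) (q ^ 3)) *
      eulerP (q ^ 9) * eulerP (q ^ 3) ^ 3"
    unfolding eulerP_trisect[OF assms, symmetric] 1[symmetric] 2[symmetric]
    by (simp add: power3_eq_cube mult_ac)
  also have "\<dots> = eulerP (q ^ 3) ^ 4"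
    unfolding 3 4 5 by (simp add: eval_nat_numeral)
  finally show ?thesis .
qed

section \<open>Formal eta products as expansions of analytic functions\<close>

definition cmap :: "rat fps \<Rightarrow> complex fps" where
  "cmap F = Abs_fps (\<lambda>n. of_rat (fps_nth F n))"

lemma cmap_nth [simp]: "fps_nth (cmap F) n = of_rat (fps_nth F n)"
  by (simp add: cmap_def)

lemma cmap_mult: "cmap (F * H) = cmap F * cmap H"
  by (simp add: fps_eq_iff fps_mult_nth of_rat_sum of_rat_mult)

lemma cmap_add: "cmap (F + H) = cmap F + cmap H"
  and cmap_diff: "cmap (F - H) = cmap F - cmap H"
  by (simp_all add: fps_eq_iff of_rat_add of_rat_diff)

lemma cmap_1 [simp]: "cmap 1 = 1"
  by (simp add: fps_eq_iff)

lemma cmap_X_power [simp]: "cmap (fps_X ^ n) = fps_X ^ n"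
  by (simp add: fps_eq_iff fps_X_power_iff)

lemma cmap_power: "cmap (F ^ n) = cmap F ^ n"
  by (induction n) (simp_all add: cmap_mult)

lemma cmap_prod: "cmap (prod f I) = (\<Prod>i\<in>I. cmap (f i))"
  by (induction I rule: infinite_finite_induct) (simp_all add: cmap_mult)

lemma eta_prod_partial_nth:
  assumes "d > 0"
  shows "fps_nth (\<Prod>k\<in>{1..n + N}. 1 - fps_X ^ (d * k) :: rat fps) n = fps_nth (eta_prod d) n"
proof (induction N)
  case (Suc N)
  have "n < d * Suc (n + N)" using assms by (cases d) auto
  thus ?case using Suc
    by (simp add: right_diff_distrib fps_X_power_mult_right_nth del: mult_Suc_right)
qed (simp add: eta_prod_def)

text \<open>The partial products converge uniformly near 0, so their Taylor coefficients converge;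
  by \<open>eta_prod_partial_nth\<close> each coefficient is eventually constant, with the value
  given by the formal product.\<close>

lemma eulerP_has_fps_expansion:
  assumes d: "d > 0"
  shows "(\<lambda>q. eulerP (q ^ d)) has_fps_expansion cmap (eta_prod d)"
proof -
  let ?f = "\<lambda>N (q::complex). \<Prod>n<N. 1 - q ^ d * (q ^ d) ^ n"
  let ?g = "\<lambda>q::complex. eulerP (q ^ d)"
  have small: "norm (q ^ d) < 1" if "q \<in> ball 0 1" for q :: complex
    using that d by (simp add: norm_power power_less_one_iff)
  have hol: "?g holomorphic_on ball 0 1"
    by (intro holomorphic_intros small) auto
  hence exp: "?g has_fps_expansion fps_expansion ?g 0"
    by (intro has_fps_expansion_fps_expansion[of "ball 0 1"]) auto
  have fexp: "?f N has_fps_expansion cmap (\<Prod>k\<in>{1..N}. 1 - fps_X ^ (d * k))" for N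
  proof -
    have "?f N has_fps_expansion (\<Prod>n<N. 1 - fps_X ^ d * (fps_X ^ d) ^ n)"
      by (rule has_fps_expansion_prod)
         (intro has_fps_expansion_diff has_fps_expansion_mult has_fps_expansion_power
            has_fps_expansion_fps_X has_fps_expansion_1)
    also have "(\<Prod>n<N. 1 - fps_X ^ d * (fps_X ^ d) ^ n :: complex fps) = (\<Prod>k\<in>{1..N}. 1 - fps_X ^ (d * k))"
      by (rule prod.reindex_bij_witness[of _ "\<lambda>k. k - 1" Suc])
         (auto simp: power_mult[symmetric] power_add[symmetric])
    finally show ?thesis by (simp add: cmap_prod cmap_diff)
  qed
  have "fps_expansion ?g 0 = cmap (eta_prod d)"
  proof (rule fps_ext)
    fix n
    have lim: "(\<lambda>N. (deriv ^^ n) (?f N) 0) \<longlonglongrightarrow> (deriv ^^ n) ?g 0"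
    proof (rule higher_deriv_complex_uniform_limit[where A = "ball 0 (1/2)"])
      have "uniform_limit (cball 0 (1/2)) ?f ?g sequentially"
        unfolding eulerP_def
      proof (rule uniform_limit_qpoch)
        fix z :: complex assume "z \<in> cball 0 (1/2)"
        thus "norm (z ^ d) < 1" by (intro small) auto
      qed (auto intro!: continuous_intros)
      thus "uniform_limit (ball 0 (1/2)) ?f ?g sequentially"
        by (rule uniform_limit_on_subset) auto
    qed (auto intro!: always_eventually holomorphic_intros)
    have "(deriv ^^ n) (?f N) 0 = fact n * of_rat (fps_nth (eta_prod d) n)" if "N \<ge> n" for N
      using fps_nth_fps_expansion[OF fexp, of N n] eta_prod_partial_nth[OF d, of n "N - n"] that
      by simp
    hence "(\<lambda>N. (deriv ^^ n) (?f N) 0) \<longlonglongrightarrow> fact n * of_rat (fps_nth (eta_prod d) n)"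
      by (intro tendsto_eventually) (auto simp: eventually_at_top_linorder)
    hence "(deriv ^^ n) ?g 0 = fact n * of_rat (fps_nth (eta_prod d) n)"
      using lim LIMSEQ_unique by blast
    thus "fps_nth (fps_expansion ?g 0) n = fps_nth (cmap (eta_prod d)) n"
      by (simp add: fps_expansion_def)
  qed
  thus ?thesis using exp by simp
qed

section \<open>Theta functions and the inversion law\<close>

definition ee :: "complex \<Rightarrow> complex" where "ee z = exp (2 * of_real pi * \<i> * z)"

lemma ee_add: "ee (x + y) = ee x * ee y"
  by (simp add: ee_def distrib_left exp_add)

lemma ee_diff: "ee (x - y) = ee x / ee y"
  by (simp add: ee_def right_diff_distrib exp_diff)

lemma ee_uminus: "ee (- x) = inverse (ee x)"
  by (simp add: ee_def exp_minus)

lemma ee_ne_0 [simp]: "ee x \<noteq> 0"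
  by (simp add: ee_def)

lemma ee_0 [simp]: "ee 0 = 1"
  by (simp add: ee_def)

lemma ee_power: "ee x ^ n = ee (of_nat n * x)"
  by (simp add: ee_def exp_of_nat_mult[symmetric] mult_ac)

lemma ee_of_int [simp]: "ee (of_int n) = 1"
  using exp_integer_2pi[of "of_int n"] by (simp add: ee_def mult_ac)

lemma ee_1 [simp]: "ee 1 = 1"
  using ee_of_int[of 1] by simp

lemma ee_half: "ee (1/2) = -1"
  by (simp add: ee_def)

lemma ee_eq_1_iff: "ee z = 1 \<longleftrightarrow> (\<exists>n. z = of_int n)"
proof
  assume "ee z = 1"
  then obtain n :: int where n: "Im (2 * of_real pi * \<i> * z) = of_int (2 * n) * pi" "Re (2 * of_real pi * \<i> * z) = 0"
    by (auto simp: ee_def exp_eq_1)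
  hence "z = of_int n" by (auto simp: complex_eq_iff)
  thus "\<exists>n. z = of_int n" ..
qed auto

lemma norm_ee: "norm (ee z) = exp (- 2 * pi * Im z)"
  by (simp add: ee_def)

lemma norm_ee_less_1: "Im z > 0 \<Longrightarrow> norm (ee z) < 1"
  by (simp add: norm_ee)

lemma holomorphic_ee [holomorphic_intros]: "f holomorphic_on A \<Longrightarrow> (\<lambda>z. ee (f z)) holomorphic_on A"
  unfolding ee_def by (intro holomorphic_intros)

text \<open>
  The Weierstrass sigma function without its Gaussian factor and up to normalization, as a function
  of \<open>x = e(z)\<close> and \<open>Q = e(t)\<close>.
\<close>

definition theta :: "complex \<Rightarrow> complex \<Rightarrow> complex" where
  "theta t z = ee (- z / 2) * qpoch (ee z) (ee t) * qpoch (ee (t - z)) (ee t)"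

lemma holomorphic_theta: "Im t > 0 \<Longrightarrow> theta t holomorphic_on UNIV"
  unfolding theta_def[abs_def] by (intro holomorphic_intros norm_ee_less_1) auto

lemma theta_add_1: "theta t (z + 1) = - theta t z"
proof -
  have "ee (- (z + 1) / 2) = - ee (- z / 2)"
    using ee_add[of "-z/2 - 1" "1/2"] ee_diff[of "-z/2" 1] by (simp add: ee_half field_simps)
  thus ?thesis
    using ee_diff[of "t - z" 1] by (simp add: theta_def ee_add algebra_simps)
qed

text \<open>One factor is moved from each product to the other. Both the oddness of
  \<open>theta\<close> and its law under z -> z + t are this identity.\<close>

lemma qpoch_swap:
  assumes "norm q < 1" "x \<noteq> 0"
  shows "qpoch (q * x) q * qpoch (inverse x) q = - inverse x * qpoch x q * qpoch (q / x) q"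
proof -
  have "qpoch x q = (1 - x) * qpoch (q * x) q"
    using qpoch_unfold[OF assms(1), of x] by (simp add: mult_ac)
  moreover have "qpoch (inverse x) q = (1 - inverse x) * qpoch (q / x) q"
    using qpoch_unfold[OF assms(1), of "inverse x"] by (simp add: field_simps)
  moreover have "1 - inverse x = - inverse x * (1 - x)"
    using assms(2) by (simp add: algebra_simps)
  ultimately show ?thesis by (simp only: mult_ac mult_minus_left mult_minus_right)
qed

lemma theta_uminus: assumes "Im t > 0" shows "theta t (- z) = - theta t z"
proof -
  have "ee (z / 2) * inverse (ee z) = ee (- z / 2)"
    using ee_add[of "z / 2" "-z"] by (simp add: ee_uminus)
  moreover have "theta t (- z) = ee (z / 2) * (qpoch (ee t * ee z) (ee t) * qpoch (inverse (ee z)) (ee t))"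
    by (simp add: theta_def ee_uminus ee_add)
  ultimately show ?thesis
    unfolding qpoch_swap[OF norm_ee_less_1[OF assms] ee_ne_0] by (simp add: theta_def ee_diff)
qed

lemma theta_add_tau: assumes "Im t > 0" shows "theta t (z + t) = - ee (- z - t / 2) * theta t z"
proof -
  have 1: "ee (- (z + t) / 2) * inverse (ee z) = ee (- z - t / 2) * ee (- z / 2)"
    unfolding ee_add[symmetric] ee_uminus[symmetric] by (rule arg_cong[of _ _ ee]) (simp add: field_simps)
  have "theta t (z + t) = ee (- (z + t) / 2) * (qpoch (ee t * ee z) (ee t) * qpoch (inverse (ee z)) (ee t))"
    by (simp add: theta_def ee_uminus ee_add mult_ac)
  also have "\<dots> = - (ee (- (z + t) / 2) * inverse (ee z)) * qpoch (ee z) (ee t) * qpoch (ee t / ee z) (ee t)"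
    unfolding qpoch_swap[OF norm_ee_less_1[OF assms] ee_ne_0] by simp
  finally show ?thesis unfolding 1 by (simp add: theta_def ee_diff)
qed

lemma theta_eq_0_iff:
  assumes "Im t > 0"
  shows "theta t z = 0 \<longleftrightarrow> (\<exists>m n :: int. z = of_int m + of_int n * t)"
proof
  assume "theta t z = 0"
  hence "(\<exists>n. ee z * ee t ^ n = 1) \<or> (\<exists>n. ee (t - z) * ee t ^ n = 1)"
    by (simp add: theta_def qpoch_eq_0_iff norm_ee_less_1 assms)
  hence "(\<exists>n::nat. ee (z + of_nat n * t) = 1) \<or> (\<exists>n::nat. ee (t - z + of_nat n * t) = 1)"
    by (simp add: ee_power ee_add)
  then obtain n k where "z + of_nat n * t = of_int k \<or> t - z + of_nat n * t = of_int k"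
    unfolding ee_eq_1_iff by blast
  thus "\<exists>m n :: int. z = of_int m + of_int n * t"
  proof
    assume "z + of_nat n * t = of_int k"
    hence "z = of_int k + of_int (- int n) * t" by (simp add: algebra_simps)
    thus ?thesis by blast
  next
    assume "t - z + of_nat n * t = of_int k"
    hence "z = of_int (- k) + of_int (int n + 1) * t" by (simp add: algebra_simps)
    thus ?thesis by blast
  qed
next
  assume "\<exists>m n :: int. z = of_int m + of_int n * t"
  then obtain m n :: int where z: "z = of_int m + of_int n * t" by blast
  have "(\<exists>k. ee z * ee t ^ k = 1) \<or> (\<exists>k. ee (t - z) * ee t ^ k = 1)"
  proof (cases "n \<le> 0")
    case True
    hence "z + of_nat (nat (- n)) * t = of_int m" by (simp add: z)
    hence "ee z * ee t ^ nat (- n) = 1" by (metis ee_add ee_of_int ee_power)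
    thus ?thesis by blast
  next
    case False
    hence "t - z + of_nat (nat (n - 1)) * t = of_int (- m)" by (simp add: z algebra_simps)
    hence "ee (t - z) * ee t ^ nat (n - 1) = 1" by (metis ee_add ee_of_int ee_power)
    thus ?thesis by blast
  qed
  thus "theta t z = 0"
    by (auto simp: theta_def qpoch_eq_0_iff norm_ee_less_1 assms)
qed

text \<open>The factor \<open>1 - ee z\<close> carries the zero at 0; combined with the exponential
  it becomes \<open>ee (- z / 2) - ee (z / 2)\<close>, and the other factors are evaluated at
  0.\<close>

lemma theta_deriv_0:
  assumes "Im t > 0"
  shows "(theta t has_field_derivative (- 2 * of_real pi * \<i> * eulerP (ee t) ^ 2)) (at 0)"
proof -
  define f where "f = (\<lambda>z. qpoch (ee t * ee z) (ee t) * qpoch (ee (t - z)) (ee t))"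
  have "f holomorphic_on UNIV"
    unfolding f_def by (intro holomorphic_intros norm_ee_less_1 assms) auto
  then obtain f' where f': "(f has_field_derivative f') (at 0)"
    by (meson UNIV_I field_differentiable_def holomorphic_on_imp_differentiable_at open_UNIV)
  have "theta t = (\<lambda>z. (ee (- z / 2) - ee (z / 2)) * f z)"
  proof
    fix z
    have e: "ee (- z / 2) * ee z = ee (z / 2)" unfolding ee_add[symmetric] by (rule arg_cong[of _ _ ee]) simp
    have "qpoch (ee z) (ee t) = (1 - ee z) * qpoch (ee t * ee z) (ee t)"
      using qpoch_unfold[OF norm_ee_less_1[OF assms], of "ee z"] by (simp add: mult_ac)
    moreover have "(ee (- z / 2) - ee (z / 2)) = ee (- z / 2) * (1 - ee z)"
      unfolding e[symmetric] by (simp add: algebra_simps)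
    ultimately show "theta t z = (ee (- z / 2) - ee (z / 2)) * f z"
      by (simp only: theta_def f_def mult_ac)
  qed
  moreover have "((\<lambda>z. (ee (- z / 2) - ee (z / 2)) * f z) has_field_derivative (- 2 * of_real pi * \<i> * f 0)) (at 0)"
    unfolding ee_def by (auto intro!: derivative_eq_intros f' simp: algebra_simps)
  moreover have "f 0 = eulerP (ee t) ^ 2"
    by (simp add: f_def eulerP_def power2_eq_square)
  ultimately show ?thesis by simp
qed

section \<open>Entire functions with a lattice of periods\<close>

lemma lattice_periodic:
  fixes f :: "complex \<Rightarrow> 'a"
  assumes "\<And>z. f (z + 1) = f z" "\<And>z. f (z + t) = f z"
  shows "f (z + of_int m + of_int n * t) = f z"
proof -
  have *: "g (z + of_int k * s) = g z" if "\<And>z. g (z + s) = g z" for g :: "complex \<Rightarrow> 'a" and z s k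
  proof (induction k rule: int_induct[of _ 0])
    case (step1 i)
    thus ?case using that[of "z + of_int i * s"] by (simp add: algebra_simps)
  next
    case (step2 i)
    thus ?case using that[of "z + of_int (i - 1) * s"] by (simp add: algebra_simps)
  qed simp
  show ?thesis
    using *[of f t "z + of_int m" n] *[of f 1 z m] assms by simp
qed

lemma doubly_periodic_entire_const:
  assumes t: "Im t > 0" and hol: "f holomorphic_on UNIV"
    and per: "\<And>z. f (z + 1) = f z" "\<And>z. f (z + t) = f z"
  shows "f z = f 0"
proof -
  define K where "K = (\<lambda>(x, y). of_real x + of_real y * t) ` (cbox (0, 0) (1, 1 :: real))"
  have "compact K" unfolding K_def
    by (intro compact_continuous_image compact_cbox) (auto intro!: continuous_intros simp: case_prod_unfold)
  hence "compact (f ` K)"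
    by (intro compact_continuous_image holomorphic_on_imp_continuous_on holomorphic_on_subset[OF hol]) auto
  hence bdd: "bounded (f ` K)" by (rule compact_imp_bounded)
  have "f z \<in> f ` K" for z
  proof -
    define y where "y = Im z / Im t"
    define x where "x = Re z - y * Re t"
    have z: "z = of_real x + of_real y * t"
      using t by (simp add: complex_eq_iff x_def y_def)
    define z0 where "z0 = of_real (frac x) + of_real (frac y) * t"
    have "(frac x, frac y) \<in> cbox (0, 0) (1, 1 :: real)"
      by (auto simp: cbox_Pair_eq less_imp_le[OF frac_lt_1])
    hence "z0 \<in> K" unfolding K_def z0_def by force
    moreover have "z = z0 + of_int \<lfloor>x\<rfloor> + of_int \<lfloor>y\<rfloor> * t"
      by (simp add: z z0_def frac_def algebra_simps)
    hence "f z = f z0" using lattice_periodic[of f t z0] per by simp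
    ultimately show ?thesis by blast
  qed
  hence "bounded (range f)" using bounded_subset[OF bdd] by blast
  from Liouville_theorem[OF hol this] show ?thesis
    by (auto simp: constant_on_def)
qed

text \<open>The quotient \<open>g / h\<close> is doubly periodic. The zeros of \<open>h\<close> are
  the lattice points, simple because \<open>h'\<close> is nonzero, and \<open>g\<close> vanishes
  there too, so the quotient extends to an entire function and Liouville's theorem applies.\<close>

lemma quasi_periodic_proportional:
  assumes t: "Im t > 0" and hol: "g holomorphic_on UNIV" "h holomorphic_on UNIV"
    and zeros: "\<And>z. h z = 0 \<longleftrightarrow> (\<exists>m n :: int. z = of_int m + of_int n * t)"
    and der: "(g has_field_derivative g') (at 0)" "(h has_field_derivative h') (at 0)" "h' \<noteq> 0" "g 0 = 0"
    and per1: "\<And>z. m1 z \<noteq> 0" "\<And>z. g (z + 1) = m1 z * g z" "\<And>z. h (z + 1) = m1 z * h z"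
    and per2: "\<And>z. m2 z \<noteq> 0" "\<And>z. g (z + t) = m2 z * g z" "\<And>z. h (z + t) = m2 z * h z"
  shows "g z = g' / h' * h z"
proof -
  define A where "A = g' / h'"
  \<comment> \<open>At lattice points the value is the limit of \<open>g / h\<close> at 0, which
    makes \<open>f\<close> entire.\<close>
  define f where "f = (\<lambda>z. if h z = 0 then A else g z / h z)"
  have h0: "h 0 = 0" unfolding zeros by (intro exI[of _ 0]) auto
  have per: "f (z + 1) = f z" "f (z + t) = f z" for z
    using per1 per2 by (auto simp: f_def)
  have an: "f analytic_on {z}" if "h z \<noteq> 0" for z
  proof -
    have "open {z. h z \<noteq> 0}"
      using hol(2) holomorphic_on_imp_continuous_on open_Collect_neq[of h "\<lambda>_. 0"] by fastforce
    moreover have "f holomorphic_on {z. h z \<noteq> 0}"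
    proof -
      have "(\<lambda>z. g z / h z) holomorphic_on {z. h z \<noteq> 0}"
        by (intro holomorphic_intros holomorphic_on_subset[OF hol(1)] holomorphic_on_subset[OF hol(2)]) auto
      thus ?thesis by (rule holomorphic_transform) (auto simp: f_def)
    qed
    ultimately show ?thesis using that by (auto simp: analytic_at)
  qed
  have lim: "((\<lambda>z. g z / z) \<longlongrightarrow> g') (at 0)" "((\<lambda>z. h z / z) \<longlongrightarrow> h') (at 0)"
    using der h0 by (simp_all add: has_field_derivative_iff)
  have "((\<lambda>z. (g z / z) / (h z / z)) \<longlongrightarrow> A) (at 0)"
    unfolding A_def by (intro tendsto_intros lim der)
  moreover have "\<forall>\<^sub>F z in at 0. (g z / z) / (h z / z) = g z / h z"
    by (auto simp: eventually_at_filter)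
  ultimately have limA: "((\<lambda>z. g z / h z) \<longlongrightarrow> A) (at 0)"
    by (rule Lim_transform_eventually)
  have "\<forall>\<^sub>F z in at 0. h z / z \<noteq> 0"
    using lim(2) der(3) tendsto_imp_eventually_ne by blast
  then obtain d where d: "d > 0" "\<And>z. z \<noteq> 0 \<Longrightarrow> norm z < d \<Longrightarrow> h z \<noteq> 0"
    by (auto simp: eventually_at dist_norm)
  have "(\<lambda>y. if y = 0 then A else g y / h y) holomorphic_on ball 0 d"
    using d limA by (intro removable_singularity holomorphic_intros holomorphic_on_subset[OF hol(1)]
        holomorphic_on_subset[OF hol(2)]) auto
  hence "f holomorphic_on ball 0 d"
    by (rule holomorphic_transform) (use d h0 in \<open>auto simp: f_def\<close>)
  hence an0: "f analytic_on {0}" using d by (auto simp: analytic_at intro!: exI[of _ "ball 0 d"])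
  have "f analytic_on {z}" for z
  proof (cases "h z = 0")
    case True
    then obtain m n :: int where z: "z = of_int m + of_int n * t" using zeros by blast
    have "f analytic_on (\<lambda>w. w - z) ` {z}" using an0 by simp
    hence "(f \<circ> (\<lambda>w. w - z)) analytic_on {z}"
      by (intro analytic_on_compose) (auto intro!: analytic_intros)
    moreover have "f \<circ> (\<lambda>w. w - z) = f"
    proof
      fix w show "(f \<circ> (\<lambda>w. w - z)) w = f w"
        using lattice_periodic[of f t "w - z" m n] per by (simp add: z algebra_simps)
    qed
    ultimately show ?thesis by simp
  qed (use an in auto)
  hence "f holomorphic_on UNIV"
    using analytic_imp_holomorphic analytic_on_analytic_at by blast
  from doubly_periodic_entire_const[OF t this per] have *: "f z = A" for z
    using h0 by (metis f_def)
  show ?thesis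
  proof (cases "h z = 0")
    case True
    then obtain m n :: int where z: "z = of_int m + of_int n * t" using zeros by blast
    have "(g (w + 1) = 0) = (g w = 0)" "(g (w + t) = 0) = (g w = 0)" for w
      using per1 per2 by auto
    from lattice_periodic[of "\<lambda>w. g w = 0" t 0 m n, OF this] have "g z = 0"
      using der(4) by (simp add: z)
    thus ?thesis using True by simp
  next
    case False
    thus ?thesis using *[of z] by (auto simp: f_def A_def field_simps split: if_splits)
  qed
qed

text \<open>The division makes the derivative at 0 equal to -2 pi i for every \<open>t\<close>;
  thereby the inversion law acquires the factor 1/t and no multiplier of eta.\<close>

definition ksigma :: "complex \<Rightarrow> complex \<Rightarrow> complex" where
  "ksigma t z = theta t z / eulerP (ee t) ^ 2"

lemma Im_minus_inverse: "Im t > 0 \<Longrightarrow> Im (- 1 / t) > 0"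
proof -
  assume t: "Im t > 0"
  hence "t \<noteq> 0" by auto
  hence "(Re t)\<^sup>2 + (Im t)\<^sup>2 > 0"
    by (metis complex_neq_0)
  thus ?thesis using t by (simp add: Im_divide)
qed

text \<open>Times a Gaussian, the function z -> theta(-1/t, z/t) has the multipliers of
  \<open>theta t\<close> under z + 1 and z + t and vanishes at 0, so it is proportional to
  \<open>theta t\<close>. The constant comes from the derivatives at 0.\<close>

lemma ksigma_inversion:
  assumes t: "Im t > 0"
  shows "ksigma (- 1 / t) (z / t) = ee (z\<^sup>2 / (2 * t)) / t * ksigma t z"
proof -
  define s where "s = - 1 / t"
  have t0: "t \<noteq> 0" using t by auto
  have s: "Im s > 0" unfolding s_def by (rule Im_minus_inverse[OF t])
  define g where "g = (\<lambda>z. theta s (z / t) * ee (- z\<^sup>2 / (2 * t)))"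
  define a where "a = - 2 * of_real pi * \<i> * eulerP (ee t) ^ 2"
  define b where "b = - 2 * of_real pi * \<i> * eulerP (ee s) ^ 2"
  have "g z = (b / t) / a * theta t z"
  proof (rule quasi_periodic_proportional[OF t, where g = g and h = "theta t" and ?g' = "b / t"
        and ?h' = a and z = z and ?m1.0 = "\<lambda>_. -1" and ?m2.0 = "\<lambda>z. - ee (- z - t / 2)"])
    show "g holomorphic_on UNIV"
    proof -
      have "(\<lambda>z. z / t) holomorphic_on UNIV" using t0 by (auto intro!: holomorphic_intros)
      from holomorphic_on_compose_gen[OF this holomorphic_theta[OF s]]
      have "(\<lambda>z. theta s (z / t)) holomorphic_on UNIV" by (simp add: o_def)
      thus "g holomorphic_on UNIV" unfolding g_def
        using t0 by (auto intro!: holomorphic_intros)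
    qed
    have "((\<lambda>z. theta s (z / t)) has_field_derivative (b * (1 / t))) (at 0)"
    proof (rule DERIV_chain2[of "theta s" b "\<lambda>z. z / t" 0 "1 / t"])
      show "((\<lambda>z. z / t) has_field_derivative 1 / t) (at 0)"
        using t0 by (auto intro!: derivative_eq_intros)
    qed (use theta_deriv_0[OF s] in \<open>simp add: b_def\<close>)
    thus "(g has_field_derivative (b / t)) (at 0)"
      unfolding g_def ee_def using t0 by (auto intro!: derivative_eq_intros)
    show "(theta t has_field_derivative a) (at 0)" unfolding a_def by (rule theta_deriv_0[OF t])
    show "a \<noteq> 0" using eulerP_nonzero[OF norm_ee_less_1[OF t]] by (simp add: a_def)
    have "theta s 0 = 0" unfolding theta_eq_0_iff[OF s] by (intro exI[of _ 0]) simp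
    thus "g 0 = 0" by (simp add: g_def)
    show "g (z + 1) = (\<lambda>_. -1) z * g z" for z
    proof -
      have eq: "(z + 1) / t + s = z / t" "- ((z + 1) / t) - s / 2 = - (z / t) + s / 2"
        by (simp_all add: s_def add_divide_distrib)
      have *: "theta s (z / t) = - ee (- (z / t) + s / 2) * theta s ((z + 1) / t)"
        using theta_add_tau[OF s, of "(z + 1) / t"] unfolding eq .
      have "- (z + 1)\<^sup>2 / (2 * t) = - z\<^sup>2 / (2 * t) + (- (z / t) + s / 2)"
        using t0 by (simp add: s_def power2_eq_square field_simps)
      hence "ee (- (z + 1)\<^sup>2 / (2 * t)) = ee (- z\<^sup>2 / (2 * t)) * ee (- (z / t) + s / 2)"
        by (metis ee_add)
      thus ?thesis unfolding g_def * by simp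
    qed
    show "theta t (z + 1) = (\<lambda>_. -1) z * theta t z" for z by (simp add: theta_add_1)
    show "g (z + t) = (\<lambda>z. - ee (- z - t / 2)) z * g z" for z
    proof -
      have "(z + t) / t = z / t + 1" using t0 by (simp add: add_divide_distrib)
      moreover have "- (z + t)\<^sup>2 / (2 * t) = - z\<^sup>2 / (2 * t) + (- z - t / 2)"
        using t0 by (simp add: power2_eq_square field_simps)
      hence "ee (- (z + t)\<^sup>2 / (2 * t)) = ee (- z\<^sup>2 / (2 * t)) * ee (- z - t / 2)"
        by (metis ee_add)
      ultimately show ?thesis unfolding g_def by (simp add: theta_add_1)
    qed
    show "theta t (z + t) = (\<lambda>z. - ee (- z - t / 2)) z * theta t z" for z
      by (simp add: theta_add_tau[OF t])
  qed (auto simp: holomorphic_theta t theta_eq_0_iff)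
  hence "theta s (z / t) = ee (z\<^sup>2 / (2 * t)) * ((b / t) / a * theta t z)"
    by (simp add: g_def ee_uminus field_simps)
  hence "theta s (z / t) = (b / a) * (ee (z\<^sup>2 / (2 * t)) / t * theta t z)"
    by (simp add: mult_ac)
  moreover have "b / a = eulerP (ee s) ^ 2 / eulerP (ee t) ^ 2"
    by (simp add: a_def b_def)
  moreover have "eulerP (ee s) \<noteq> 0" by (rule eulerP_nonzero[OF norm_ee_less_1[OF s]])
  ultimately show ?thesis unfolding ksigma_def s_def[symmetric]
    by (simp add: field_simps)
qed

section \<open>Klein forms of level 3\<close>

definition mob :: "int \<Rightarrow> int \<Rightarrow> int \<Rightarrow> int \<Rightarrow> complex \<Rightarrow> complex" where
  "mob a b c d t = (of_int a * t + of_int b) / (of_int c * t + of_int d)"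

text \<open>The rules are right multiplication by T, its inverse and S, the side on which
  \<open>mob\<close> composes with a substitution in \<open>t\<close>. The Euclidean algorithm on
  the bottom row shrinks \<open>c\<close> until the matrix is plus or minus a power of T.\<close>

lemma sl2z_induct [consumes 1, case_names one T T' S]:
  assumes det: "a * d - b * c = (1 :: int)"
  assumes one: "P 1 0 0 1"
    and T: "\<And>a b c d. P a b c d \<Longrightarrow> P a (a + b) c (c + d)"
    and T': "\<And>a b c d. P a b c d \<Longrightarrow> P a (b - a) c (d - c)"
    and S: "\<And>a b c d. P a b c d \<Longrightarrow> P b (- a) d (- c)"
  shows "P a b c d"
proof -
  have Tk: "P a (b + k * a) c (d + k * c)" if "P a b c d" for a b c d k
  proof (induction k rule: int_induct[of _ 0])
    case (step1 i) thus ?case using T[of a "b + i * a" c "d + i * c"] by (simp add: algebra_simps)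
  next
    case (step2 i) thus ?case using T'[of a "b + i * a" c "d + i * c"] by (simp add: algebra_simps)
  qed (use that in simp)
  show ?thesis using det
  proof (induction "nat \<bar>c\<bar>" arbitrary: a b c d rule: less_induct)
    case less
    show ?case
    proof (cases "c = 0")
      case True
      hence "a = 1 \<and> d = 1 \<or> a = -1 \<and> d = -1"
        using less.prems by (simp add: zmult_eq_1_iff)
      moreover have "P 1 b 0 1" using Tk[OF one, of b] by simp
      moreover have "P (-1) b 0 (-1)" using Tk[OF S[OF S[OF one]], of "-b"] by simp
      ultimately show ?thesis using True by auto
    next
      case False
      define k where "k = d div c"
      define b' where "b' = b - k * a"
      define d' where "d' = d - k * c"
      have d': "d' = d mod c" by (simp add: d'_def k_def minus_div_mult_eq_mod)
      have "P b' (- a) d' (- c)"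
      proof (rule less.hyps)
        show "nat \<bar>d'\<bar> < nat \<bar>c\<bar>" using False abs_mod_less[of c d] by (simp add: d')
        show "b' * (- c) - (- a) * d' = 1"
          using less.prems by (simp add: b'_def d'_def algebra_simps)
      qed
      \<comment> \<open>S has order 4, so three more applications undo the one made above.\<close>
      hence "P a b' c d'" using S[OF S[OF S]] by fastforce
      from Tk[OF this, of k] show ?thesis by (simp add: b'_def d'_def)
    qed
  qed
qed

lemma Im_mob_pos:
  assumes "a * d - b * c = 1" "Im t > 0"
  shows "Im (mob a b c d t) > 0" "of_int c * t + of_int d \<noteq> 0"
    "Im (mob a b c d t) = Im t / norm (of_int c * t + of_int d) ^ 2"
proof -
  show nz: "of_int c * t + of_int d \<noteq> 0"
  proof
    assume eq: "of_int c * t + of_int d = 0"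
    hence "Im (of_int c * t + of_int d) = 0" "Re (of_int c * t + of_int d) = 0" by simp_all
    hence "c = 0" "d = 0" using assms(2) by auto
    thus False using assms(1) by simp
  qed
  have det: "real_of_int a * real_of_int d - real_of_int b * real_of_int c = 1"
    using assms(1) by (metis of_int_1 of_int_diff of_int_mult)
  have "Im (mob a b c d t) = (real_of_int a * real_of_int d - real_of_int b * real_of_int c) * Im t
      / norm (of_int c * t + of_int d) ^ 2"
    unfolding mob_def Im_divide cmod_power2 by (simp add: algebra_simps)
  thus eq: "Im (mob a b c d t) = Im t / norm (of_int c * t + of_int d) ^ 2" by (simp add: det)
  show "Im (mob a b c d t) > 0" using nz assms(2) by (simp add: eq)
qed

text \<open>
  The Klein form at the 3-division point \<open>(r t + s) / 3\<close>. Its cube is periodic in \<open>(r, s)\<close> modulo 3 up to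
  sign, because cubing removes the cube roots of unity.
\<close>

definition klein :: "int \<Rightarrow> int \<Rightarrow> complex \<Rightarrow> complex" where
  "klein r s t = ee (of_int r * ((of_int r * t + of_int s) / 3) / 6) * ksigma t ((of_int r * t + of_int s) / 3)"

definition kap :: "int \<Rightarrow> int \<Rightarrow> complex \<Rightarrow> complex" where
  "kap r s t = klein r s t ^ 3"

lemma ksigma_T: "ksigma (t + 1) z = ksigma t z"
  using ee_add[of "t - z" 1] by (simp add: ksigma_def theta_def ee_add algebra_simps)

lemma kap_T: "kap r s (t + 1) = kap r (r + s) t"
proof -
  have eq: "(of_int r * (t + 1) + of_int s) / 3 = (of_int r * t + of_int (r + s)) / 3"
    by (simp add: algebra_simps)
  show ?thesis unfolding kap_def klein_def eq ksigma_T ..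
qed

lemma kap_T': "kap r s (t - 1) = kap r (s - r) t"
  using kap_T[of r "s - r" "t - 1"] by simp

lemma kap_S:
  assumes "Im t > 0"
  shows "kap r s (- 1 / t) = kap s (- r) t / t ^ 3"
proof -
  have t0: "t \<noteq> 0" using assms by auto
  define z where "z = (of_int s * t + of_int (- r)) / 3"
  have 1: "(of_int r * (- 1 / t) + of_int s) / 3 = z / t"
    using t0 by (simp add: z_def field_simps)
  have "of_int r * (z / t) / 6 + z\<^sup>2 / (2 * t) = of_int s * z / 6"
    using t0 by (simp add: z_def field_simps power2_eq_square)
  hence "ee (of_int r * (z / t) / 6) * ee (z\<^sup>2 / (2 * t)) = ee (of_int s * z / 6)"
    by (simp only: ee_add[symmetric])
  hence "klein r s (- 1 / t) = klein s (- r) t / t"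
    unfolding klein_def 1 ksigma_inversion[OF assms] z_def[symmetric] by simp
  thus ?thesis by (simp add: kap_def power_divide)
qed

text \<open>The generators suffice: the induction hypothesis is applied at t + 1, t - 1 or -1/t,
  which is why \<open>t\<close> stays arbitrary.\<close>

lemma kap_mob:
  assumes "a * d - b * c = 1" "Im t > 0"
  shows "kap r s (mob a b c d t) = kap (r * a + s * c) (r * b + s * d) t / (of_int c * t + of_int d) ^ 3"
  using assms
proof (induction arbitrary: t rule: sl2z_induct)
  case one
  thus ?case by (simp add: mob_def)
next
  case (T a b c d)
  have 1: "mob a (a + b) c (c + d) t = mob a b c d (t + 1)"
    by (simp add: mob_def algebra_simps)
  have 2: "of_int c * (t + 1) + of_int d = of_int c * t + (of_int (c + d) :: complex)"
    by (simp add: algebra_simps)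
  have 3: "r * a + s * c + (r * b + s * d) = r * (a + b) + s * (c + d)"
    by (simp add: algebra_simps)
  show ?case unfolding 1 using T(1)[of "t + 1"] T(2) unfolding kap_T 2 3 by simp
next
  case (T' a b c d)
  have 1: "mob a (b - a) c (d - c) t = mob a b c d (t - 1)"
    by (simp add: mob_def algebra_simps)
  have 2: "of_int c * (t - 1) + of_int d = of_int c * t + (of_int (d - c) :: complex)"
    by (simp add: algebra_simps)
  have 3: "r * b + s * d - (r * a + s * c) = r * (b - a) + s * (d - c)"
    by (simp add: algebra_simps)
  show ?case unfolding 1 using T'(1)[of "t - 1"] T'(2) unfolding kap_T' 2 3 by simp
next
  case (S a b c d)
  have t0: "t \<noteq> 0" using S(2) by auto
  have 1: "of_int c * (- 1 / t) + of_int d = (of_int d * t + of_int (- c)) / t"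
    using t0 by (simp add: field_simps)
  have "of_int a * (- 1 / t) + of_int b = (of_int b * t + of_int (- a)) / t"
    using t0 by (simp add: field_simps)
  hence "mob a b c d (- 1 / t) = mob b (- a) d (- c) t"
    unfolding mob_def 1 using t0 by simp
  with S(1)[OF Im_minus_inverse[OF S(2)]] show ?case
    unfolding 1 kap_S[OF S(2)] using t0 by (simp add: power_divide)
qed

lemma ksigma_add_1: "ksigma t (z + 1) = - ksigma t z"
  by (simp add: ksigma_def theta_add_1)

lemma kap_uminus: "Im t > 0 \<Longrightarrow> kap (- r) (- s) t = - kap r s t"
proof -
  assume t: "Im t > 0"
  define z where "z = (of_int r * t + of_int s) / 3"
  have 1: "(of_int (- r) * t + of_int (- s)) / 3 = - z"
    by (simp add: z_def field_simps)
  have 2: "of_int (- r) * (- z) / 6 = of_int r * z / 6" by simp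
  have "ksigma t (- z) = - ksigma t z"
    by (simp add: ksigma_def theta_uminus[OF t])
  hence "klein (- r) (- s) t = - klein r s t"
    unfolding klein_def 1 2 z_def[symmetric] by simp
  thus ?thesis by (simp add: kap_def)
qed

lemma ee_half_int: "ee (of_int r / 2) = (if even r then 1 else -1)"
proof (cases "even r")
  case True
  then obtain k where "r = 2 * k" by blast
  thus ?thesis by simp
next
  case False
  then obtain k where "r = 2 * k + 1" by (elim oddE)
  hence 1: "of_int r / 2 = (of_int k + 1 / 2 :: complex)" by (simp add: field_simps)
  show ?thesis using False unfolding 1 by (simp add: ee_add ee_half del: divide_inverse)
qed

lemma kap_add3_right: "kap r (s + 3) t = (if even r then -1 else 1) * kap r s t"
proof -
  define z where "z = (of_int r * t + of_int s) / 3"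
  have 1: "(of_int r * t + of_int (s + 3)) / 3 = z + 1" by (simp add: z_def field_simps)
  have 2: "of_int r * (z + 1) / 6 = of_int r * z / 6 + of_int r / 6" by (simp add: field_simps)
  have "klein r (s + 3) t = - ee (of_int r / 6) * klein r s t"
    unfolding klein_def 1 z_def[symmetric] 2 by (simp add: ee_add ksigma_add_1)
  moreover have "ee (of_int r / 6) ^ 3 = ee (of_int r / 2)" by (simp add: ee_power)
  ultimately show ?thesis by (simp add: kap_def power_mult_distrib ee_half_int)
qed

lemma kap_add3_left:
  assumes "Im t > 0"
  shows "kap (r + 3) s t = (if even s then -1 else 1) * kap r s t"
proof -
  define z where "z = (of_int r * t + of_int s) / 3"
  have 1: "(of_int (r + 3) * t + of_int s) / 3 = z + t" by (simp add: z_def field_simps)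
  have 2: "of_int (r + 3) * (z + t) / 6 + (- z - t / 2) = of_int r * z / 6 - of_int s / 6"
    by (simp add: z_def field_simps)
  have "ksigma t (z + t) = - ee (- z - t / 2) * ksigma t z"
    by (simp add: ksigma_def theta_add_tau[OF assms])
  hence "klein (r + 3) s t = - (ee (of_int (r + 3) * (z + t) / 6) * ee (- z - t / 2)) * ksigma t z"
    unfolding klein_def 1 by simp
  also have "ee (of_int (r + 3) * (z + t) / 6) * ee (- z - t / 2) = ee (of_int r * z / 6) * inverse (ee (of_int s / 6))"
    unfolding ee_add[symmetric] 2 unfolding ee_diff by (rule divide_inverse)
  finally have "klein (r + 3) s t = - inverse (ee (of_int s / 6)) * klein r s t"
    unfolding klein_def z_def[symmetric] by simp
  moreover have "ee (of_int s / 6) ^ 3 = ee (of_int s / 2)" by (simp add: ee_power)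
  ultimately show ?thesis by (simp add: kap_def power_mult_distrib ee_half_int power_inverse)
qed

lemma kap_add_right: "kap r (s + 3 * n) t = (if even (n * (r + 1)) then 1 else -1) * kap r s t"
proof (induction n rule: int_induct[of _ 0])
  case (step1 i)
  have "s + 3 * (i + 1) = s + 3 * i + 3" by simp
  thus ?case unfolding \<open>s + 3 * (i + 1) = _\<close> kap_add3_right step1(2) by auto
next
  case (step2 i)
  have "s + 3 * i = s + 3 * (i - 1) + 3" by simp
  hence "kap r (s + 3 * i) t = (if even r then -1 else 1) * kap r (s + 3 * (i - 1)) t"
    by (simp only: kap_add3_right)
  hence "kap r (s + 3 * (i - 1)) t = (if even r then -1 else 1) * kap r (s + 3 * i) t"
    by (cases "even r") (simp_all only: if_True if_False mult_minus_left mult_1 minus_minus)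
  thus ?case unfolding step2(2) by (cases "even i"; cases "even r") simp_all
qed simp

lemma kap_add_left:
  assumes "Im t > 0"
  shows "kap (r + 3 * n) s t = (if even (n * (s + 1)) then 1 else -1) * kap r s t"
proof (induction n rule: int_induct[of _ 0])
  case (step1 i)
  have "r + 3 * (i + 1) = r + 3 * i + 3" by simp
  thus ?case unfolding \<open>r + 3 * (i + 1) = _\<close> kap_add3_left[OF assms] step1(2) by auto
next
  case (step2 i)
  have "r + 3 * i = r + 3 * (i - 1) + 3" by simp
  hence "kap (r + 3 * i) s t = (if even s then -1 else 1) * kap (r + 3 * (i - 1)) s t"
    by (simp only: kap_add3_left[OF assms])
  hence "kap (r + 3 * (i - 1)) s t = (if even s then -1 else 1) * kap (r + 3 * i) s t"
    by (cases "even s") (simp_all only: if_True if_False mult_minus_left mult_1 minus_minus)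
  thus ?case unfolding step2(2) by (cases "even i"; cases "even s") simp_all
qed simp

definition gam3 :: "int \<Rightarrow> int \<Rightarrow> int \<Rightarrow> int \<Rightarrow> bool" where
  "gam3 a b c d \<longleftrightarrow> a * d - b * c = 1 \<and> a mod 3 = 1 \<and> 3 dvd b \<and> 3 dvd c \<and> d mod 3 = 1"

text \<open>Reducing the indices modulo 3 produces signs. They cancel because the determinant is
  odd, so exactly one of \<open>a * d\<close> and \<open>b * c\<close> is odd.\<close>

lemma kap_gam3:
  assumes "gam3 a b c d" "Im t > 0"
  shows "kap a b t = kap 1 0 t" "kap c d t = kap 0 1 t"
proof -
  obtain b' c' where bc: "b = 3 * b'" "c = 3 * c'" using assms(1) unfolding gam3_def by (elim conjE dvdE)
  have "a = 1 + 3 * (a div 3)" "d = 1 + 3 * (d div 3)"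
    using assms(1) div_mult_mod_eq[of a 3] div_mult_mod_eq[of d 3] by (simp_all add: gam3_def)
  then obtain a' d' where ad: "a = 1 + 3 * a'" "d = 1 + 3 * d'" by blast
  have "a * d - b * c = 1" using assms(1) by (simp add: gam3_def)
  hence "odd (a * d - b * c)" by simp
  hence par: "odd (a * d) \<noteq> odd (b * c)" by auto
  have "kap a b t = (if even (a' * (b + 1)) then 1 else -1) * kap 1 b t"
    unfolding ad using kap_add_left[OF assms(2), of 1 a' b] by simp
  also have "kap 1 b t = kap 1 0 t"
    using kap_add_right[of 1 0 b' t] by (simp add: bc)
  finally show "kap a b t = kap 1 0 t"
    using par by (auto simp: ad bc)
  have "kap c d t = (if even (c' * (d + 1)) then 1 else -1) * kap 0 d t"
    unfolding bc using kap_add_left[OF assms(2), of 0 c' d] by simp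
  also have "kap 0 d t = (if even d' then 1 else -1) * kap 0 1 t"
    using kap_add_right[of 0 1 d' t] by (simp add: ad)
  finally show "kap c d t = kap 0 1 t"
    using par by (auto simp: ad bc split: if_splits)
qed

section \<open>Klein forms as eta quotients\<close>

definition kc :: complex where "kc = (ee (- 1 / 6) * (1 - omg)) ^ 3"

lemma ee_third: "ee (1 / 3) = omg"
  by (simp add: ee_def omg_def)

lemma omg_cube': "omg * (omg * omg) = 1" "omg * omg\<^sup>2 = 1" "inverse omg = omg\<^sup>2"
proof -
  show "omg * (omg * omg) = 1" using omg_cube by (simp add: power3_eq_cube mult_ac)
  thus "omg * omg\<^sup>2 = 1" by (simp add: power2_eq_square)
  thus "inverse omg = omg\<^sup>2" by (rule inverse_unique)
qed

text \<open>Since \<open>ee (- 1 / 6) * omg\<close> is e(1/6), the base of the cube is -i sqrt 3 and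
  \<open>kc\<close> itself is 3 i sqrt 3. The square produces the 27 in \<open>wH_S\<close>.\<close>

lemma kc_square: "kc\<^sup>2 = -27"
proof -
  have "(ee (- 1 / 6))\<^sup>2 = inverse (ee (1 / 3))"
    by (simp add: ee_power ee_uminus[symmetric])
  hence "(ee (- 1 / 6))\<^sup>2 = omg\<^sup>2" by (simp add: ee_third omg_cube')
  moreover have "(1 - omg)\<^sup>2 = (omg\<^sup>2 + omg + 1) - 3 * omg"
    by (simp add: power2_eq_square algebra_simps)
  hence "(1 - omg)\<^sup>2 = - 3 * omg" by (simp add: omg_sum)
  ultimately have "(ee (- 1 / 6) * (1 - omg))\<^sup>2 = - 3 * (omg * omg\<^sup>2)"
    by (simp add: power_mult_distrib)
  hence "(ee (- 1 / 6) * (1 - omg))\<^sup>2 = - 3" by (simp add: omg_cube')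
  hence "((ee (- 1 / 6) * (1 - omg))\<^sup>2) ^ 3 = -27" by simp
  thus ?thesis by (simp add: kc_def power_mult[symmetric] mult.commute)
qed

lemma kc_nz [simp]: "kc \<noteq> 0"
  using kc_square by auto

text \<open>
  \<open>qq t\<close> is the \<open>q\<close> of the theorem at \<open>z = t / 3\<close>; in the variable \<open>t\<close> the level is \<open>\<Gamma>(3)\<close>, and
  \<open>wH = \<eta>\<^sup>3(z) / \<eta>\<^sup>3(9 z)\<close>, \<open>bH = \<eta>\<^sup>9(3 z) / \<eta>\<^sup>3(9 z)\<close>, \<open>gH = \<eta>\<^sup>8(3 z)\<close>.
\<close>

definition qq :: "complex \<Rightarrow> complex" where "qq t = ee (t / 3)"

lemma qq_nz [simp]: "qq t \<noteq> 0" by (simp add: qq_def)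

lemma norm_qq: "norm (qq t) = exp (- 2 * pi * Im t / 3)"
  by (simp add: qq_def norm_ee)

lemma norm_qq_less_1: "Im t > 0 \<Longrightarrow> norm (qq t) < 1"
  by (simp add: norm_qq)

lemma qq_cube: "qq t ^ 3 = ee t"
  by (simp add: qq_def ee_power)

lemma qq_T: "qq (t + 1) = omg * qq t"
  by (simp add: qq_def add_divide_distrib ee_add ee_third)

definition wq :: "complex \<Rightarrow> complex" where "wq q = eulerP q ^ 3 / (q * eulerP (q ^ 9) ^ 3)"
definition bq :: "complex \<Rightarrow> complex" where "bq q = eulerP (q ^ 3) ^ 9 / eulerP (q ^ 9) ^ 3"
definition gq :: "complex \<Rightarrow> complex" where "gq q = q * eulerP (q ^ 3) ^ 8"

definition wH :: "complex \<Rightarrow> complex" where "wH t = wq (qq t)"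
definition bH :: "complex \<Rightarrow> complex" where "bH t = bq (qq t)"
definition gH :: "complex \<Rightarrow> complex" where "gH t = gq (qq t)"
definition lH :: "complex \<Rightarrow> complex" where "lH t = wH t + 3"

lemma norm_qq_power_less_1: "Im t > 0 \<Longrightarrow> n > 0 \<Longrightarrow> norm (qq t ^ n) < 1"
  using norm_qq_less_1[of t] by (simp add: norm_power power_less_one_iff)

lemma eulerP_qq_nz: "Im t > 0 \<Longrightarrow> n > 0 \<Longrightarrow> eulerP (qq t ^ n) \<noteq> 0"
  by (intro eulerP_nonzero norm_qq_power_less_1)

text \<open>At the division point 1/3 the arguments are \<open>omg\<close> and its square times
  powers of \<open>ee t\<close>; with the Euler product itself they form a full set of cube roots of
  unity, and \<open>qpoch_cube\<close> applies.\<close>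

lemma kap_0_1:
  assumes "Im t > 0"
  shows "kap 0 1 t = kc * eulerP (qq t ^ 9) ^ 3 / eulerP (qq t ^ 3) ^ 9"
proof -
  define Q where "Q = qq t ^ 3"
  have Q: "norm Q < 1" "ee t = Q" unfolding Q_def
    using norm_qq_power_less_1[OF assms, of 3] by (simp_all add: qq_cube)
  have nz: "eulerP Q \<noteq> 0" by (rule eulerP_nonzero[OF Q(1)])
  have e1: "ee (t - 1 / 3) = omg\<^sup>2 * Q"
    unfolding ee_diff Q(2) ee_third divide_inverse[of Q] omg_cube' by (rule mult.commute)
  have "theta t (1 / 3) = ee (- 1 / 6) * qpoch omg Q * qpoch (omg\<^sup>2 * Q) Q"
    by (simp add: theta_def ee_third Q(2) e1)
  also have "qpoch omg Q = (1 - omg) * qpoch (omg * Q) Q" by (rule qpoch_unfold[OF Q(1)])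
  finally have "theta t (1 / 3) * eulerP Q = ee (- 1 / 6) * (1 - omg) *
      (eulerP Q * qpoch (omg * Q) Q * qpoch (omg\<^sup>2 * Q) Q)" by (simp add: mult_ac)
  also have "eulerP Q * qpoch (omg * Q) Q * qpoch (omg\<^sup>2 * Q) Q = eulerP (Q ^ 3)"
    using qpoch_cube[OF Q(1), of Q] by (simp add: eulerP_def)
  finally have "klein 0 1 t = ee (- 1 / 6) * (1 - omg) * eulerP (Q ^ 3) / eulerP Q ^ 3"
    using nz by (simp add: klein_def ksigma_def Q(2) field_simps power3_eq_cube power2_eq_square)
  thus ?thesis
    by (simp add: kap_def kc_def Q_def power_divide power_mult_distrib power_mult[symmetric])
qed

text \<open>At t/3 the arguments are q and q^2 with base q^3, so the Euler product in q^3 completes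
  them to a trisection of the Euler product in q.\<close>

lemma kap_1_0:
  assumes "Im t > 0"
  shows "kap 1 0 t = eulerP (qq t) ^ 3 / (qq t * eulerP (qq t ^ 3) ^ 9)"
proof -
  define q where "q = qq t"
  have q: "norm q < 1" "norm (q ^ 3) < 1" "ee t = q ^ 3" "ee (t / 3) = q" unfolding q_def
    using norm_qq_power_less_1[OF assms, of 3] norm_qq_less_1[OF assms] by (simp_all add: qq_cube) (simp add: qq_def)
  have nz: "eulerP (q ^ 3) \<noteq> 0" by (rule eulerP_nonzero[OF q(2)])
  have e1: "ee (t - t / 3) = q\<^sup>2" 
  proof -
    have "t - t / 3 = of_nat 2 * (t / 3)" by simp
    thus ?thesis by (simp only: ee_power[symmetric] q(4))
  qed
  have "theta t (t / 3) = ee (- (t / 3) / 2) * (qpoch q (q ^ 3) * qpoch (q\<^sup>2) (q ^ 3))"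
    unfolding theta_def e1 q by simp
  hence "theta t (t / 3) * eulerP (q ^ 3) = ee (- (t / 3) / 2) * eulerP q"
    using eulerP_trisect[OF q(1)] by (simp add: mult_ac)
  hence "klein 1 0 t = ee ((t / 3) / 6) * ee (- (t / 3) / 2) * eulerP q / eulerP (q ^ 3) ^ 3"
    using nz by (simp add: klein_def ksigma_def q field_simps power3_eq_cube power2_eq_square)
  also have "ee ((t / 3) / 6) * ee (- (t / 3) / 2) = ee (- t / 9)"
    unfolding ee_add[symmetric] by (rule arg_cong[of _ _ ee]) (simp add: field_simps)
  finally have "kap 1 0 t = ee (- t / 9) ^ 3 * eulerP q ^ 3 / eulerP (q ^ 3) ^ 9"
    by (simp add: kap_def power_divide power_mult_distrib power_mult[symmetric])
  also have "ee (- t / 9) ^ 3 = inverse q"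
    by (simp add: ee_power q_def qq_def ee_uminus[symmetric])
  finally show ?thesis by (simp add: q_def field_simps)
qed

lemma kap_nz:
  assumes "Im t > 0"
  shows "kap 0 1 t \<noteq> 0" "kap 1 0 t \<noteq> 0"
  using eulerP_qq_nz[OF assms, of 9] eulerP_qq_nz[OF assms, of 3] eulerP_qq_nz[OF assms, of 1]
  by (simp_all add: kap_0_1 kap_1_0 assms)

lemma bH_kap: "Im t > 0 \<Longrightarrow> bH t = kc / kap 0 1 t"
  by (simp add: bH_def bq_def kap_0_1)

lemma wH_kap: "Im t > 0 \<Longrightarrow> wH t = kc * kap 1 0 t / kap 0 1 t"
  using eulerP_qq_nz[of t 3] by (simp add: wH_def wq_def kap_0_1 kap_1_0)

lemma wH_nz: "Im t > 0 \<Longrightarrow> wH t \<noteq> 0" and bH_nz: "Im t > 0 \<Longrightarrow> bH t \<noteq> 0"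
  by (simp_all add: wH_kap bH_kap kap_nz)

lemma wH_mob: "a * d - b * c = 1 \<Longrightarrow> Im t > 0 \<Longrightarrow> wH (mob a b c d t) = kc * kap a b t / kap c d t"
  using Im_mob_pos(1,2)[of a d b c t] by (simp add: wH_kap kap_mob)

lemma bH_mob: "a * d - b * c = 1 \<Longrightarrow> Im t > 0 \<Longrightarrow> bH (mob a b c d t) = (of_int c * t + of_int d) ^ 3 * kc / kap c d t"
  using Im_mob_pos(1,2)[of a d b c t] by (simp add: bH_kap kap_mob)

lemma wH_gam3: "gam3 a b c d \<Longrightarrow> Im t > 0 \<Longrightarrow> wH (mob a b c d t) = wH t"
  using kap_gam3[of a b c d t] by (simp add: wH_mob wH_kap gam3_def)

lemma bH_gam3: "gam3 a b c d \<Longrightarrow> Im t > 0 \<Longrightarrow> bH (mob a b c d t) = (of_int c * t + of_int d) ^ 3 * bH t"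
  using kap_gam3[of a b c d t] by (simp add: bH_mob bH_kap gam3_def)

lemma mob_S: "mob 0 (-1) 1 0 t = - 1 / t" by (simp add: mob_def)

text \<open>S exchanges the two division points up to sign and hence inverts the quotient of Klein
  forms; the constant is minus the square of \<open>kc\<close>.\<close>

lemma wH_S:
  assumes "Im t > 0"
  shows "wH (- 1 / t) = 27 / wH t"
proof -
  have "wH (- 1 / t) = - (kc * kap 0 1 t) / kap 1 0 t"
    using wH_mob[of 0 0 "-1" 1 t] kap_uminus[OF assms, of 0 1] assms by (simp add: mob_S)
  also have "\<dots> = - kc\<^sup>2 / wH t"
    using kap_nz[OF assms] by (simp add: wH_kap assms power2_eq_square)
  finally show ?thesis by (simp add: kc_square)
qed

lemma bH_S:
  assumes "Im t > 0"
  shows "bH (- 1 / t) = t ^ 3 * kc * bH t / wH t"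
  using bH_mob[of 0 0 "-1" 1 t] kap_nz[OF assms] by (simp add: mob_S assms bH_kap wH_kap)

section \<open>Liouville's theorem for the principal congruence subgroup of level 3\<close>

text \<open>The real part of \<open>t\<close> is free, so this corresponds to q -> 0 in every
  direction.\<close>

abbreviation ioo :: "complex filter" where "ioo \<equiv> filtercomap Im at_top"

abbreviation uhp :: "complex set" where "uhp \<equiv> {t. Im t > 0}"

lemma open_uhp: "open uhp"
  by (rule open_halfspace_Im_gt)

lemma eventually_ioo: "eventually P ioo \<longleftrightarrow> (\<exists>Y. \<forall>t. Im t > Y \<longrightarrow> P t)"
proof -
  have "eventually P ioo \<longleftrightarrow> (\<exists>Q. (\<exists>Y. \<forall>y>Y. Q y) \<and> (\<forall>x. Q (Im x) \<longrightarrow> P x))"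
    unfolding eventually_filtercomap eventually_at_top_dense ..
  also have "\<dots> \<longleftrightarrow> (\<exists>Y. \<forall>t. Im t > Y \<longrightarrow> P t)"
  proof
    assume "\<exists>Y. \<forall>t. Im t > Y \<longrightarrow> P t"
    then obtain Y where "\<forall>t. Im t > Y \<longrightarrow> P t" ..
    thus "\<exists>Q. (\<exists>Y. \<forall>y>Y. Q y) \<and> (\<forall>x. Q (Im x) \<longrightarrow> P x)"
      by (intro exI[of _ "\<lambda>y. y > Y"]) auto
  qed auto
  finally show ?thesis .
qed

lemma eventually_ioo_gt: "eventually (\<lambda>t. Im t > Y) ioo"
  unfolding eventually_ioo by auto

lemma filterlim_qq: "filterlim qq (at 0) ioo"
proof -
  have "((\<lambda>y. exp (- 2 * pi * y / 3)) \<longlongrightarrow> 0) at_top"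
    using pi_gt_zero by real_asymp
  hence "((\<lambda>t. norm (qq t)) \<longlongrightarrow> 0) ioo"
    unfolding norm_qq by (rule filterlim_compose) (rule filterlim_filtercomap)
  thus ?thesis
    by (auto simp: filterlim_at tendsto_norm_zero_iff)
qed

text \<open>A right inverse of \<open>qq\<close> from the principal logarithm. It jumps by 3 along
  the negative axis, which functions of period 3 do not see.\<close>

definition qinv :: "complex \<Rightarrow> complex" where "qinv q = 3 * Ln q / (2 * of_real pi * \<i>)"

lemma qq_qinv: "q \<noteq> 0 \<Longrightarrow> qq (qinv q) = q"
  by (simp add: qq_def qinv_def ee_def)

lemma Im_qinv: "q \<noteq> 0 \<Longrightarrow> Im (qinv q) = - 3 * ln (norm q) / (2 * pi)"
  by (simp add: qinv_def Im_divide power2_eq_square field_simps)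

lemma Im_qinv_pos: "q \<noteq> 0 \<Longrightarrow> norm q < 1 \<Longrightarrow> Im (qinv q) > 0"
  by (simp add: Im_qinv divide_less_0_iff mult_less_0_iff)

lemma filterlim_qinv: "filterlim qinv ioo (at 0)"
  unfolding filterlim_filtercomap_iff
proof -
  have "filterlim (\<lambda>q::complex. norm q) (at_right 0) (at 0)"
    by (auto simp: filterlim_at eventually_at_filter intro!: tendsto_eq_intros)
  moreover have "filterlim (\<lambda>x. - 3 * ln x / (2 * pi)) at_top (at_right 0)"
    using pi_gt_zero by real_asymp
  ultimately have "filterlim (\<lambda>q::complex. - 3 * ln (norm q) / (2 * pi)) at_top (at 0)"
    by (rule filterlim_compose[rotated])
  moreover have ev: "eventually (\<lambda>q. (Im \<circ> qinv) q = - 3 * ln (norm q) / (2 * pi)) (at 0)"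
    by (auto simp: eventually_at_filter Im_qinv)
  ultimately show "filterlim (Im \<circ> qinv) at_top (at 0)"
    unfolding filterlim_cong[OF refl refl ev] by simp
qed

lemma int_periodic3:
  fixes F :: "complex \<Rightarrow> complex"
  assumes per: "\<And>t. Im t > 0 \<Longrightarrow> F (t + 3) = F t" and t: "Im t > 0"
  shows "F (t + 3 * of_int k) = F t"
proof (induction k rule: int_induct[of _ 0])
  case (step1 i)
  thus ?case using per[of "t + 3 * of_int i"] t by (simp add: algebra_simps)
next
  case (step2 i)
  thus ?case using per[of "t + 3 * of_int (i - 1)"] t by (simp add: algebra_simps)
qed simp

lemma periodic_factors_qq:
  assumes hol: "F holomorphic_on uhp" and per: "\<And>t. Im t > 0 \<Longrightarrow> F (t + 3) = F t"
  obtains f where "f holomorphic_on ball 0 1 - {0}" "\<And>t. Im t > 0 \<Longrightarrow> F t = f (qq t)"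
    "\<And>q. q \<noteq> 0 \<Longrightarrow> f q = F (qinv q)"
proof
  define f where "f = (\<lambda>q. F (qinv q))"
  show *: "F t = f (qq t)" if "Im t > 0" for t
  proof -
    have "exp (Ln (qq t)) = exp (2 * of_real pi * \<i> * (t / 3))" by (simp add: qq_def ee_def)
    then obtain k :: int where k: "Ln (qq t) = 2 * of_real pi * \<i> * (t / 3) + of_int (2 * k) * of_real pi * \<i>"
      unfolding exp_eq by auto
    hence "qinv (qq t) = t + 3 * of_int k"
      by (simp add: qinv_def field_simps)
    thus ?thesis using int_periodic3[of F t k] per that by (simp add: f_def)
  qed
  show "f holomorphic_on ball 0 1 - {0}"
  proof (subst analytic_on_open[symmetric], force, rule iffD2[OF analytic_on_analytic_at], rule ballI)
    fix q0 :: complex assume q0: "q0 \<in> ball 0 1 - {0}"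
    define r where "r = min (norm q0) (1 - norm q0)"
    have r: "r > 0" using q0 by (auto simp: r_def)
    \<comment> \<open>Near \<open>q0\<close> the logarithm is taken relative to \<open>q0\<close>,
      so that the branch cut is avoided; by period 3, \<open>F\<close> takes the same values there
      as with \<open>qinv\<close>.\<close>
    define g where "g = (\<lambda>q. 3 * (Ln (q / q0) + Ln q0) / (2 * of_real pi * \<i>))"
    have near: "q \<noteq> 0" "norm q < 1" "q / q0 \<notin> \<real>\<^sub>\<le>\<^sub>0" if "q \<in> ball q0 r" for q
    proof -
      have d: "norm (q0 - q) < norm q0" "norm (q0 - q) < 1 - norm q0"
        using that by (auto simp: r_def dist_norm)
      show "q \<noteq> 0" using d(1) by auto
      show "norm q < 1" using d(2) norm_triangle_ineq3[of q q0] by (simp add: norm_minus_commute)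
      have "norm (1 - q / q0) = norm (q0 - q) / norm q0"
        using q0 by (simp add: norm_divide[symmetric] diff_divide_distrib)
      hence "norm (1 - q / q0) < 1" using d(1) q0 by simp
      hence "Re (1 - q / q0) < 1" using complex_Re_le_cmod[of "1 - q / q0"] by linarith
      thus "q / q0 \<notin> \<real>\<^sub>\<le>\<^sub>0" by (auto elim!: nonpos_Reals_cases)
    qed
    have qg: "qq (g q) = q" if "q \<in> ball q0 r" for q
    proof -
      have "2 * of_real pi * \<i> * (g q / 3) = Ln (q / q0) + Ln q0"
        by (simp add: g_def field_simps)
      hence "qq (g q) = exp (Ln (q / q0) + Ln q0)" unfolding qq_def ee_def by (simp only:)
      thus ?thesis using near(1)[OF that] q0 by (simp add: exp_add)
    qed
    have Img: "Im (g q) > 0" if "q \<in> ball q0 r" for q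
    proof -
      have "exp (- 2 * pi * Im (g q) / 3) < 1" 
        using near(2)[OF that] norm_qq[of "g q"] qg[OF that] by simp
      thus ?thesis by (simp add: zero_less_mult_iff)
    qed
    have "(F \<circ> g) holomorphic_on ball q0 r"
    proof (rule holomorphic_on_compose_gen[OF _ hol])
      show "g holomorphic_on ball q0 r" unfolding g_def
        using near(3) q0 by (intro holomorphic_intros) auto
    qed (use Img in auto)
    hence "f holomorphic_on ball q0 r"
      by (rule holomorphic_transform) (use * Img qg in auto)
    thus "f analytic_on {q0}" using r by (auto simp: analytic_at intro!: exI[of _ "ball q0 r"])
  qed
qed auto

text \<open>The limit excludes a pole. Extending \<open>q * f q\<close> by 0 gives a holomorphic
  function; its derivative at 0 is the limit of \<open>f\<close>, and the singularity of
  \<open>f\<close> is removed.\<close>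

lemma cusp_extension:
  assumes hol: "F holomorphic_on uhp" and per: "\<And>t. Im t > 0 \<Longrightarrow> F (t + 3) = F t"
    and lim: "((\<lambda>t. qq t * F t) \<longlongrightarrow> 0) ioo"
  obtains f where "f holomorphic_on ball 0 1" "\<And>t. Im t > 0 \<Longrightarrow> F t = f (qq t)"
proof -
  obtain f where f: "f holomorphic_on ball 0 1 - {0}" "\<And>t. Im t > 0 \<Longrightarrow> F t = f (qq t)"
    "\<And>q. q \<noteq> 0 \<Longrightarrow> f q = F (qinv q)"
    using periodic_factors_qq[OF hol per] by blast
  have "((\<lambda>q. qq (qinv q) * F (qinv q)) \<longlongrightarrow> 0) (at 0)"
    by (rule filterlim_compose[OF lim filterlim_qinv])
  moreover have "\<forall>\<^sub>F q in at 0. qq (qinv q) * F (qinv q) = q * f q"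
    by (auto simp: eventually_at_filter f(3) qq_qinv)
  ultimately have lim0: "((\<lambda>q. q * f q) \<longlongrightarrow> 0) (at 0)"
    by (rule Lim_transform_eventually)
  define g where "g = (\<lambda>q. if q = 0 then 0 else q * f q)"
  have g: "g holomorphic_on ball 0 1" unfolding g_def
    by (intro removable_singularity lim0) (auto intro!: holomorphic_intros f)
  have "(g has_field_derivative deriv g 0) (at 0)"
    using g by (meson centre_in_ball holomorphic_derivI open_ball zero_less_one)
  hence "((\<lambda>q. g q / q) \<longlongrightarrow> deriv g 0) (at 0)"
    by (simp add: has_field_derivative_iff g_def)
  moreover have "\<forall>\<^sub>F q in at 0. g q / q = f q"
    by (auto simp: eventually_at_filter g_def)
  ultimately have "(f \<longlongrightarrow> deriv g 0) (at 0)"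
    by (rule Lim_transform_eventually)
  hence "(\<lambda>y. if y = 0 then deriv g 0 else f y) holomorphic_on ball 0 1"
    using f(1) by (intro removable_singularity) auto
  from that[OF this] show ?thesis using f(2) by simp
qed

section \<open>Reduction theory for Gamma(3)\<close>

lemma sl2z_to_fundamental:
  assumes t: "Im t > 0"
  obtains a b c d :: int where "a * d - b * c = 1" "Im (mob a b c d t) \<ge> 1 / 5"
proof (cases "Im t \<ge> 1 / 5")
  case True
  thus ?thesis using that[of 1 1 0 0] by (simp add: mob_def)
next
  case False
  define y where "y = Im t"
  have y: "y > 0" "y < 1 / 5" using t False by (auto simp: y_def)
  \<comment> \<open>Dirichlet approximation takes the place of the fundamental domain: with
    denominators up to about y^(-1/2), the bottom row (k, -h) satisfies |k t - h|^2 <= 4 y + y,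
    whence the bound 1/5.\<close>
  define N where "N = nat \<lfloor>1 / sqrt y\<rfloor>"
  have sq: "sqrt y > 0" "sqrt y < 1 / 2"
    using y real_sqrt_less_mono[of y "(1/2)\<^sup>2"] by (simp_all add: power_divide real_sqrt_divide)
  hence ge2: "1 / sqrt y > 2" by (simp add: field_simps)
  have N1: "real N \<le> 1 / sqrt y" "real N > 1 / sqrt y - 1"
    using ge2 unfolding N_def by linarith+
  have N2: "real N > 1 / (2 * sqrt y)" using N1(2) ge2 by (simp add: field_simps)
  have N0: "N > 0" using N2 sq by (metis divide_pos_pos less_trans mult_pos_pos of_nat_0_less_iff zero_less_numeral zero_less_one)
  obtain h k where hk: "coprime h k" "0 < k" "k \<le> int N" "\<bar>of_int k * Re t - of_int h\<bar> < 1 / N"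
    using Dirichlet_approx_coprime[OF N0] by blast
  obtain u v where uv: "u * h + v * k = 1"
    using bezout_int[of h k] hk(1) by auto
  have det: "(- u) * (- h) - (- v) * k = 1" using uv by simp
  define D where "D = of_int k * t + of_int (- h)"
  have sy: "sqrt y ^ 2 = y" using y by simp
  have "(of_int k * Re t - of_int h)\<^sup>2 \<le> (1 / real N)\<^sup>2"
    using hk(4) by (intro abs_le_square_iff[THEN iffD1]) auto
  also have "\<dots> \<le> (2 * sqrt y)\<^sup>2"
    using N2 N0 sq by (intro power_mono) (auto simp: field_simps)
  finally have 1: "(of_int k * Re t - of_int h)\<^sup>2 \<le> 4 * y"
    by (simp add: power_mult_distrib sy)
  have "(real_of_int k * sqrt y)\<^sup>2 \<le> 1\<^sup>2"
  proof (rule power_mono)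
    have "real_of_int k \<le> real N" using hk(3) by linarith
    also have "\<dots> \<le> 1 / sqrt y" by (rule N1)
    finally show "real_of_int k * sqrt y \<le> 1" using sq by (simp add: field_simps)
  qed (use hk sq in auto)
  hence "(real_of_int k)\<^sup>2 * y \<le> 1" using sy by (simp add: power_mult_distrib)
  hence "(real_of_int k)\<^sup>2 * y * y \<le> 1 * y" using y by (intro mult_right_mono) auto
  hence 2: "(real_of_int k * y)\<^sup>2 \<le> y" by (simp add: power2_eq_square mult_ac)
  have "norm D ^ 2 = (of_int k * Re t - of_int h)\<^sup>2 + (real_of_int k * y)\<^sup>2"
    unfolding cmod_power2 by (simp add: D_def y_def)
  hence le: "norm D ^ 2 \<le> 5 * y" using 1 2 by linarith
  have "Im (mob (- u) (- v) k (- h) t) = y / norm D ^ 2"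
    using Im_mob_pos(3)[OF det t] by (simp add: D_def y_def)
  moreover have "D \<noteq> 0" using Im_mob_pos(2)[OF det t] by (simp add: D_def)
  hence "0 < norm D ^ 2" by simp
  hence "y / norm D ^ 2 \<ge> 1 / 5"
    using le by (simp add: field_simps)
  ultimately have "Im (mob (- u) (- v) k (- h) t) \<ge> 1 / 5"
    by simp
  thus ?thesis using that det by blast
qed

lemma mob_inverse:
  assumes "a * d - b * c = 1" "Im t > 0"
  shows "mob d (- b) (- c) a (mob a b c d t) = t"
proof -
  have nz: "of_int c * t + of_int d \<noteq> 0" by (rule Im_mob_pos[OF assms])
  have det: "of_int a * of_int d - of_int b * of_int c = (1 :: complex)"
    using assms(1) by (metis of_int_1 of_int_diff of_int_mult)
  have "of_int d * (of_int a * t + of_int b) + of_int (- b) * (of_int c * t + of_int d) =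
     (of_int a * of_int d - of_int b * of_int c) * t"
    by (simp add: algebra_simps)
  moreover have "of_int (- c) * (of_int a * t + of_int b) + of_int a * (of_int c * t + of_int d) =
     (of_int a * of_int d - of_int b * of_int c)"
    by (simp add: algebra_simps)
  moreover have "(p * (X / Y) + q) / (r * (X / Y) + s) = (p * X + q * Y) / (r * X + s * Y)"
    if "Y \<noteq> 0" for p q r s X Y :: complex
  proof -
    have "p * (X / Y) + q = (p * X + q * Y) / Y" "r * (X / Y) + s = (r * X + s * Y) / Y"
      using that by (simp_all add: field_simps)
    thus ?thesis using that by simp
  qed
  from this[OF nz] have "mob d (- b) (- c) a (mob a b c d t) =
     (of_int d * (of_int a * t + of_int b) + of_int (- b) * (of_int c * t + of_int d)) /
     (of_int (- c) * (of_int a * t + of_int b) + of_int a * (of_int c * t + of_int d))"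
    unfolding mob_def .
  ultimately show ?thesis using det by simp
qed

text \<open>Modulo 3 the matrix is plus or minus a power of T; the exponent is \<open>a * b\<close>
  because the square of \<open>a\<close> is 1 modulo 3.\<close>

lemma gam3_coset_inf:
  assumes "a * d - b * c = 1" "3 dvd c"
  obtains e where "e = 1 \<or> e = - 1" "gam3 (e * a) (e * (b - a * (a * b))) (e * c) (e * (d - c * (a * b)))"
proof -
  obtain c' where c: "c = 3 * c'" using assms(2) by blast
  have "(a * d) mod 3 = (1 + 3 * (b * c')) mod 3" using assms(1) by (simp add: c algebra_simps)
  hence ad: "((a mod 3) * (d mod 3)) mod 3 = 1" by (simp add: mod_mult_eq)
  have "a mod 3 = 0 \<or> a mod 3 = 1 \<or> a mod 3 = 2" "d mod 3 = 0 \<or> d mod 3 = 1 \<or> d mod 3 = 2" by linarith+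
  with ad consider "a mod 3 = 1" "d mod 3 = 1" | "a mod 3 = 2" "d mod 3 = 2" by auto
  thus ?thesis
  proof cases
    case 1
    obtain a' where a: "a = 1 + 3 * a'" using 1(1) by (metis div_mult_mod_eq add.commute mult.commute)
    have "b - a * (a * b) = 3 * (- b * (2 * a' + 3 * a' * a'))" by (simp add: a algebra_simps)
    hence "3 dvd b - a * (a * b)" by (rule dvdI)
    moreover have "(d - c * (a * b)) mod 3 = 1" using 1(2) by (simp add: c mod_diff_eq[symmetric])
    ultimately show ?thesis using 1 assms
      by (intro that[of 1]) (simp_all add: gam3_def, simp add: algebra_simps)
  next
    case 2
    obtain a' where a: "a = 2 + 3 * a'" using 2(1) by (metis div_mult_mod_eq add.commute mult.commute)
    have "- (b - a * (a * b)) = 3 * (b * (1 + 4 * a' + 3 * a' * a'))" by (simp add: a algebra_simps)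
    hence "3 dvd - (b - a * (a * b))" by (rule dvdI)
    hence "3 dvd b - a * (a * b)" by (simp only: dvd_minus_iff)
    moreover have "(- (d - c * (a * b))) mod 3 = 1" 
    proof -
      have "- (d - c * (a * b)) = - d + 3 * (c' * (a * b))" by (simp add: c)
      moreover have "(- d) mod 3 = 1" using 2(2) by presburger
      ultimately show ?thesis by (simp only: mod_mult_self2)
    qed
    moreover have "(- a) mod 3 = 1" using 2 by (simp add: zmod_zminus1_eq_if)
    ultimately show ?thesis using 2 assms
      by (intro that[of "-1"]) (simp_all add: gam3_def dvd_diff_commute, simp add: algebra_simps)
  qed
qed

text \<open>Up to sign the matrix is gamma T^i S T^j with gamma in Gamma(3): \<open>i\<close> is
  a/c, the cusp, and j = \<open>e * d\<close> is d/c, both modulo 3, where \<open>e\<close> is the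
  residue of \<open>c\<close>. The four entries in the conclusion are those of the matrix times the
  inverse of T^i S T^j.\<close>

lemma gam3_coset_0:
  assumes det: "a * d - b * c = 1" and c: "\<not> 3 dvd c"
  obtains e i where "e = 1 \<or> e = - 1" "i \<in> {-1, 0, 1 :: int}"
    "gam3 (e * (a * (e * d) - b)) (e * (a * (1 - i * (e * d)) + b * i))
          (e * (c * (e * d) - d)) (e * (c * (1 - i * (e * d)) + d * i))"
proof -
  have "c mod 3 = 1 \<or> c mod 3 = 2" using c by presburger
  then obtain e where e: "e = 1 \<or> e = - 1" "(c - e) mod 3 = 0"
  proof
    assume "c mod 3 = 1" thus ?thesis by (intro that[of 1]) presburger+
  next
    assume "c mod 3 = 2" thus ?thesis by (intro that[of "-1"]) presburger+
  qed
  obtain c' where c': "c = e + 3 * c'" using e(2) by (metis add.commute diff_add_cancel dvd_def mod_0_imp_dvd)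
  obtain i where i: "i \<in> {-1, 0, 1 :: int}" "(e * a - i) mod 3 = 0"
  proof -
    define x where "x = e * a"
    consider "x mod 3 = 0" | "x mod 3 = 1" | "x mod 3 = 2" by linarith
    thus ?thesis
    proof cases
      case 1 thus ?thesis by (intro that[of 0]) (simp_all add: x_def)
    next
      case 2
      hence "(x - 1) mod 3 = 0" by presburger
      thus ?thesis by (intro that[of 1]) (simp_all add: x_def)
    next
      case 3
      hence "(x - (-1)) mod 3 = 0" by presburger
      thus ?thesis by (intro that[of "-1"]) (simp_all add: x_def)
    qed
  qed
  have ee1: "e * e = 1" using e(1) by auto
  obtain a' where a0: "e * a - i = 3 * a'" using i(2) by (metis dvd_def mod_0_imp_dvd)
  hence "e * (e * a) = e * (i + 3 * a')" by (simp add: algebra_simps)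
  hence a': "a = e * (i + 3 * a')" using ee1 by (simp add: mult.assoc[symmetric])
  define j where "j = e * d"
  have d: "d = e * j" using ee1 by (simp add: j_def mult.assoc[symmetric])
  define k where "k = a' * j - b * c'"
  have "b * e = i * j - 1 + 3 * k"
  proof -
    have "b * (e + 3 * c') = a * d - 1" using det by (simp add: c')
    also have "a * d = (e * e) * ((i + 3 * a') * j)" by (simp add: a' d algebra_simps)
    finally show ?thesis by (simp add: ee1 k_def algebra_simps)
  qed
  hence "e * (b * e) = e * (i * j - 1 + 3 * k)" by simp
  hence b: "b = e * (i * j - 1 + 3 * k)" using ee1 by (metis mult.assoc mult.commute mult_1)
  have 1: "e * (a * (e * d) - b) = 1 + 3 * (a' * j - k)"
  proof -
    have "e * (a * (e * d) - b) = (e * e) * ((i + 3 * a') * j - (i * j - 1 + 3 * k))"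
      unfolding j_def[symmetric] by (simp add: a' b algebra_simps)
    thus ?thesis by (simp add: ee1 algebra_simps)
  qed
  have 2: "e * (a * (1 - i * (e * d)) + b * i) = 3 * (a' * (1 - i * j) + k * i)"
  proof -
    have "e * (a * (1 - i * (e * d)) + b * i) = (e * e) * ((i + 3 * a') * (1 - i * j) + (i * j - 1 + 3 * k) * i)"
      unfolding j_def[symmetric] by (simp add: a' b algebra_simps)
    thus ?thesis by (simp add: ee1 algebra_simps)
  qed
  have 3: "e * (c * (e * d) - d) = 3 * (e * c' * j)"
    unfolding j_def[symmetric] by (simp add: c' d algebra_simps)
  have 4: "e * (c * (1 - i * (e * d)) + d * i) = 1 + 3 * (e * c' * (1 - i * j))"
  proof -
    have "e * (c * (1 - i * (e * d)) + d * i) = (e * e) * (1 - i * j + j * i) + 3 * (e * c' * (1 - i * j))"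
      unfolding j_def[symmetric] by (simp add: c' d algebra_simps)
    thus ?thesis by (simp add: ee1 algebra_simps)
  qed
  have 5: "(e * (a * (e * d) - b)) * (e * (c * (1 - i * (e * d)) + d * i)) -
        (e * (a * (1 - i * (e * d)) + b * i)) * (e * (c * (e * d) - d)) = (e * e) * (a * d - b * c)"
    by (simp add: algebra_simps)
  show ?thesis
  proof (rule that[OF e(1) i(1)])
    have m: "(1 + 3 * x) mod 3 = (1 :: int)" "3 dvd 3 * x" for x :: int by simp_all
    show "gam3 (e * (a * (e * d) - b)) (e * (a * (1 - i * (e * d)) + b * i))
          (e * (c * (e * d) - d)) (e * (c * (1 - i * (e * d)) + d * i))"
      unfolding gam3_def 5 unfolding 1 2 3 4 by (intro conjI m) (simp add: ee1 det)
  qed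
qed

lemma mob_scale:
  assumes "e = 1 \<or> e = - 1"
  shows "mob (e * a) (e * b) (e * c) (e * d) t = mob a b c d t"
proof -
  have "mob (- a) (- b) (- c) (- d) t = (- (of_int a * t + of_int b)) / (- (of_int c * t + of_int d))"
    by (simp add: mob_def)
  also have "\<dots> = mob a b c d t" unfolding minus_divide_divide mob_def ..
  finally show ?thesis using assms by auto
qed


text \<open>
  In \<open>q = exp (2 \<pi> i t / 3)\<close>, the invariance and the growth condition make \<open>F\<close> and its translates at the
  other three cusps holomorphic on the whole unit disc; reduction theory lets one of the four
  attain the supremum of \<open>norm F\<close> inside the disc.
\<close>

theorem gam3_liouville:
  assumes hol: "F holomorphic_on uhp"
    and inv: "\<And>a b c d t. gam3 a b c d \<Longrightarrow> Im t > 0 \<Longrightarrow> F (mob a b c d t) = F t"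
    and lim: "((\<lambda>t. qq t * F t) \<longlongrightarrow> 0) ioo"
    and limS: "\<And>i :: int. i \<in> {-1, 0, 1} \<Longrightarrow> ((\<lambda>t. qq t * F (- 1 / t + of_int i)) \<longlongrightarrow> 0) ioo"
  obtains k where "\<And>t. Im t > 0 \<Longrightarrow> F t = k"
proof -
  have per: "F (t + 3) = F t" if "Im t > 0" for t
    using inv[of 1 3 0 1 t] that by (simp add: gam3_def mob_def)
  obtain f where f: "f holomorphic_on ball 0 1" "\<And>t. Im t > 0 \<Longrightarrow> F t = f (qq t)"
    using cusp_extension[OF hol per lim] by blast
  have "\<exists>h. h holomorphic_on ball 0 1 \<and> (\<forall>t. Im t > 0 \<longrightarrow> F (- 1 / t + of_int i) = h (qq t))"
    if i: "i \<in> {-1, 0, 1 :: int}" for i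
  proof -
    define F' where "F' = (\<lambda>t. F (- 1 / t + of_int i))"
    have "(F \<circ> (\<lambda>t. - 1 / t + of_int i)) holomorphic_on uhp"
    proof (rule holomorphic_on_compose_gen[OF _ hol])
      show "(\<lambda>t. - 1 / t + of_int i) holomorphic_on uhp"
        by (intro holomorphic_intros) auto
    qed (use Im_minus_inverse in auto)
    hence hol': "F' holomorphic_on uhp" by (simp add: F'_def o_def)
    have per': "F' (t + 3) = F' t" if t: "Im t > 0" for t
    proof -
      define s where "s = - 1 / t + of_int i"
      have s: "Im s > 0" using Im_minus_inverse[OF t] by (simp add: s_def)
      have nz: "t \<noteq> 0" "t + 3 \<noteq> 0" using t by (auto simp: complex_eq_iff)
      \<comment> \<open>This is T^i S T^3 S^(-1) T^(-i), the translation by 3 seen from the cusp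
        \<open>i\<close>.\<close>
      have g: "gam3 (1 - 3 * i) (3 * i\<^sup>2) (- 3) (1 + 3 * i)"
        using i by (auto simp: gam3_def)
      have den: "of_int (- 3) * s + of_int (1 + 3 * i) = (t + 3) / t"
        using nz by (simp add: s_def field_simps)
      have num: "of_int (1 - 3 * i) * s + of_int (3 * i\<^sup>2) = (of_int i * (t + 3) - 1) / t"
        using nz by (simp add: s_def field_simps power2_eq_square)
      have "mob (1 - 3 * i) (3 * i\<^sup>2) (- 3) (1 + 3 * i) s = - 1 / (t + 3) + of_int i"
      proof -
        have "(of_int i * (t + 3) - 1) / t / ((t + 3) / t) = (of_int i * (t + 3) - 1) / (t + 3)"
          using nz by simp
        thus ?thesis unfolding mob_def den num using nz by (simp add: diff_divide_distrib)
      qed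
      with inv[OF g s] show ?thesis by (simp add: F'_def s_def)
    qed
    have "((\<lambda>t. qq t * F' t) \<longlongrightarrow> 0) ioo" using limS[OF i] by (simp add: F'_def)
    from cusp_extension[OF hol' per' this] show ?thesis unfolding F'_def by metis
  qed
  then obtain h where h: "\<And>i. i \<in> {-1, 0, 1 :: int} \<Longrightarrow> h i holomorphic_on ball 0 1"
    "\<And>i t. i \<in> {-1, 0, 1 :: int} \<Longrightarrow> Im t > 0 \<Longrightarrow> F (- 1 / t + of_int i) = h i (qq t)"
    by metis
  \<comment> \<open>The norm of \<open>qq t\<close> at height 1/5, the bound from reduction
    theory.\<close>
  define r where "r = exp (- 2 * pi / 15)"
  have r: "0 < r" "r < 1" by (simp_all add: r_def)
  have qr: "qq t \<in> cball 0 r" if "Im t \<ge> 1 / 5" for t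
  proof -
    have "pi * (1 / 5) \<le> pi * Im t" using that by (intro mult_left_mono) auto
    thus ?thesis by (simp add: norm_qq r_def)
  qed
  define S where "S = insert f (h ` {-1, 0, 1})"
  have S: "finite S" "S \<noteq> {}" "\<And>g. g \<in> S \<Longrightarrow> g holomorphic_on ball 0 1"
    using f(1) h(1) by (auto simp: S_def)
  have "\<exists>x\<in>cball 0 r. \<forall>y\<in>cball 0 r. norm (g y) \<le> norm (g x)" if "g \<in> S" for g
    using r by (intro continuous_attains_sup continuous_intros holomorphic_on_imp_continuous_on
        holomorphic_on_subset[OF S(3)[OF that]]) auto
  then obtain m where m: "\<And>g. g \<in> S \<Longrightarrow> m g \<in> cball 0 r"
    "\<And>g y. g \<in> S \<Longrightarrow> y \<in> cball 0 r \<Longrightarrow> norm (g y) \<le> norm (g (m g))"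
    by metis
  define M where "M = Max ((\<lambda>g. norm (g (m g))) ` S)"
  have "M \<in> (\<lambda>g. norm (g (m g))) ` S" unfolding M_def using S by (intro Max_in) auto
  then obtain g where g: "g \<in> S" "norm (g (m g)) = M" by auto
  have small: "norm (g' y) \<le> M" if "g' \<in> S" "y \<in> cball 0 r" for g' y
    using m(2)[OF that] S(1) that(1) unfolding M_def by (meson Max_ge finite_imageI image_eqI order_trans)
  have bound: "norm (F t) \<le> M" if t: "Im t > 0" for t
  proof -
    obtain a b c d where abcd: "a * d - b * c = 1" "Im (mob a b c d t) \<ge> 1 / 5"
      using sl2z_to_fundamental[OF t] .
    define s where "s = mob a b c d t"
    have s: "Im s > 0" "Im s \<ge> 1 / 5" using abcd(2) by (simp_all add: s_def)
    have ts: "t = mob d (- b) (- c) a s" unfolding s_def by (simp add: mob_inverse[OF abcd(1) t])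
    have det: "d * a - (- b) * (- c) = 1" using abcd(1) by (simp add: mult.commute)
    show ?thesis
    proof (cases "3 dvd - c")
      case True
      from gam3_coset_inf[OF det True] obtain e where e: "e = 1 \<or> e = - 1"
        "gam3 (e * d) (e * (- b - d * (d * - b))) (e * - c) (e * (a - - c * (d * - b)))" .
      define s' where "s' = s + of_int (d * - b)"
      have s': "Im s' > 0" "Im s' \<ge> 1 / 5" using s by (simp_all add: s'_def)
      have "mob d (- b - d * (d * - b)) (- c) (a - - c * (d * - b)) s' = mob d (- b) (- c) a s"
        by (simp add: mob_def s'_def algebra_simps)
      hence "F t = F s'" using inv[OF e(2) s'(1)] unfolding mob_scale[OF e(1)] ts by simp
      thus ?thesis using f(2)[OF s'(1)] small[OF _ qr[OF s'(2)], of f] by (simp add: S_def)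
    next
      case False
      from gam3_coset_0[OF det False] obtain e i where e: "e = 1 \<or> e = - 1" "i \<in> {-1, 0, 1 :: int}"
        "gam3 (e * (d * (e * a) - - b)) (e * (d * (1 - i * (e * a)) + - b * i))
          (e * (- c * (e * a) - a)) (e * (- c * (1 - i * (e * a)) + a * i))" .
      define j where "j = e * a"
      define s' where "s' = s + of_int j"
      have s': "Im s' > 0" "Im s' \<ge> 1 / 5" using s by (simp_all add: s'_def)
      have nz: "s' \<noteq> 0" using s' by auto
      define u where "u = - 1 / s' + of_int i"
      have u: "Im u > 0" using Im_minus_inverse[OF s'(1)] by (simp add: u_def)
      have *: "of_int (x * j - y) * u + of_int (x * (1 - i * j) + y * i) = (of_int x * s + of_int y) / s'" for x y :: int
        using nz by (simp add: u_def s'_def field_simps)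
      have "mob (d * j - - b) (d * (1 - i * j) + - b * i) (- c * j - a) (- c * (1 - i * j) + a * i) u = mob d (- b) (- c) a s"
        unfolding mob_def * using nz by simp
      hence "F t = F u" using inv[OF e(3) u] unfolding mob_scale[OF e(1)] ts j_def by simp
      thus ?thesis using h(2)[OF e(2) s'(1)] small[OF _ qr[OF s'(2)], of "h i"] e(2) by (auto simp: S_def u_def)
    qed
  qed
  have vals: "\<exists>t. Im t > 0 \<and> g' q = F t" if "g' \<in> S" "q \<in> ball 0 1" "q \<noteq> 0" for g' q
  proof -
    have t: "Im (qinv q) > 0" "qq (qinv q) = q"
      using that by (auto intro!: Im_qinv_pos qq_qinv)
    from that(1) consider "g' = f" | i where "g' = h i" "i \<in> {-1, 0, 1 :: int}"
      unfolding S_def by blast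
    thus ?thesis
    proof cases
      assume "g' = f" thus ?thesis using f(2)[OF t(1)] t by metis
    next
      fix i assume "g' = h i" "i \<in> {-1, 0, 1 :: int}"
      moreover have "Im (- 1 / qinv q + of_int i) > 0" using Im_minus_inverse[OF t(1)] by simp
      ultimately show ?thesis using h(2)[OF _ t(1)] t by metis
    qed
  qed
  have "norm (g q) \<le> norm (g (m g))" if "q \<in> ball 0 1" for q
  proof (cases "q = 0")
    case True
    thus ?thesis using small[OF g(1), of 0] r g by simp
  next
    case False
    thus ?thesis using vals[OF g(1) that] bound g by metis
  qed
  moreover have "m g \<in> ball 0 1" using m(1)[OF g(1)] r by auto
  ultimately have "g constant_on ball 0 1"
    using maximum_modulus_principle[OF S(3)[OF g(1)], of "ball 0 1" "m g"] by auto
  then obtain k where k: "\<And>q. q \<in> ball 0 1 \<Longrightarrow> g q = k" by (auto simp: constant_on_def)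
  have "F t = k" if t: "Im t > 0" for t
  proof -
    from g(1) consider "g = f" | i where "g = h i" "i \<in> {-1, 0, 1 :: int}"
      unfolding S_def by blast
    thus ?thesis
    proof cases
      assume "g = f" thus ?thesis using f(2)[OF t] k norm_qq_less_1[OF t] by simp
    next
      fix i assume i: "g = h i" "i \<in> {-1, 0, 1 :: int}"
      define s where "s = - 1 / (t - of_int i)"
      have ti: "Im (t - of_int i) > 0" using t by simp
      have s: "Im s > 0" unfolding s_def by (rule Im_minus_inverse[OF ti])
      have "t - of_int i \<noteq> 0" using ti by force
      hence "- 1 / s + of_int i = t" by (simp add: s_def)
      thus ?thesis using h(2)[OF i(2) s] k norm_qq_less_1[OF s] i(1) by simp
    qed
  qed
  thus thesis by (rule that)
qed

section \<open>Expansions at infinity\<close>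

text \<open>\<open>F\<close> may have finitely many negative exponents, and agreement is asked for
  near infinity, which keeps the relation stable under quotients and derivatives.\<close>

definition qexp :: "(complex \<Rightarrow> complex) \<Rightarrow> complex fls \<Rightarrow> bool" where
  "qexp f F \<longleftrightarrow> (\<exists>\<phi>. \<phi> has_laurent_expansion F \<and> (\<forall>\<^sub>F t in ioo. f t = \<phi> (qq t)))"

lemma ioo_neq_bot [simp]: "ioo \<noteq> bot"
proof
  assume "ioo = bot"
  hence "eventually (\<lambda>_. False) ioo" by simp
  then obtain Y where "\<forall>t. Im t > Y \<longrightarrow> False" unfolding eventually_ioo by blast
  hence "\<not> Im (Complex 0 (Y + 1)) > Y" by blast
  thus False by simp
qed

lemma qexpI: "\<phi> has_laurent_expansion F \<Longrightarrow> (\<And>t. Im t > 0 \<Longrightarrow> f t = \<phi> (qq t)) \<Longrightarrow> qexp f F"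
  unfolding qexp_def by (auto intro!: exI[of _ \<phi>] eventually_mono[OF eventually_ioo_gt[of 0]])

lemma qexp_cong:
  assumes "\<And>t. Im t > 0 \<Longrightarrow> f t = g t" "qexp f F"
  shows "qexp g F"
proof -
  obtain \<phi> where *: "\<phi> has_laurent_expansion F" "\<forall>\<^sub>F t in ioo. f t = \<phi> (qq t)"
    using assms(2) by (auto simp: qexp_def)
  have "\<forall>\<^sub>F t in ioo. g t = \<phi> (qq t)"
    using *(2) eventually_ioo_gt[of 0] by eventually_elim (use assms(1) in simp)
  thus ?thesis using *(1) unfolding qexp_def by blast
qed

lemma qexp_binop:
  assumes "qexp f F" "qexp g G'"
    and "\<And>\<phi> \<psi>. \<phi> has_laurent_expansion F \<Longrightarrow> \<psi> has_laurent_expansion G' \<Longrightarrow> (\<lambda>q. b (\<phi> q) (\<psi> q)) has_laurent_expansion H"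
  shows "qexp (\<lambda>t. b (f t) (g t)) H"
proof -
  obtain \<phi> \<psi> where *: "\<phi> has_laurent_expansion F" "\<forall>\<^sub>F t in ioo. f t = \<phi> (qq t)"
    "\<psi> has_laurent_expansion G'" "\<forall>\<^sub>F t in ioo. g t = \<psi> (qq t)"
    using assms(1,2) by (auto simp: qexp_def)
  have "\<forall>\<^sub>F t in ioo. b (f t) (g t) = b (\<phi> (qq t)) (\<psi> (qq t))"
    using *(2,4) by eventually_elim simp
  thus ?thesis unfolding qexp_def using assms(3)[OF *(1,3)] by (intro exI[of _ "\<lambda>q. b (\<phi> q) (\<psi> q)"]) simp
qed

lemma qexp_add: "qexp f F \<Longrightarrow> qexp g G' \<Longrightarrow> qexp (\<lambda>t. f t + g t) (F + G')"
  by (rule qexp_binop) (auto intro: laurent_expansion_intros)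

lemma qexp_diff: "qexp f F \<Longrightarrow> qexp g G' \<Longrightarrow> qexp (\<lambda>t. f t - g t) (F - G')"
  by (rule qexp_binop) (auto intro: laurent_expansion_intros)

lemma qexp_mult: "qexp f F \<Longrightarrow> qexp g G' \<Longrightarrow> qexp (\<lambda>t. f t * g t) (F * G')"
  by (rule qexp_binop) (auto intro: laurent_expansion_intros)

lemma qexp_divide: "qexp f F \<Longrightarrow> qexp g G' \<Longrightarrow> qexp (\<lambda>t. f t / g t) (F / G')"
  by (rule qexp_binop) (auto intro: laurent_expansion_intros)

lemma qexp_const: "qexp (\<lambda>_. c) (fls_const c)"
  by (rule qexpI[of "\<lambda>_. c"]) auto

lemma qexp_power: "qexp f F \<Longrightarrow> qexp (\<lambda>t. f t ^ n) (F ^ n)"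
  by (induction n) (use qexp_const[of 1] in \<open>auto intro: qexp_mult\<close>)

lemma qexp_uminus: "qexp f F \<Longrightarrow> qexp (\<lambda>t. - f t) (- F)"
  using qexp_diff[OF qexp_const[of 0], of f F] by simp

lemma qexp_cmult: "qexp f F \<Longrightarrow> qexp (\<lambda>t. c * f t) (fls_const c * F)"
  by (intro qexp_mult qexp_const)

lemma qexp_qq: "qexp qq fls_X"
  by (rule qexpI[of "\<lambda>q. q"]) (auto intro: laurent_expansion_intros)

lemma qexp_sum: "(\<And>i. i \<in> I \<Longrightarrow> qexp (f i) (F i)) \<Longrightarrow> qexp (\<lambda>t. \<Sum>i\<in>I. f i t) (\<Sum>i\<in>I. F i)"
  by (induction I rule: infinite_finite_induct) (use qexp_const[of 0] in \<open>auto intro: qexp_add\<close>)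

text \<open>This is the passage from identities of functions to identities of formal series: two
  expansions of one function agree on a punctured neighbourhood of 0, as one sees by pulling back
  along \<open>qinv\<close>.\<close>

lemma qexp_unique:
  assumes "qexp f F" "qexp f G'"
  shows "F = G'"
proof -
  obtain \<phi> \<psi> where *: "\<phi> has_laurent_expansion F" "\<forall>\<^sub>F t in ioo. f t = \<phi> (qq t)"
    "\<psi> has_laurent_expansion G'" "\<forall>\<^sub>F t in ioo. f t = \<psi> (qq t)"
    using assms(1,2) by (auto simp: qexp_def)
  from *(2,4) have "\<forall>\<^sub>F t in ioo. \<phi> (qq t) = \<psi> (qq t)" by eventually_elim simp
  hence "\<forall>\<^sub>F q in at 0. \<phi> (qq (qinv q)) = \<psi> (qq (qinv q))"
    using filterlim_qinv by (rule eventually_compose_filterlim)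
  moreover have "\<forall>\<^sub>F q::complex in at 0. q \<noteq> 0" by (auto simp: eventually_at_filter)
  ultimately have "\<forall>\<^sub>F q in at 0. \<phi> q = \<psi> q"
    by eventually_elim (simp add: qq_qinv)
  hence "\<psi> has_laurent_expansion F" using *(1) has_laurent_expansion_cong by blast
  thus ?thesis using *(3) has_laurent_expansion_unique by blast
qed

lemma qexp_tendsto:
  assumes "qexp f F" "fls_subdegree F \<ge> 0"
  shows "(f \<longlongrightarrow> fls_nth F 0) ioo"
proof -
  obtain \<phi> where *: "\<phi> has_laurent_expansion F" "\<forall>\<^sub>F t in ioo. f t = \<phi> (qq t)"
    using assms(1) by (auto simp: qexp_def)
  have "((\<lambda>t. \<phi> (qq t)) \<longlongrightarrow> fls_nth F 0) ioo"
    by (rule filterlim_compose[OF has_laurent_expansion_imp_tendsto_0[OF *(1) assms(2)] filterlim_qq])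
  thus ?thesis by (rule Lim_transform_eventually) (use *(2) in \<open>auto simp: eq_commute\<close>)
qed

text \<open>The operator q d/dq on expansions, unrelated to the function
  \<open>theta\<close>.\<close>

definition ftheta :: "complex fls \<Rightarrow> complex fls" where "ftheta F = fls_X * fls_deriv F"

lemma ftheta_nth [simp]: "fls_nth (ftheta F) n = of_int n * fls_nth F n"
  by (simp add: ftheta_def fls_X_times_conv_shift)

text \<open>Chosen such that \<open>q d/dq = cD d/dt\<close> for \<open>q = qq t\<close>.\<close>

definition cD :: complex where "cD = 3 / (2 * of_real pi * \<i>)"

lemma cD_nz [simp]: "cD \<noteq> 0" by (simp add: cD_def)

lemma qq_deriv: "(qq has_field_derivative (qq t / cD)) (at t)"
  unfolding qq_def[abs_def] ee_def cD_def by (auto intro!: derivative_eq_intros simp: field_simps)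

lemma qexp_deriv:
  assumes "qexp f F"
  shows "qexp (\<lambda>t. cD * deriv f t) (ftheta F)"
proof -
  obtain \<phi> where *: "\<phi> has_laurent_expansion F" "\<forall>\<^sub>F t in ioo. f t = \<phi> (qq t)"
    using assms(1) by (auto simp: qexp_def)
  have "isolated_singularity_at \<phi> 0" using has_laurent_expansion_isolated_0[OF *(1)] .
  then obtain r where r: "r > 0" "\<phi> analytic_on ball 0 r - {0}"
    by (auto simp: isolated_singularity_at_def)
  obtain Y where Y: "\<And>t. Im t > Y \<Longrightarrow> f t = \<phi> (qq t)"
    using *(2) unfolding eventually_ioo by blast
  have "\<forall>\<^sub>F t in ioo. qq t \<in> ball 0 r - {0}"
  proof -
    have "\<forall>\<^sub>F q in at (0::complex). q \<in> ball 0 r - {0}"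
      using eventually_at_ball'[OF r(1), of 0 UNIV] by eventually_elim auto
    thus ?thesis by (rule eventually_compose_filterlim[OF _ filterlim_qq])
  qed
  moreover have "\<forall>\<^sub>F t in ioo. Im t > Y" by (rule eventually_ioo_gt)
  ultimately have "\<forall>\<^sub>F t in ioo. cD * deriv f t = qq t * deriv \<phi> (qq t)"
  proof eventually_elim
    case (elim t)
    have "\<phi> field_differentiable at (qq t)"
      using r(2) elim(1) analytic_on_imp_differentiable_at by blast
    hence "((\<lambda>t. \<phi> (qq t)) has_field_derivative deriv \<phi> (qq t) * (qq t / cD)) (at t)"
      by (intro DERIV_chain2[OF _ qq_deriv]) (simp add: DERIV_deriv_iff_field_differentiable)
    moreover have "\<forall>\<^sub>F x in nhds t. x \<in> {x. Im x > Y}"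
      by (rule eventually_nhds_in_open) (use elim in \<open>auto simp: open_halfspace_Im_gt\<close>)
    hence "\<forall>\<^sub>F x in nhds t. f x = \<phi> (qq x)"
      by eventually_elim (use Y in auto)
    ultimately have "(f has_field_derivative deriv \<phi> (qq t) * (qq t / cD)) (at t)"
      by (subst DERIV_cong_ev[OF refl _ refl])
    hence "deriv f t = deriv \<phi> (qq t) * (qq t / cD)" by (rule DERIV_imp_deriv)
    thus ?case by simp
  qed
  moreover have "(\<lambda>q. q * deriv \<phi> q) has_laurent_expansion ftheta F"
    unfolding ftheta_def by (intro laurent_expansion_intros *)
  ultimately show ?thesis unfolding qexp_def by blast
qed

section \<open>Expansions of L, B and g_1\<close>

definition et :: "nat \<Rightarrow> complex fps" where "et d = cmap (eta_prod d)"

lemma et_0 [simp]: "fps_nth (et d) 0 = 1"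
  by (simp add: et_def eta_prod_def)

definition psi_fps :: "complex fps" where "psi_fps = et 1 ^ 3 * inverse (et 9 ^ 3)"

definition lf :: "complex fls" where "lf = fls_X_inv * fps_to_fls psi_fps + 3"
definition bf :: "complex fls" where "bf = fps_to_fls (et 3 ^ 9 * inverse (et 9 ^ 3))"
definition gf :: "complex fls" where "gf = fls_X * fps_to_fls (et 3 ^ 8)"

lemma et_expansion: "d > 0 \<Longrightarrow> (\<lambda>q. eulerP (q ^ d)) has_fps_expansion et d"
  unfolding et_def by (rule eulerP_has_fps_expansion)

lemma psi_expansion: "(\<lambda>q. eulerP q ^ 3 * inverse (eulerP (q ^ 9) ^ 3)) has_fps_expansion psi_fps"
  unfolding psi_fps_def using et_expansion[of 1]
  by (intro has_fps_expansion_mult has_fps_expansion_power has_fps_expansion_inverse et_expansion) auto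

lemma qexp_lH: "qexp lH lf"
proof -
  have "(\<lambda>q. inverse q * (eulerP q ^ 3 * inverse (eulerP (q ^ 9) ^ 3)) + 3) has_laurent_expansion lf"
    unfolding lf_def by (intro laurent_expansion_intros has_laurent_expansion_fps psi_expansion)
  thus ?thesis by (rule qexpI) (simp add: lH_def wH_def wq_def field_simps)
qed

lemma qexp_bH: "qexp bH bf"
proof -
  have "(\<lambda>q. eulerP (q ^ 3) ^ 9 * inverse (eulerP (q ^ 9) ^ 3)) has_laurent_expansion bf"
    unfolding bf_def by (intro has_laurent_expansion_fps has_fps_expansion_mult
        has_fps_expansion_power has_fps_expansion_inverse et_expansion) auto
  thus ?thesis by (rule qexpI) (simp add: bH_def bq_def field_simps)
qed

lemma qexp_gH: "qexp gH gf"
proof -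
  have "(\<lambda>q. q * eulerP (q ^ 3) ^ 8) has_laurent_expansion gf"
    unfolding gf_def by (intro laurent_expansion_intros has_laurent_expansion_fps has_fps_expansion_power et_expansion) auto
  thus ?thesis by (rule qexpI) (simp add: gH_def gq_def)
qed

lemma eta_prod_coeffs:
  "fps_nth (eta_prod 1) (Suc 0) = -1" "d > 1 \<Longrightarrow> fps_nth (eta_prod d) (Suc 0) = 0"
  by (simp_all add: eta_prod_def)

lemma psi_coeffs: "fps_nth psi_fps 0 = 1" "fps_nth psi_fps (Suc 0) = -3"
proof -
  show "fps_nth psi_fps 0 = 1" by (simp add: psi_fps_def fps_power_zeroth)
  have p: "fps_nth (f ^ 3) (Suc 0) = 3 * fps_nth f (Suc 0)" if "fps_nth f 0 = 1" for f :: "complex fps"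
    using that by (simp add: power3_eq_cube fps_mult_nth)
  have e: "fps_nth (et 1) (Suc 0) = -1" "fps_nth (et 9) (Suc 0) = 0"
    by (simp_all only: et_def cmap_nth eta_prod_coeffs) (simp_all add: eta_prod_coeffs)
  have p1: "fps_nth (et 1 ^ 3) (Suc 0) = -3" and p9: "fps_nth (et 9 ^ 3) (Suc 0) = 0"
    using p[OF et_0] e by simp_all
  have "psi_fps * et 9 ^ 3 = et 1 ^ 3"
    unfolding psi_fps_def by (simp add: mult.assoc inverse_mult_eq_1 fps_power_zeroth)
  hence "fps_nth (psi_fps * et 9 ^ 3) (Suc 0) = -3" by (simp only: p1)
  thus "fps_nth psi_fps (Suc 0) = -3"
    using \<open>fps_nth psi_fps 0 = 1\<close>
    by (simp add: fps_mult_nth p9 fps_power_zeroth)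
qed

text \<open>The series q L. The summand 3 in L cancels the constant term -3 of the eta quotient, so
  the linear coefficient is 0.\<close>

definition lfps :: "complex fps" where "lfps = psi_fps + 3 * fps_X"

lemma lf_lfps: "lf = fls_X_inv * fps_to_fls lfps"
proof -
  have "fls_X_inv * (fps_to_fls (3 * fps_X) :: complex fls) = 3"
  proof -
    have "fls_X_inv * (fps_to_fls (3 * fps_X) :: complex fls) = 3 * (fls_X_inv * fls_X)"
      by (simp add: fls_times_fps_to_fls mult_ac)
    also have "fls_X_inv * fls_X = (1 :: complex fls)"
      by (simp add: fls_X_inv_times_conv_shift)
    finally show ?thesis by simp
  qed
  thus ?thesis by (simp add: lf_def lfps_def distrib_left)
qed

lemma lfps_coeffs: "fps_nth lfps 0 = 1" "fps_nth lfps (Suc 0) = 0"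
  by (simp_all add: lfps_def psi_coeffs)

lemma lf_nth: "fls_nth lf n = (if n < -1 then 0 else fps_nth lfps (nat (n + 1)))"
  by (simp add: lf_lfps fls_X_inv_times_conv_shift)

lemma bf_nth: "fls_nth bf n = (if n < 0 then 0 else fps_nth (et 3 ^ 9 * inverse (et 9 ^ 3)) (nat n))"
  by (simp add: bf_def)

lemma gf_nth: "fls_nth gf n = (if n < 1 then 0 else fps_nth (et 3 ^ 8) (nat (n - 1)))"
  by (simp add: gf_def fls_X_times_conv_shift)


section \<open>Holomorphy and behaviour at the cusps\<close>

lemma holomorphic_qq [holomorphic_intros]: "f holomorphic_on A \<Longrightarrow> (\<lambda>t. qq (f t)) holomorphic_on A"
  unfolding qq_def by (intro holomorphic_intros) auto

lemma holomorphic_comp_uhp: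
  assumes "f holomorphic_on uhp" "g holomorphic_on uhp" "\<And>t. Im t > 0 \<Longrightarrow> Im (g t) > 0"
  shows "(\<lambda>t. f (g t)) holomorphic_on uhp"
  using holomorphic_on_compose_gen[OF assms(2,1)] assms(3) by (auto simp: o_def)

lemma holomorphic_eulerP_qq: "n > 0 \<Longrightarrow> (\<lambda>t. eulerP (qq t ^ n)) holomorphic_on uhp"
  by (intro holomorphic_eulerP open_uhp holomorphic_intros) (auto intro: norm_qq_power_less_1)

lemma holomorphic_wH: "wH holomorphic_on uhp"
  unfolding wH_def[abs_def] wq_def using holomorphic_eulerP_qq[of 1] eulerP_qq_nz[of _ 9]
  by (intro holomorphic_intros holomorphic_eulerP_qq)
    (auto simp: open_uhp intro: norm_qq_less_1 norm_qq_power_less_1)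

lemma holomorphic_bH: "bH holomorphic_on uhp"
  unfolding bH_def[abs_def] bq_def using eulerP_qq_nz[of _ 9]
  by (intro holomorphic_intros holomorphic_eulerP_qq)
    (auto simp: open_uhp intro: norm_qq_less_1 norm_qq_power_less_1)

lemma holomorphic_gH: "gH holomorphic_on uhp"
  unfolding gH_def[abs_def] gq_def by (intro holomorphic_intros holomorphic_eulerP_qq)
    (auto simp: open_uhp intro: norm_qq_less_1 norm_qq_power_less_1)

lemma holomorphic_lH: "lH holomorphic_on uhp"
  unfolding lH_def[abs_def] by (intro holomorphic_intros holomorphic_wH)

lemma lim_qq: "(qq \<longlongrightarrow> 0) ioo"
  using filterlim_qq by (simp add: filterlim_at)

lemma lim_eulerP: 
  assumes "(f \<longlongrightarrow> 0) F"
  shows "((\<lambda>t. eulerP (f t)) \<longlongrightarrow> 1) F"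
proof -
  have "eulerP holomorphic_on ball 0 1" using holomorphic_eulerP[of "ball 0 1" "\<lambda>z. z"] by simp
  hence "isCont eulerP 0"
    by (metis centre_in_ball continuous_on_eq_continuous_at holomorphic_on_imp_continuous_on open_ball zero_less_one)
  thus ?thesis using isCont_tendsto_compose[OF _ assms] by fastforce
qed

lemma omg_power_simps: "omg ^ 4 = omg" "omg ^ 6 = 1" "(omg\<^sup>2) ^ 3 = 1" "(omg\<^sup>2)\<^sup>2 = omg"
proof -
  have "omg ^ 4 = omg ^ 3 * omg" "omg ^ 6 = (omg ^ 3)\<^sup>2" by (simp_all add: eval_nat_numeral)
  thus *: "omg ^ 4 = omg" "omg ^ 6 = 1" by (simp_all add: omg_cube)
  show "(omg\<^sup>2) ^ 3 = 1" "(omg\<^sup>2)\<^sup>2 = omg" using * by (simp_all add: power_mult[symmetric])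
qed

lemma qq_shift: "qq (t - 1) = omg\<^sup>2 * qq t" "qq (t + 3) = qq t"
proof -
  have "omg * qq (t - 1) = qq t" using qq_T[of "t - 1"] by simp
  hence "omg\<^sup>2 * qq t = (omg * omg\<^sup>2) * qq (t - 1)" by (simp add: mult_ac)
  thus "qq (t - 1) = omg\<^sup>2 * qq t" by (simp add: omg_cube')
  have "qq (t + 3) = ee (t / 3 + 1)" by (simp add: qq_def add_divide_distrib)
  thus "qq (t + 3) = qq t" by (simp add: ee_add qq_def)
qed

lemma period3: "wH (t + 3) = wH t" "bH (t + 3) = bH t" "gH (t + 3) = gH t" "lH (t + 3) = lH t"
  by (simp_all add: wH_def bH_def gH_def lH_def qq_shift)

lemma bH_T: "bH (t + 1) = bH t" and gH_T: "gH (t + 1) = omg * gH t"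
proof -
  have "(omg * x) ^ 9 = x ^ 9" "(omg * x) ^ 3 = x ^ 3" for x
    using power_mult[of omg 3 3] by (simp_all add: power_mult_distrib omg_cube)
  thus "bH (t + 1) = bH t" "gH (t + 1) = omg * gH t"
    by (simp_all add: bH_def bq_def gH_def gq_def qq_T)
qed

lemma lim_kap_ratio:
  assumes "c ^ 3 = 1" "c \<noteq> 0" "\<And>t. qq (s t) = c * qq t" "\<And>t. Im t > 0 \<Longrightarrow> Im (s t) > 0"
  shows "((\<lambda>t. qq t * (kap 1 0 (s t) / kap 1 0 t)) \<longlongrightarrow> 0) ioo"
proof -
  have "((\<lambda>t. qq t * (inverse c * eulerP (c * qq t) ^ 3 / eulerP (qq t) ^ 3)) \<longlongrightarrow> 0 * (inverse c * 1 ^ 3 / 1 ^ 3)) ioo"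
    by (intro tendsto_intros lim_qq lim_eulerP tendsto_mult_right_zero) auto
  moreover have "\<forall>\<^sub>F t in ioo. qq t * (inverse c * eulerP (c * qq t) ^ 3 / eulerP (qq t) ^ 3) =
      qq t * (kap 1 0 (s t) / kap 1 0 t)"
    using eventually_ioo_gt[of 0]
  proof eventually_elim
    case (elim t)
    have "(c * qq t) ^ 3 = qq t ^ 3" using assms(1) by (simp add: power_mult_distrib)
    thus ?case using eulerP_qq_nz[OF elim, of 1] eulerP_qq_nz[OF elim, of 3] assms(2)
      by (simp add: kap_1_0 elim assms(3,4) field_simps)
  qed
  ultimately show ?thesis by (simp add: Lim_transform_eventually)
qed

lemma lim_qq_wH: "((\<lambda>t. qq t * wH t) \<longlongrightarrow> 1) ioo"
proof -
  have "((\<lambda>t. eulerP (qq t) ^ 3 / eulerP (qq t ^ 9) ^ 3) \<longlongrightarrow> 1 ^ 3 / 1 ^ 3) ioo"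
    by (intro tendsto_intros lim_qq lim_eulerP) (auto intro!: tendsto_eq_intros lim_qq)
  thus ?thesis by (simp add: wH_def wq_def)
qed

lemma lim_inverse_wH: "((\<lambda>t. inverse (wH t)) \<longlongrightarrow> 0) ioo"
proof -
  have "((\<lambda>t. qq t * inverse (qq t * wH t)) \<longlongrightarrow> 0 * inverse 1) ioo"
    by (intro tendsto_intros lim_qq lim_qq_wH) auto
  thus ?thesis by (simp add: mult.assoc[symmetric])
qed

text \<open>At these cusps \<open>wH\<close> becomes 27 / \<open>wH\<close> or a constant times a
  quotient of values of \<open>kap 1 0\<close> at translated arguments, bounded in both cases. The
  value 2 of \<open>j\<close> is included because \<open>lH_T\<close> translates the cusps by 1; it
  reduces to -1 by period 3.\<close>

lemma lim_wH_cusp: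
  assumes "j \<in> {-1, 0, 1, 2 :: int}"
  shows "((\<lambda>t. qq t * wH (- 1 / t + of_int j)) \<longlongrightarrow> 0) ioo"
proof -
  have mob1: "mob j (-1) 1 0 t = - 1 / t + of_int j" if "Im t > 0" for j t
  proof -
    have "t \<noteq> 0" using that by auto
    thus ?thesis by (simp add: mob_def field_simps)
  qed
  have w: "wH (- 1 / t + of_int j) = kc * (kap j (-1) t / kap 1 0 t)" if "Im t > 0" for j t
    using wH_mob[of j 0 "-1" 1 t] mob1[OF that] that by simp
  have m1: "((\<lambda>t. qq t * wH (- 1 / t + of_int (-1))) \<longlongrightarrow> 0) ioo"
  proof -
    have "((\<lambda>t. - kc * (qq t * (kap 1 0 (t + 1) / kap 1 0 t))) \<longlongrightarrow> - kc * 0) ioo"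
      by (intro tendsto_mult tendsto_const lim_kap_ratio[of omg]) (auto simp: omg_cube qq_T)
    moreover have "\<forall>\<^sub>F t in ioo. - kc * (qq t * (kap 1 0 (t + 1) / kap 1 0 t)) = qq t * wH (- 1 / t + of_int (-1))"
      using eventually_ioo_gt[of 0]
      by eventually_elim (use kap_T[of 1 0] kap_uminus[of _ 1 1] w[of _ "-1"] in simp)
    ultimately show ?thesis by (simp add: Lim_transform_eventually)
  qed
  from assms consider "j = -1" | "j = 0" | "j = 1" | "j = 2" by auto
  thus ?thesis
  proof cases
    case 1
    thus ?thesis using m1 by simp
  next
    case 2
    have "((\<lambda>t. qq t * (27 * inverse (wH t))) \<longlongrightarrow> 0 * (27 * 0)) ioo"
      by (intro tendsto_intros lim_qq lim_inverse_wH)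
    moreover have "\<forall>\<^sub>F t in ioo. qq t * (27 * inverse (wH t)) = qq t * wH (- 1 / t + of_int j)"
      using eventually_ioo_gt[of 0] by eventually_elim (use wH_S 2 in \<open>simp add: field_simps\<close>)
    ultimately show ?thesis by (simp add: Lim_transform_eventually)
  next
    case 3
    have "((\<lambda>t. kc * (qq t * (kap 1 0 (t - 1) / kap 1 0 t))) \<longlongrightarrow> kc * 0) ioo"
      by (intro tendsto_mult tendsto_const lim_kap_ratio[of "omg\<^sup>2"]) (auto simp: omg_power_simps qq_shift)
    moreover have "\<forall>\<^sub>F t in ioo. kc * (qq t * (kap 1 0 (t - 1) / kap 1 0 t)) = qq t * wH (- 1 / t + of_int j)"
      using eventually_ioo_gt[of 0]
      by eventually_elim (use kap_T'[of 1 0] w[of _ 1] 3 in simp)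
    ultimately show ?thesis by (simp add: Lim_transform_eventually)
  next
    case 4
    have "wH (- 1 / t + of_int j) = wH (- 1 / t + of_int (-1))" for t
    proof -
      have "- 1 / t + of_int j = (- 1 / t + of_int (-1)) + 3" using 4 by simp
      thus ?thesis by (simp only: period3(1))
    qed
    thus ?thesis using m1 by simp
  qed
qed

text \<open>Conjugation by T: Gamma(3) is normal, so translates of invariant functions stay
  invariant.\<close>

lemma gam3_conj_T:
  assumes "gam3 a b c d" "Im t > 0"
  shows "gam3 (a + c) (b + d - a - c) c (d - c)" "mob (a + c) (b + d - a - c) c (d - c) (t + 1) = mob a b c d t + 1"
proof -
  obtain b' c' where bc: "b = 3 * b'" "c = 3 * c'" using assms(1) unfolding gam3_def by (elim conjE dvdE)
  have "(d - a) mod 3 = (1 - 1) mod 3" using assms(1) unfolding gam3_def by (metis mod_diff_eq)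
  hence "3 dvd d - a" by presburger
  moreover have "b + d - a - c = (b - c) + (d - a)" by simp
  ultimately have "3 dvd b + d - a - c" using bc by (metis dvd_add dvd_diff dvd_triv_left)
  moreover have "(a + c) mod 3 = 1" "(d - c) mod 3 = 1" 
    using assms(1) by (auto simp: gam3_def bc mod_diff_eq[symmetric])
  moreover have "(a + c) * (d - c) - (b + d - a - c) * c = a * d - b * c" by (simp add: algebra_simps)
  ultimately show "gam3 (a + c) (b + d - a - c) c (d - c)" using assms(1) by (simp add: gam3_def)
  have "of_int c * t + of_int d \<noteq> 0" using Im_mob_pos(2)[of a d b c t] assms by (simp add: gam3_def)
  thus "mob (a + c) (b + d - a - c) c (d - c) (t + 1) = mob a b c d t + 1"
    unfolding mob_def by (simp add: field_simps)
qed

text \<open>L lives on exponents congruent to -1 modulo 3. In the corresponding difference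
  \<open>F\<close> for \<open>wH\<close> the poles cancel, so \<open>F\<close> is constant by
  \<open>gam3_liouville\<close>; the constant comes from the coefficient -3 and is absorbed exactly
  by the summand 3 of \<open>lH\<close>.\<close>

lemma lH_T:
  assumes "Im t > 0"
  shows "lH (t + 1) = omg\<^sup>2 * lH t"
proof -
  define F where "F = (\<lambda>t. wH (t + 1) - omg\<^sup>2 * wH t)"
  \<comment> \<open>The product of \<open>q\<close> and \<open>wq q\<close>, regular at 0; its
    derivative there is the constant term of \<open>wH\<close>.\<close>
  define f where "f = (\<lambda>q. eulerP q ^ 3 * inverse (eulerP (q ^ 9) ^ 3))"
  obtain f' where f': "(f has_field_derivative f') (at 0)" "f' = -3"
  proof -
    have "f has_fps_expansion psi_fps" unfolding f_def by (rule psi_expansion)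
    hence d: "deriv f 0 = fps_nth psi_fps 1" using fps_nth_fps_expansion[of f psi_fps 1] by simp
    have "f field_differentiable at 0"
      using \<open>f has_fps_expansion psi_fps\<close> has_fps_expansion_imp_analytic_0 analytic_on_imp_differentiable_at by blast
    hence "(f has_field_derivative deriv f 0) (at 0)"
      by (simp add: DERIV_deriv_iff_field_differentiable)
    thus ?thesis using that[of "deriv f 0"] psi_coeffs d by simp
  qed
  have lim: "(F \<longlongrightarrow> 3 * omg\<^sup>2 - 3) ioo"
  proof -
    have f0: "f 0 = 1" by (simp add: f_def)
    have "((\<lambda>q. f (omg * q) - f q) has_field_derivative (f' * omg - f')) (at 0)"
    proof (rule DERIV_diff[OF DERIV_chain2[of f f' "\<lambda>q. omg * q"] f'(1)])
      show "(f has_field_derivative f') (at (omg * 0))" using f'(1) by simp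
      show "((*) omg has_field_derivative omg) (at 0)" by (auto intro!: derivative_eq_intros)
    qed
    hence "((\<lambda>q. (f (omg * q) - f q) / q) \<longlongrightarrow> f' * omg - f') (at 0)"
      by (simp add: has_field_derivative_iff)
    hence "((\<lambda>t. omg\<^sup>2 * ((f (omg * qq t) - f (qq t)) / qq t)) \<longlongrightarrow> omg\<^sup>2 * (f' * omg - f')) ioo"
      by (intro tendsto_intros filterlim_compose[OF _ filterlim_qq])
    also have "omg\<^sup>2 * (f' * omg - f') = 3 * omg\<^sup>2 - 3 * (omg * omg\<^sup>2)"
      by (simp add: f' algebra_simps)
    also have "\<dots> = 3 * omg\<^sup>2 - 3" by (simp add: omg_cube')
    also have "(\<lambda>t. omg\<^sup>2 * ((f (omg * qq t) - f (qq t)) / qq t)) = F"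
    proof
      fix t
      have "inverse (omg * qq t) = omg\<^sup>2 / qq t" by (simp add: omg_cube' divide_inverse)
      moreover have "wq q = f q * inverse q" for q by (simp add: wq_def f_def field_simps)
      ultimately show "omg\<^sup>2 * ((f (omg * qq t) - f (qq t)) / qq t) = F t"
        by (simp add: F_def wH_def qq_T field_simps)
    qed
    finally show ?thesis .
  qed
  obtain k where k: "\<And>t. Im t > 0 \<Longrightarrow> F t = k"
  proof (rule gam3_liouville[of F])
    have "((\<lambda>t. wH (t + 1))) holomorphic_on uhp"
      by (rule holomorphic_comp_uhp[OF holomorphic_wH]) (auto intro!: holomorphic_intros)
    thus "F holomorphic_on uhp" unfolding F_def by (intro holomorphic_intros holomorphic_wH)
    show "F (mob a b c d t) = F t" if "gam3 a b c d" "Im t > 0" for a b c d t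
      using gam3_conj_T[OF that] that wH_gam3[of _ _ _ _ "t + 1"] wH_gam3[of _ _ _ _ t] by (simp add: F_def) metis
    show "((\<lambda>t. qq t * F t) \<longlongrightarrow> 0) ioo"
      using tendsto_mult[OF lim_qq lim] by simp
    show "((\<lambda>t. qq t * F (- 1 / t + of_int i)) \<longlongrightarrow> 0) ioo" if "i \<in> {-1, 0, 1 :: int}" for i
    proof -
      have "((\<lambda>t. qq t * wH (- 1 / t + of_int (i + 1)) - omg\<^sup>2 * (qq t * wH (- 1 / t + of_int i))) \<longlongrightarrow> 0 - omg\<^sup>2 * 0) ioo"
        using that by (intro tendsto_diff tendsto_mult[OF tendsto_const] lim_wH_cusp) auto
      thus ?thesis by (simp add: F_def algebra_simps)
    qed
  qed blast
  have "(F \<longlongrightarrow> k) ioo"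
    using k by (auto intro!: tendsto_eventually eventually_mono[OF eventually_ioo_gt[of 0]])
  hence "k = 3 * omg\<^sup>2 - 3" using lim tendsto_unique[OF ioo_neq_bot] by blast
  with k[OF assms] show ?thesis by (simp add: F_def lH_def algebra_simps)
qed

section \<open>Differential identities\<close>

definition vH :: "complex \<Rightarrow> complex" where "vH t = lH t ^ 3 - 27"

text \<open>The three translates of \<open>lH\<close> are its multiples by cube roots of unity, so
  L^3 - 27 is the product of the three translates of \<open>wH\<close>, an eta quotient by
  \<open>eulerP_omg\<close>. In particular it has no zeros.\<close>

lemma vH_eta:
  assumes t: "Im t > 0"
  shows "vH t = eulerP (qq t ^ 3) ^ 12 / (qq t ^ 3 * eulerP (qq t ^ 9) ^ 12)"
proof -
  define q where "q = qq t"
  have q: "norm q < 1" "q \<noteq> 0" "eulerP (q ^ 9) \<noteq> 0"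
    unfolding q_def using norm_qq_less_1[OF t] eulerP_qq_nz[OF t] by auto
  have t1: "Im (t + 1) > 0" using t by simp
  have qj: "qq (t + 1) = omg * q" "qq (t + 1 + 1) = omg\<^sup>2 * q"
    by (simp_all only: qq_T q_def power2_eq_square mult.assoc)
  have l: "lH (t + 1 + 1) = omg * lH t"
    using lH_T[OF t] lH_T[OF t1] omg_power_simps by (simp add: mult.assoc[symmetric] power2_eq_square)
  have "wH t = lH t - 3" "wH (t + 1) = omg\<^sup>2 * lH t - 3" "wH (t + 1 + 1) = omg * lH t - 3"
    unfolding l[symmetric] lH_T[OF t, symmetric] unfolding lH_def by simp_all
  hence "wH t * wH (t + 1) * wH (t + 1 + 1) = (lH t - 3) * (omg\<^sup>2 * lH t - 3) * (omg * lH t - 3)"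
    by (simp only:)
  also have "\<dots> = - 27 * ((1 - lH t / 3) * (1 - omg * (lH t / 3)) * (1 - omg\<^sup>2 * (lH t / 3)))"
    by (simp add: field_simps)
  also have "\<dots> = vH t" unfolding omg_factor by (simp add: vH_def power_divide)
  finally have "vH t = wq q * wq (omg * q) * wq (omg\<^sup>2 * q)"
    by (simp only: wH_def qj) (simp add: q_def)
  also have "\<dots> = (eulerP q * eulerP (omg * q) * eulerP (omg\<^sup>2 * q)) ^ 3 / (q ^ 3 * (omg * omg\<^sup>2) * eulerP (q ^ 9) ^ 9)"
  proof -
    have "(omg * q) ^ 9 = q ^ 9" "(omg\<^sup>2 * q) ^ 9 = q ^ 9"
      using power_mult[of omg 3 3] power_mult[of "omg\<^sup>2" 3 3] by (simp_all add: power_mult_distrib omg_cube omg_power_simps)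
    moreover have "x ^ 3 / (q * y ^ 3) * (x1 ^ 3 / (a * q * y ^ 3)) * (x2 ^ 3 / (b * q * y ^ 3)) =
        (x * x1 * x2) ^ 3 / (q ^ 3 * (a * b) * y ^ 9)" for x x1 x2 a b y :: complex
      by (simp add: eval_nat_numeral mult_ac)
    ultimately show ?thesis by (simp only: wq_def)
  qed
  also have "eulerP q * eulerP (omg * q) * eulerP (omg\<^sup>2 * q) = eulerP (q ^ 3) ^ 4 / eulerP (q ^ 9)"
    using eulerP_omg[OF q(1)] q(3) by (simp add: field_simps)
  also have "(eulerP (q ^ 3) ^ 4 / eulerP (q ^ 9)) ^ 3 / (q ^ 3 * (omg * omg\<^sup>2) * eulerP (q ^ 9) ^ 9) =
      eulerP (q ^ 3) ^ 12 / (q ^ 3 * eulerP (q ^ 9) ^ 12)"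
    using q(3) by (simp add: omg_cube' power_divide power_mult[symmetric] power_add[symmetric] field_simps)
  finally show ?thesis by (simp add: q_def)
qed

lemma vH_nz: "Im t > 0 \<Longrightarrow> vH t \<noteq> 0"
  using eulerP_qq_nz[of t 3] eulerP_qq_nz[of t 9] by (simp add: vH_eta)

lemma gH_nz: "Im t > 0 \<Longrightarrow> gH t \<noteq> 0"
  using eulerP_qq_nz[of t 3] by (simp add: gH_def gq_def)

lemma gH_cube: "Im t > 0 \<Longrightarrow> gH t ^ 3 * vH t = bH t ^ 4"
  using eulerP_qq_nz[of t 3] eulerP_qq_nz[of t 9]
  by (simp add: vH_eta gH_def gq_def bH_def bq_def power_mult_distrib power_divide power_mult[symmetric]
      power_add[symmetric] field_simps)

definition dL :: "complex \<Rightarrow> complex" where "dL t = cD * deriv lH t"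

lemma lH_deriv: "Im t > 0 \<Longrightarrow> (lH has_field_derivative dL t / cD) (at t)"
  unfolding dL_def using holomorphic_derivI[OF holomorphic_lH open_uhp] by simp

lemma holomorphic_dL: "dL holomorphic_on uhp"
  unfolding dL_def[abs_def] by (intro holomorphic_intros holomorphic_deriv holomorphic_lH open_uhp)

lemma qexp_dL: "qexp dL (ftheta lf)"
  unfolding dL_def[abs_def] by (rule qexp_deriv[OF qexp_lH])

lemma mob_deriv:
  assumes "a * d - b * c = 1" "Im t > 0"
  shows "(mob a b c d has_field_derivative inverse ((of_int c * t + of_int d)\<^sup>2)) (at t)"
proof -
  have nz: "of_int c * t + of_int d \<noteq> 0" by (rule Im_mob_pos[OF assms])
  have det: "of_int a * of_int d - of_int b * of_int c = (1 :: complex)"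
    using assms(1) by (metis of_int_1 of_int_diff of_int_mult)
  have "(of_int a * (of_int c * t + of_int d) - (of_int a * t + of_int b) * of_int c) = (1 :: complex)"
    using det by (simp add: algebra_simps)
  moreover have "(mob a b c d has_field_derivative
      ((of_int a * (of_int c * t + of_int d) - (of_int a * t + of_int b) * of_int c) / ((of_int c * t + of_int d) * (of_int c * t + of_int d)))) (at t)"
    unfolding mob_def[abs_def] using nz by (auto intro!: derivative_eq_intros)
  ultimately show ?thesis by (simp add: power2_eq_square divide_inverse)
qed

lemma has_field_derivative_transform_uhp:
  assumes "(f has_field_derivative D) (at t)" "Im t > 0" "\<And>s. Im s > 0 \<Longrightarrow> f s = g s"
  shows "(g has_field_derivative D) (at t)"
  using has_field_derivative_transform_within_open[OF assms(1) open_uhp] assms(2,3) by simp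

lemma dL_gam3:
  assumes "gam3 a b c d" "Im t > 0"
  shows "dL (mob a b c d t) = (of_int c * t + of_int d)\<^sup>2 * dL t"
proof -
  have det: "a * d - b * c = 1" using assms(1) by (simp add: gam3_def)
  define J where "J = of_int c * t + (of_int d :: complex)"
  have nz: "J \<noteq> 0" unfolding J_def by (rule Im_mob_pos[OF det assms(2)])
  have "((\<lambda>s. lH (mob a b c d s)) has_field_derivative (dL (mob a b c d t) / cD * inverse (J\<^sup>2))) (at t)"
    unfolding J_def by (rule DERIV_chain2[OF lH_deriv mob_deriv]) (use Im_mob_pos det assms in auto)
  moreover have "((\<lambda>s. lH (mob a b c d s)) has_field_derivative (dL t / cD)) (at t)"
    by (rule has_field_derivative_transform_uhp[OF lH_deriv])
       (use assms wH_gam3[OF assms(1)] in \<open>auto simp: lH_def\<close>)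
  ultimately have "dL (mob a b c d t) / cD * inverse (J\<^sup>2) = dL t / cD" by (rule DERIV_unique)
  thus ?thesis using nz unfolding J_def[symmetric] by (simp add: field_simps)
qed

lemma dL_S:
  assumes "Im t > 0"
  shows "dL (- 1 / t) = - 27 * t\<^sup>2 * dL t / wH t ^ 2"
proof -
  have nz: "t \<noteq> 0" "wH t \<noteq> 0" using assms wH_nz[OF assms] by auto
  have im: "Im (- 1 / t) > 0" by (rule Im_minus_inverse[OF assms])
  have w': "(wH has_field_derivative dL t / cD) (at t)"
  proof -
    have "((\<lambda>t. lH t - 3) has_field_derivative dL t / cD - 0) (at t)"
      by (intro DERIV_diff lH_deriv assms DERIV_const)
    thus ?thesis by (simp add: lH_def)
  qed
  have "((\<lambda>s. - 1 / s) has_field_derivative 1 / t\<^sup>2) (at t)"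
    using nz by (auto intro!: derivative_eq_intros simp: power2_eq_square)
  hence "((\<lambda>s. lH (- 1 / s)) has_field_derivative (dL (- 1 / t) / cD * (1 / t\<^sup>2))) (at t)"
    by (rule DERIV_chain2[of lH _ "\<lambda>s. - 1 / s", OF lH_deriv[OF im]])
  moreover have "((\<lambda>s. lH (- 1 / s)) has_field_derivative (- 27 * (dL t / cD) / wH t ^ 2)) (at t)"
  proof (rule has_field_derivative_transform_uhp[OF _ assms])
    show "((\<lambda>s. 3 + 27 / wH s) has_field_derivative (- 27 * (dL t / cD) / wH t ^ 2)) (at t)"
      using nz by (auto intro!: derivative_eq_intros w' simp: power2_eq_square)
  qed (simp only: lH_def wH_S add.commute)
  ultimately have "dL (- 1 / t) / cD * (1 / t\<^sup>2) = - 27 * (dL t / cD) / wH t ^ 2" by (rule DERIV_unique)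
  thus ?thesis using nz by (simp add: field_simps)
qed

lemma dL_T:
  assumes "Im t > 0"
  shows "dL (t + 1) = omg\<^sup>2 * dL t"
proof -
  have "((\<lambda>s. s + 1) has_field_derivative 1) (at t)" by (auto intro!: derivative_eq_intros)
  moreover have im: "Im (t + 1) > 0" using assms by simp
  ultimately have "((\<lambda>s. lH (s + 1)) has_field_derivative (dL (t + 1) / cD * 1)) (at t)"
    by (intro DERIV_chain2[OF lH_deriv])
  moreover have "((\<lambda>s. lH (s + 1)) has_field_derivative (omg\<^sup>2 * (dL t / cD))) (at t)"
    by (rule has_field_derivative_transform_uhp[OF DERIV_cmult[OF lH_deriv] assms]) (use assms in \<open>simp_all add: lH_T\<close>)
  ultimately have "dL (t + 1) / cD * 1 = omg\<^sup>2 * (dL t / cD)" by (rule DERIV_unique)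
  thus ?thesis by (simp add: field_simps)
qed

lemma vH_S:
  assumes "Im t > 0"
  shows "vH (- 1 / t) = 27\<^sup>2 * vH t / wH t ^ 4"
proof -
  have nz: "wH t \<noteq> 0" by (rule wH_nz[OF assms])
  have "vH (- 1 / t) = (27 / wH t + 3) ^ 3 - 27" by (simp only: vH_def lH_def wH_S[OF assms])
  also have "27 / wH t + 3 = (27 + 3 * wH t) / wH t" using nz by (simp add: field_simps)
  also have "((27 + 3 * wH t) / wH t) ^ 3 - 27 = 27\<^sup>2 * ((wH t + 3) ^ 3 - 27) / wH t ^ 4"
    using nz by (simp add: field_simps power3_eq_cube power4_eq_xxxx)
  finally show ?thesis by (simp add: vH_def lH_def)
qed

lemma lim_qq_lH: "((\<lambda>t. qq t * lH t) \<longlongrightarrow> 1) ioo"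
  unfolding lH_def distrib_left using tendsto_add[OF lim_qq_wH tendsto_mult_left_zero[OF lim_qq, of 3]] by simp

lemma lim_qq_dL: "((\<lambda>t. qq t * dL t) \<longlongrightarrow> - 1) ioo"
proof -
  have 1: "qexp (\<lambda>t. qq t * dL t) (fls_X * ftheta lf)" by (intro qexp_mult qexp_qq qexp_dL)
  have nth: "fls_nth (fls_X * ftheta lf) n = of_int (n - 1) * fls_nth lf (n - 1)" for n
    by (simp add: fls_X_times_conv_shift)
  have "fls_subdegree (fls_X * ftheta lf) \<ge> 0"
    by (rule fls_subdegree_geI) (use lfps_coeffs in \<open>auto simp: nth lf_nth dest!: fun_cong[of _ _ 0] simp: fls_eq_iff intro!: exI[of _ 0]\<close>)
  from qexp_tendsto[OF 1 this] show ?thesis by (simp add: nth lf_nth lfps_coeffs)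
qed

lemma lim_bH: "(bH \<longlongrightarrow> 1) ioo"
proof -
  have "((\<lambda>t. eulerP (qq t ^ 3) ^ 9 / eulerP (qq t ^ 9) ^ 3) \<longlongrightarrow> 1 ^ 9 / 1 ^ 3) ioo"
    by (intro tendsto_intros lim_eulerP) (auto intro!: tendsto_eq_intros lim_qq)
  thus ?thesis by (simp add: bH_def[abs_def] bq_def)
qed

lemma lim_gH_qq: "((\<lambda>t. gH t / qq t) \<longlongrightarrow> 1) ioo"
proof -
  have "((\<lambda>t. eulerP (qq t ^ 3) ^ 8) \<longlongrightarrow> 1 ^ 8) ioo"
    by (intro tendsto_intros lim_eulerP) (auto intro!: tendsto_eq_intros lim_qq)
  thus ?thesis by (simp add: gH_def[abs_def] gq_def)
qed

text \<open>Since \<open>bH\<close> and \<open>vH\<close> have no zeros, the quotient is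
  holomorphic. It is invariant under T and S besides Gamma(3): the powers of \<open>wH\<close> and
  the constants 27 and \<open>kc\<close> balance. So every cusp looks like infinity, where the limit
  is -1.\<close>

lemma dL_cube:
  assumes "Im t > 0"
  shows "dL t ^ 3 = - (bH t)\<^sup>2 * vH t"
proof -
  define F where "F = (\<lambda>t. dL t ^ 3 / ((bH t)\<^sup>2 * vH t))"
  have FT: "F (t + 1) = F t" if "Im t > 0" for t
    using lH_T[OF that] dL_T[OF that]
    by (simp add: F_def vH_def bH_T power_mult_distrib omg_power_simps)
  have FS: "F (- 1 / t) = F t" if t: "Im t > 0" for t
  proof -
    have nz: "t \<noteq> 0" "wH t \<noteq> 0" "bH t \<noteq> 0" "vH t \<noteq> 0" using t wH_nz bH_nz vH_nz by auto
    have "F (- 1 / t) = (- 27 * t\<^sup>2 * dL t / wH t ^ 2) ^ 3 / ((t ^ 3 * kc * bH t / wH t)\<^sup>2 * (27\<^sup>2 * vH t / wH t ^ 4))"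
      by (simp only: F_def dL_S[OF t] bH_S[OF t] vH_S[OF t])
    also have "\<dots> = (-27) ^ 3 * dL t ^ 3 / (kc\<^sup>2 * 27\<^sup>2 * ((bH t)\<^sup>2 * vH t))"
    proof -
      have "(- 27 * T\<^sup>2 * X / W ^ 2) ^ 3 / ((T ^ 3 * k * B / W)\<^sup>2 * (27\<^sup>2 * V / W ^ 4)) =
         (- 27) ^ 3 * X ^ 3 / (k\<^sup>2 * 27\<^sup>2 * (B\<^sup>2 * V))" if "T \<noteq> 0" "W \<noteq> 0" "B \<noteq> 0" "V \<noteq> 0" for T X W k B V :: complex
        using that by (simp add: power_divide power_mult_distrib power_mult[symmetric] power_add[symmetric])
      thus ?thesis using nz by blast
    qed
    finally show ?thesis by (simp add: kc_square F_def)
  qed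
  have lim: "(F \<longlongrightarrow> - 1) ioo"
  proof -
    have "((\<lambda>t. (qq t * dL t) ^ 3 / ((bH t)\<^sup>2 * ((qq t * lH t) ^ 3 - 27 * qq t ^ 3))) \<longlongrightarrow> (- 1) ^ 3 / (1\<^sup>2 * (1 ^ 3 - 27 * 0 ^ 3))) ioo"
      by (intro tendsto_intros lim_qq_dL lim_bH lim_qq_lH lim_qq) auto
    also have "(\<lambda>t. (qq t * dL t) ^ 3 / ((bH t)\<^sup>2 * ((qq t * lH t) ^ 3 - 27 * qq t ^ 3))) = F"
    proof
      fix t
      have "(qq t * lH t) ^ 3 - 27 * qq t ^ 3 = qq t ^ 3 * vH t"
        by (simp add: vH_def power_mult_distrib algebra_simps)
      thus "(qq t * dL t) ^ 3 / ((bH t)\<^sup>2 * ((qq t * lH t) ^ 3 - 27 * qq t ^ 3)) = F t"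
        by (simp add: F_def power_mult_distrib)
    qed
    finally show ?thesis by simp
  qed
  have limq: "((\<lambda>t. qq t * F t) \<longlongrightarrow> 0) ioo" using tendsto_mult[OF lim_qq lim] by simp
  obtain k where k: "\<And>t. Im t > 0 \<Longrightarrow> F t = k"
  proof (rule gam3_liouville[of F])
    show "F holomorphic_on uhp" unfolding F_def
      by (intro holomorphic_intros holomorphic_dL holomorphic_bH) 
         (auto simp: bH_nz vH_nz vH_def[abs_def] intro!: holomorphic_intros holomorphic_lH dest: vH_nz bH_nz)
    show "F (mob a b c d t) = F t" if "gam3 a b c d" "Im t > 0" for a b c d t
    proof -
      have nz: "of_int c * t + of_int d \<noteq> 0" using Im_mob_pos(2)[of a d b c t] that by (simp add: gam3_def)
      have "vH (mob a b c d t) = vH t" by (simp add: vH_def lH_def wH_gam3[OF that])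
      thus ?thesis using nz unfolding F_def dL_gam3[OF that] bH_gam3[OF that]
        by (simp add: power_mult_distrib power_mult[symmetric])
    qed
    show "((\<lambda>t. qq t * F (- 1 / t + of_int i)) \<longlongrightarrow> 0) ioo" if i: "i \<in> {-1, 0, 1 :: int}" for i
    proof (rule Lim_transform_eventually[OF limq])
      have "F (- 1 / t + of_int i) = F t" if t: "Im t > 0" for t
      proof -
        have im: "Im (- 1 / t) > 0" by (rule Im_minus_inverse[OF t])
        from i consider "i = -1" | "i = 0" | "i = 1" by auto
        thus ?thesis
        proof cases
          case 1 thus ?thesis using FT[of "- 1 / t - 1"] im FS[OF t] by simp
        next
          case 3 thus ?thesis using FT[of "- 1 / t"] im FS[OF t] by simp
        qed (use FS[OF t] in simp)
      qed
      thus "\<forall>\<^sub>F t in ioo. qq t * F t = qq t * F (- 1 / t + of_int i)"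
        using eventually_ioo_gt[of 0] by (auto elim!: eventually_mono)
    qed
  qed (use limq in blast)+
  have "(F \<longlongrightarrow> k) ioo"
    using k by (auto intro!: tendsto_eventually eventually_mono[OF eventually_ioo_gt[of 0]])
  hence "k = - 1" using lim tendsto_unique[OF ioo_neq_bot] by blast
  with k[OF assms] show ?thesis
    using bH_nz[OF assms] vH_nz[OF assms] by (simp add: F_def field_simps)
qed

text \<open>The cube of the quotient is -1 by \<open>dL_cube\<close> and \<open>gH_cube\<close>. A
  continuous function with finitely many values on a connected set is constant, and the limit at
  infinity selects the root -1.\<close>

lemma gH_dL:
  assumes "Im t > 0"
  shows "gH t * dL t = - (bH t)\<^sup>2"
proof -
  define F where "F = (\<lambda>t. gH t * dL t / (bH t)\<^sup>2)"
  have cube: "F t ^ 3 = - 1" if t: "Im t > 0" for t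
  proof -
    have nz: "bH t \<noteq> 0" by (rule bH_nz[OF t])
    have "F t ^ 3 = gH t ^ 3 * dL t ^ 3 / bH t ^ 6"
      by (simp add: F_def power_mult_distrib power_divide power_mult[symmetric])
    also have "gH t ^ 3 * dL t ^ 3 = - (bH t)\<^sup>2 * (gH t ^ 3 * vH t)" by (simp add: dL_cube[OF t])
    also have "\<dots> = - (bH t ^ 6)" by (simp add: gH_cube[OF t] power_add[symmetric])
    finally show ?thesis using nz by simp
  qed
  have hol: "F holomorphic_on uhp" unfolding F_def
    by (intro holomorphic_intros holomorphic_dL holomorphic_bH holomorphic_gH) (auto simp: bH_nz)
  have "F constant_on uhp"
  proof (rule continuous_finite_range_constant)
    show "connected uhp" by (intro convex_connected convex_halfspace_Im_gt)
    show "continuous_on uhp F" by (rule holomorphic_on_imp_continuous_on[OF hol])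
    have "finite {z :: complex. z ^ 3 = - 1}" by (rule finite_nth_roots) simp
    moreover have "F ` uhp \<subseteq> {z. z ^ 3 = - 1}" using cube by auto
    ultimately show "finite (F ` uhp)" by (rule finite_subset[rotated])
  qed
  then obtain k where k: "\<And>t. Im t > 0 \<Longrightarrow> F t = k" by (auto simp: constant_on_def)
  have "((\<lambda>t. (gH t / qq t) * (qq t * dL t) / (bH t)\<^sup>2) \<longlongrightarrow> 1 * - 1 / 1\<^sup>2) ioo"
    by (intro tendsto_intros lim_gH_qq lim_qq_dL lim_bH) auto
  hence lim: "(F \<longlongrightarrow> - 1) ioo" by (simp add: F_def[abs_def])
  have "(F \<longlongrightarrow> k) ioo"
    using k by (auto intro!: tendsto_eventually eventually_mono[OF eventually_ioo_gt[of 0]])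
  hence "k = - 1" using lim tendsto_unique[OF ioo_neq_bot] by blast
  with k[OF assms] show ?thesis using bH_nz[OF assms] by (simp add: F_def field_simps)
qed

lemma deriv_shift_1:
  assumes hol: "f holomorphic_on uhp" and per: "\<And>t. Im t > 0 \<Longrightarrow> f (t + 1) = k * f t" and t: "Im t > 0"
  shows "deriv f (t + 1) = k * deriv f t"
proof -
  have der: "(f has_field_derivative deriv f s) (at s)" if "Im s > 0" for s
    using holomorphic_derivI[OF hol open_uhp] that by simp
  have im: "Im (t + 1) > 0" using t by simp
  have "((\<lambda>s. s + 1) has_field_derivative 1) (at t)" by (auto intro!: derivative_eq_intros)
  hence "((\<lambda>s. f (s + 1)) has_field_derivative (deriv f (t + 1) * 1)) (at t)"
    by (rule DERIV_chain2[of f _ "\<lambda>s. s + 1", OF der[OF im]])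
  moreover have "((\<lambda>s. f (s + 1)) has_field_derivative (k * deriv f t)) (at t)"
    by (rule has_field_derivative_transform_uhp[OF DERIV_cmult[OF der] t]) (use t per in simp_all)
  ultimately have "deriv f (t + 1) * 1 = k * deriv f t" by (rule DERIV_unique)
  thus ?thesis by simp
qed

text \<open>Bol's identity: the second derivative maps weight \<open>-1\<close> to weight \<open>3\<close>.\<close>

lemma bol_weight_minus_1:
  assumes hol: "f holomorphic_on uhp" and hol': "h holomorphic_on uhp"
    and det: "a * d - b * c = 1"
    and eq: "\<And>t. Im t > 0 \<Longrightarrow> h t = (of_int c * t + of_int d) * f (mob a b c d t)"
    and t: "Im t > 0"
  shows "deriv (deriv f) (mob a b c d t) = (of_int c * t + of_int d) ^ 3 * deriv (deriv h) t"
proof -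
  define J where "J = (\<lambda>t::complex. of_int c * t + of_int d)"
  define m where "m = mob a b c d"
  have J: "J s \<noteq> 0" if "Im s > 0" for s unfolding J_def by (rule Im_mob_pos[OF det that])
  have J': "(J has_field_derivative of_int c) (at s)" for s
    unfolding J_def by (auto intro!: derivative_eq_intros)
  have m': "(m has_field_derivative inverse (J s ^ 2)) (at s)" if "Im s > 0" for s
    unfolding J_def m_def by (rule mob_deriv[OF det that])
  have im: "Im (m s) > 0" if "Im s > 0" for s unfolding m_def by (rule Im_mob_pos[OF det that])
  have f': "((\<lambda>s. f (m s)) has_field_derivative (deriv f (m s) * inverse (J s ^ 2))) (at s)" if "Im s > 0" for s
    by (rule DERIV_chain2[OF _ m'[OF that]]) (use holomorphic_derivI[OF hol open_uhp] im that in simp)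
  have hol2: "deriv f holomorphic_on uhp" by (intro holomorphic_deriv hol open_uhp)
  have f'': "((\<lambda>s. deriv f (m s)) has_field_derivative (deriv (deriv f) (m s) * inverse (J s ^ 2))) (at s)" if "Im s > 0" for s
    by (rule DERIV_chain2[OF _ m'[OF that]]) (use holomorphic_derivI[OF hol2 open_uhp] im that in simp)
  have h': "deriv h s = of_int c * f (m s) + deriv f (m s) / J s" if s: "Im s > 0" for s
  proof -
    have "((\<lambda>s. J s * f (m s)) has_field_derivative (of_int c * f (m s) + deriv f (m s) / J s)) (at s)"
      using J[OF s] by (auto intro!: derivative_eq_intros J' f' s simp: field_simps power2_eq_square)
    hence "(h has_field_derivative (of_int c * f (m s) + deriv f (m s) / J s)) (at s)"
      by (rule has_field_derivative_transform_uhp[OF _ s]) (simp add: eq J_def m_def)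
    thus ?thesis by (rule DERIV_imp_deriv)
  qed
  have "((\<lambda>s. of_int c * f (m s) + deriv f (m s) / J s) has_field_derivative (deriv (deriv f) (m t) / J t ^ 3)) (at t)"
    using J[OF t] by (auto intro!: derivative_eq_intros J' f' f'' t simp: field_simps power2_eq_square power3_eq_cube)
  hence "(deriv h has_field_derivative (deriv (deriv f) (m t) / J t ^ 3)) (at t)"
    by (rule has_field_derivative_transform_uhp[OF _ t]) (simp add: h')
  hence "deriv (deriv h) t = deriv (deriv f) (m t) / J t ^ 3" by (rule DERIV_imp_deriv)
  thus ?thesis using J[OF t] by (simp add: J_def m_def)
qed

definition D2 :: "(complex \<Rightarrow> complex) \<Rightarrow> complex \<Rightarrow> complex" where
  "D2 f t = cD\<^sup>2 * deriv (deriv f) t"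

lemma qexp_D2:
  assumes "f holomorphic_on uhp" "qexp f F"
  shows "qexp (D2 f) (ftheta (ftheta F))"
proof (rule qexp_cong[OF _ qexp_deriv[OF qexp_deriv[OF assms(2)]]])
  fix t assume t: "Im t > 0"
  have "deriv f holomorphic_on uhp" by (intro holomorphic_deriv assms open_uhp)
  hence "deriv f field_differentiable at t"
    using holomorphic_on_imp_differentiable_at[OF _ open_uhp] t by simp
  hence "deriv (\<lambda>t. cD * deriv f t) t = cD * deriv (deriv f) t" by (rule deriv_cmult)
  thus "cD * deriv (\<lambda>t. cD * deriv f t) t = D2 f t"
    by (simp add: D2_def power2_eq_square)
qed

lemma fls_subdegree_ge_nthI:
  fixes F :: "complex fls"
  assumes "\<And>k. k < n \<Longrightarrow> fls_nth F k = 0" "n \<le> 0"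
  shows "fls_subdegree F \<ge> n"
  using assms by (cases "F = 0") (auto intro: fls_subdegree_geI)

text \<open>Of weight -1, the weight to which Bol's identity applies. Its reciprocal is the function
  that becomes hypergeometric in 1/L.\<close>

definition fH :: "complex \<Rightarrow> complex" where "fH t = - dL t / bH t"

lemma holomorphic_fH: "fH holomorphic_on uhp"
  unfolding fH_def[abs_def] by (intro holomorphic_intros holomorphic_dL holomorphic_bH) (auto simp: bH_nz)

definition ff :: "complex fls" where "ff = - ftheta lf / bf"

lemma qexp_fH: "qexp fH ff"
  unfolding fH_def[abs_def] ff_def by (intro qexp_divide qexp_uminus qexp_dL qexp_bH)

lemma subdegree_lf: "fls_subdegree lf = -1"
  by (rule fls_subdegree_eqI) (auto simp: lf_nth lfps_coeffs)

lemma subdegree_ftheta_lf: "fls_subdegree (ftheta lf) = -1"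
  by (rule fls_subdegree_eqI) (auto simp: lf_nth lfps_coeffs)

lemma bf_0: "fls_nth bf 0 = 1"
  by (simp add: bf_nth fps_power_zeroth)

lemma subdegree_bf: "fls_subdegree bf = 0"
  by (rule fls_subdegree_eqI) (auto simp: bf_0, simp add: bf_nth)

lemma nz_fls: "lf \<noteq> 0" "ftheta lf \<noteq> 0" "bf \<noteq> 0"
  using subdegree_lf subdegree_ftheta_lf bf_0 by auto

lemma subdegree_ff: "fls_subdegree ff = -1"
  unfolding ff_def by (subst fls_divide_subdegree) (use nz_fls in \<open>auto simp: subdegree_ftheta_lf subdegree_bf\<close>)

lemma lim_qq_fH: "((\<lambda>t. qq t * fH t) \<longlongrightarrow> 1) ioo"
proof -
  have "((\<lambda>t. - (qq t * dL t) / bH t) \<longlongrightarrow> - (- 1) / 1) ioo"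
    by (intro tendsto_intros lim_qq_dL lim_bH) auto
  thus ?thesis by (simp add: fH_def)
qed

lemma ff_m1: "fls_nth ff (-1) = 1"
proof -
  have "qexp (\<lambda>t. qq t * fH t) (fls_X * ff)" by (intro qexp_mult qexp_qq qexp_fH)
  moreover have "fls_subdegree (fls_X * ff) \<ge> 0"
    by (rule fls_subdegree_ge_nthI) (use subdegree_ff in \<open>auto simp: fls_X_times_conv_shift\<close>)
  ultimately have "((\<lambda>t. qq t * fH t) \<longlongrightarrow> fls_nth (fls_X * ff) 0) ioo" by (rule qexp_tendsto)
  hence "fls_nth (fls_X * ff) 0 = 1" using lim_qq_fH tendsto_unique[OF ioo_neq_bot] by blast
  thus ?thesis by (simp add: fls_X_times_conv_shift)
qed

lemma lim_qq_D2_fH: "((\<lambda>t. qq t * D2 fH t) \<longlongrightarrow> 1) ioo"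
proof -
  have 1: "qexp (\<lambda>t. qq t * D2 fH t) (fls_X * ftheta (ftheta ff))"
    by (intro qexp_mult qexp_qq qexp_D2 holomorphic_fH qexp_fH)
  have "fls_subdegree (fls_X * ftheta (ftheta ff)) \<ge> 0"
    by (rule fls_subdegree_ge_nthI) (use subdegree_ff in \<open>auto simp: fls_X_times_conv_shift\<close>)
  from qexp_tendsto[OF 1 this] show ?thesis by (simp add: fls_X_times_conv_shift ff_m1)
qed

lemma kc_inverse: "27 / kc = - kc"
  using kc_square by (simp add: field_simps power2_eq_square)

lemma fH_S:
  assumes "Im t > 0"
  shows "t * fH (- 1 / t) = kc * fH t / wH t"
proof -
  have nz: "t \<noteq> 0" "wH t \<noteq> 0" "bH t \<noteq> 0" using assms wH_nz bH_nz by auto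
  have "t * fH (- 1 / t) = (27 / kc) * dL t / (bH t * wH t)"
    unfolding fH_def dL_S[OF assms] bH_S[OF assms]
    using nz by (simp add: field_simps power2_eq_square power3_eq_cube)
  thus ?thesis by (simp add: kc_inverse fH_def)
qed

lemma fH_gam3:
  assumes "gam3 a b c d" "Im t > 0"
  shows "fH t = (of_int c * t + of_int d) * fH (mob a b c d t)"
proof -
  define J where "J = of_int c * t + (of_int d :: complex)"
  have "J \<noteq> 0" unfolding J_def using Im_mob_pos(2)[of a d b c t] assms by (simp add: gam3_def)
  thus ?thesis unfolding fH_def dL_gam3[OF assms] bH_gam3[OF assms] J_def[symmetric]
    by (simp add: field_simps power2_eq_square power3_eq_cube)
qed

lemma lH_S: "Im t > 0 \<Longrightarrow> lH (- 1 / t) = 27 * inverse (wH t) + 3"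
  by (simp only: lH_def wH_S) (simp add: divide_inverse)

text \<open>The quotient \<open>D2 fH t / bH t\<close> and L both have weight 0, and their poles at
  infinity cancel, so the difference is constant. Translation by 1 multiplies it by the square of
  \<open>omg\<close>, hence the constant is 0.\<close>

lemma D2_fH:
  assumes "Im t > 0"
  shows "D2 fH t = bH t * lH t"
proof -
  define F where "F = (\<lambda>t. D2 fH t / bH t - lH t)"
  have D2hol: "D2 fH holomorphic_on uhp"
    unfolding D2_def[abs_def] by (intro holomorphic_intros holomorphic_deriv holomorphic_fH open_uhp)
  have fT: "fH (t + 1) = omg\<^sup>2 * fH t" if "Im t > 0" for t
    by (simp add: fH_def dL_T[OF that] bH_T)
  have fT2: "deriv (deriv fH) (t + 1) = omg\<^sup>2 * deriv (deriv fH) t" if "Im t > 0" for t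
    by (rule deriv_shift_1[OF _ _ that]) (auto intro!: holomorphic_deriv holomorphic_fH open_uhp deriv_shift_1 fT)
  have FT: "F (t + 1) = omg\<^sup>2 * F t" if "Im t > 0" for t
    unfolding F_def D2_def bH_T lH_T[OF that] fT2[OF that] by (simp add: algebra_simps)
  have lim: "((\<lambda>t. qq t * F t) \<longlongrightarrow> 0) ioo"
  proof -
    have "((\<lambda>t. qq t * D2 fH t / bH t - qq t * lH t) \<longlongrightarrow> 1 / 1 - 1) ioo"
      by (intro tendsto_intros lim_qq_D2_fH lim_bH lim_qq_lH) auto
    thus ?thesis by (simp add: F_def right_diff_distrib)
  qed
  define h where "h = (\<lambda>t. kc * fH t / wH t)"
  have hol_h: "h holomorphic_on uhp" unfolding h_def
    by (intro holomorphic_intros holomorphic_fH holomorphic_wH) (auto simp: wH_nz)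
  have FS: "F (- 1 / t) = D2 h t * wH t / (kc * bH t) - (27 * inverse (wH t) + 3)" if t: "Im t > 0" for t
  proof -
    have nz: "t \<noteq> 0" "wH t \<noteq> 0" "bH t \<noteq> 0" using t wH_nz bH_nz by auto
    have "deriv (deriv fH) (mob 0 (-1) 1 0 t) = (of_int 1 * t + of_int 0) ^ 3 * deriv (deriv h) t"
      by (rule bol_weight_minus_1[OF holomorphic_fH hol_h _ _ t])
         (simp, simp only: mob_S h_def fH_S[symmetric] of_int_0 of_int_1 mult_1 add_0_right)
    hence "D2 fH (- 1 / t) = t ^ 3 * D2 h t" by (simp add: D2_def mob_S)
    thus ?thesis unfolding F_def lH_S[OF t] bH_S[OF t] using nz by simp
  qed
  have limS: "((\<lambda>t. qq t * F (- 1 / t)) \<longlongrightarrow> 0) ioo"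
  proof -
    define H where "H = fls_const kc * ff / (lf - 3)"
    have wf: "qexp wH (lf - 3)" 
      using qexp_diff[OF qexp_lH qexp_const[of 3]] by (simp add: lH_def fls_const_numeral)
    have qh: "qexp h H" unfolding h_def H_def by (intro qexp_divide qexp_cmult qexp_fH wf)
    have "fls_subdegree (lf - 3) = -1"
      by (rule fls_subdegree_eqI) (auto simp: lf_nth lfps_coeffs)
    moreover from this have "lf - 3 \<noteq> 0" by auto
    moreover have "ff \<noteq> 0" using ff_m1 by auto
    ultimately have "fls_subdegree H = 0" unfolding H_def
      by (subst fls_divide_subdegree) (auto simp: subdegree_ff)
    \<comment> \<open>At the cusp 0 the transformed function \<open>h\<close> is regular, and q d/dq
      annihilates its constant term; so \<open>D2 h\<close> tends to 0 while
      \<open>qq t * wH t\<close> stays bounded.\<close>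
    hence "fls_subdegree (ftheta (ftheta H)) \<ge> 0"
      by (intro fls_subdegree_ge_nthI) auto
    from qexp_tendsto[OF qexp_D2[OF hol_h qh] this] have "(D2 h \<longlongrightarrow> 0) ioo" by simp
    hence "((\<lambda>t. D2 h t * (qq t * wH t) / (kc * bH t) - qq t * (27 * inverse (wH t) + 3)) \<longlongrightarrow>
        0 * 1 / (kc * 1) - 0 * (27 * 0 + 3)) ioo"
      by (intro tendsto_intros lim_qq_wH lim_bH lim_qq lim_inverse_wH) auto
    hence "((\<lambda>t. qq t * (D2 h t * wH t / (kc * bH t) - (27 * inverse (wH t) + 3))) \<longlongrightarrow> 0) ioo"
      by (simp add: algebra_simps)
    moreover have "\<forall>\<^sub>F t in ioo. qq t * (D2 h t * wH t / (kc * bH t) - (27 * inverse (wH t) + 3)) = qq t * F (- 1 / t)"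
      using eventually_ioo_gt[of 0] by eventually_elim (simp only: FS)
    ultimately show ?thesis by (rule Lim_transform_eventually)
  qed
  obtain k where k: "\<And>t. Im t > 0 \<Longrightarrow> F t = k"
  proof (rule gam3_liouville[of F])
    show "F holomorphic_on uhp" unfolding F_def
      by (intro holomorphic_intros D2hol holomorphic_bH holomorphic_lH) (auto simp: bH_nz)
    show "F (mob a b c d t) = F t" if g: "gam3 a b c d" and t: "Im t > 0" for a b c d t
    proof -
      have det: "a * d - b * c = 1" using g by (simp add: gam3_def)
      have "deriv (deriv fH) (mob a b c d t) = (of_int c * t + of_int d) ^ 3 * deriv (deriv fH) t"
        by (rule bol_weight_minus_1[OF holomorphic_fH holomorphic_fH det fH_gam3[OF g] t])
      moreover have "of_int c * t + of_int d \<noteq> 0" by (rule Im_mob_pos[OF det t])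
      ultimately show ?thesis using wH_gam3[OF g t] by (simp add: F_def D2_def bH_gam3[OF g t] lH_def)
    qed
    show "((\<lambda>t. qq t * F (- 1 / t + of_int i)) \<longlongrightarrow> 0) ioo" if i: "i \<in> {-1, 0, 1 :: int}" for i
    proof -
      have "\<exists>x. \<forall>s. Im s > 0 \<longrightarrow> F (s + of_int i) = x * F s"
      proof -
        from i consider "i = -1" | "i = 0" | "i = 1" by auto
        thus ?thesis
        proof cases
          case 1
          have "F (s - 1) = omg * F s" if "Im s > 0" for s
            using FT[of "s - 1"] that by (simp add: mult.assoc[symmetric] omg_cube')
          thus ?thesis using 1 by auto
        next
          case 2 thus ?thesis by (intro exI[of _ 1]) simp
        qed (use FT in auto)
      qed
      then obtain x where x: "\<And>s. Im s > 0 \<Longrightarrow> F (s + of_int i) = x * F s" by blast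
      have "((\<lambda>t. x * (qq t * F (- 1 / t))) \<longlongrightarrow> x * 0) ioo" by (intro tendsto_intros limS)
      moreover have "\<forall>\<^sub>F t in ioo. x * (qq t * F (- 1 / t)) = qq t * F (- 1 / t + of_int i)"
        using eventually_ioo_gt[of 0] by eventually_elim (simp add: x Im_minus_inverse del: divide_minus_left)
      ultimately show ?thesis by (simp add: Lim_transform_eventually)
    qed
  qed (use lim in blast)+
  have "Im (t + 1) > 0" using assms by simp
  hence "k = omg\<^sup>2 * k" using FT[OF assms] by (simp only: k assms)
  hence "(1 - omg\<^sup>2) * k = 0" by (simp add: algebra_simps)
  moreover have "omg\<^sup>2 \<noteq> 1" using omg_cube' omg_ne by (metis mult.right_neutral)
  ultimately have "k = 0" by simp
  thus ?thesis using k[OF assms] bH_nz[OF assms] by (simp add: F_def field_simps)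
qed

lemma ftheta_lf_cube: "ftheta lf ^ 3 = - bf\<^sup>2 * (lf ^ 3 - 27)"
proof (rule qexp_unique)
  show "qexp (\<lambda>t. dL t ^ 3) (ftheta lf ^ 3)" by (intro qexp_power qexp_dL)
  have "qexp (\<lambda>t. - (bH t)\<^sup>2 * (lH t ^ 3 - 27)) (- bf\<^sup>2 * (lf ^ 3 - fls_const 27))"
    by (intro qexp_mult qexp_uminus qexp_power qexp_bH qexp_diff qexp_const qexp_lH)
  hence *: "qexp (\<lambda>t. - (bH t)\<^sup>2 * (lH t ^ 3 - 27)) (- bf\<^sup>2 * (lf ^ 3 - 27))"
    by (simp only: fls_const_numeral)
  show "qexp (\<lambda>t. dL t ^ 3) (- bf\<^sup>2 * (lf ^ 3 - 27))"
    by (rule qexp_cong[OF _ *]) (simp only: dL_cube vH_def)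
qed

lemma gf_ftheta_lf: "gf * ftheta lf = - bf\<^sup>2"
proof (rule qexp_unique)
  show "qexp (\<lambda>t. gH t * dL t) (gf * ftheta lf)" by (intro qexp_mult qexp_gH qexp_dL)
  show "qexp (\<lambda>t. gH t * dL t) (- bf\<^sup>2)"
    by (rule qexp_cong[OF _ qexp_uminus[OF qexp_power[OF qexp_bH]]]) (simp add: gH_dL)
qed

lemma ftheta_ftheta_ff: "ftheta (ftheta ff) = bf * lf"
proof (rule qexp_unique)
  show "qexp (D2 fH) (ftheta (ftheta ff))" by (intro qexp_D2 holomorphic_fH qexp_fH)
  show "qexp (D2 fH) (bf * lf)"
    by (rule qexp_cong[OF _ qexp_mult[OF qexp_bH qexp_lH]]) (simp add: D2_fH)
qed

section \<open>The Hecke operator\<close>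

lemma qexp_fps_sums:
  assumes "qexp f (fps_to_fls P)"
  shows "\<forall>\<^sub>F t in ioo. (\<lambda>n. fps_nth P n * qq t ^ n) sums f t"
proof -
  obtain \<phi> where *: "\<phi> has_laurent_expansion fps_to_fls P" "\<forall>\<^sub>F t in ioo. f t = \<phi> (qq t)"
    using assms by (auto simp: qexp_def)
  have rad: "fps_conv_radius P > 0" and ev: "\<forall>\<^sub>F z in at 0. eval_fls (fps_to_fls P) z = \<phi> z"
    using *(1) by (auto simp: has_laurent_expansion_def)
  have "\<forall>\<^sub>F z in at 0. z \<in> eball 0 (fps_conv_radius P) - {0}"
    using rad by (intro eventually_at_in_open) (auto simp: zero_ereal_def)
  with ev have "\<forall>\<^sub>F z in at 0. (\<lambda>n. fps_nth P n * z ^ n) sums \<phi> z"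
  proof eventually_elim
    case (elim z)
    thus ?case using sums_eval_fps[of z P] by (simp add: eval_fps_to_fls)
  qed
  hence "\<forall>\<^sub>F t in ioo. (\<lambda>n. fps_nth P n * qq t ^ n) sums \<phi> (qq t)"
    by (rule eventually_compose_filterlim[OF _ filterlim_qq])
  with *(2) show ?thesis by eventually_elim simp
qed

text \<open>Together with the converse above it, this lets coefficients be selected or spread out in
  convergent series, as U(p) and V(p) require.\<close>

lemma qexp_of_fps_sums:
  assumes "\<forall>\<^sub>F t in ioo. (\<lambda>n. fps_nth P n * qq t ^ n) sums f t"
  shows "qexp f (fps_to_fls P)"
proof -
  define \<phi> where "\<phi> = (\<lambda>q. \<Sum>n. fps_nth P n * q ^ n)"
  have "\<forall>\<^sub>F q in at 0. (\<lambda>n. fps_nth P n * qq (qinv q) ^ n) sums f (qinv q)"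
    by (rule eventually_compose_filterlim[OF assms filterlim_qinv])
  moreover have "\<forall>\<^sub>F q::complex in at 0. q \<noteq> 0" by (auto simp: eventually_at_filter)
  ultimately have "\<forall>\<^sub>F q in at 0. (\<lambda>n. fps_nth P n * q ^ n) sums \<phi> q"
    by eventually_elim (auto simp: \<phi>_def qq_qinv sums_iff)
  moreover have "(\<lambda>n. fps_nth P n * 0 ^ n) sums \<phi> 0"
    unfolding \<phi>_def by (rule summable_sums) (simp add: powser_sums_zero sums_summable[OF powser_sums_zero])
  ultimately have "\<forall>\<^sub>F q in nhds 0. (\<lambda>n. fps_nth P n * q ^ n) sums \<phi> q"
    by (auto simp: eventually_at_filter elim: eventually_mono)
  hence "\<phi> has_fps_expansion P" by (rule has_fps_expansionI)
  hence "\<phi> has_laurent_expansion fps_to_fls P" by (rule has_laurent_expansion_fps)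
  moreover have "\<forall>\<^sub>F t in ioo. f t = \<phi> (qq t)"
    using assms by eventually_elim (simp add: \<phi>_def sums_iff)
  ultimately show ?thesis unfolding qexp_def by blast
qed

lemma qexp_qq_power_iff: "qexp (\<lambda>t. qq t ^ N * f t) (fls_X ^ N * F) \<longleftrightarrow> qexp f F"
proof
  assume "qexp (\<lambda>t. qq t ^ N * f t) (fls_X ^ N * F)"
  hence "qexp (\<lambda>t. (qq t ^ N * f t) / qq t ^ N) ((fls_X ^ N * F) / fls_X ^ N)"
    by (intro qexp_divide qexp_power qexp_qq)
  moreover have "(fls_X ^ N * F) / fls_X ^ N = F"
    by (rule nonzero_mult_div_cancel_left) simp
  ultimately show "qexp f F" by simp
qed (intro qexp_mult qexp_power qexp_qq)

lemma fls_X_power_times_nth: "fls_nth (fls_X ^ N * F) n = fls_nth F (n - int N)"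
  by (simp add: fls_X_power_times_conv_shift)

lemma fls_X_power_times_fps:
  assumes "\<And>n. n < - int N \<Longrightarrow> fls_nth F n = 0"
  shows "fls_X ^ N * F = fps_to_fls (Abs_fps (\<lambda>n. fls_nth F (int n - int N)))"
  by (rule fls_eqI) (use assms in \<open>auto simp: fls_X_power_times_nth\<close>)

lemma fls_eventually_zero:
  obtains N where "\<And>n. n < - int N \<Longrightarrow> fls_nth F n = 0"
proof
  show "fls_nth F n = 0" if "n < - int (nat (- fls_subdegree F))" for n
    using that by (intro fls_eq0_below_subdegree) linarith
qed

lemma filterlim_ioo_affine:
  assumes "m > 0" "m' > 0"
  shows "filterlim (\<lambda>t. (of_nat m * t + of_int n) / of_nat m') ioo ioo"
  unfolding filterlim_filtercomap_iff
proof -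
  have "filterlim (\<lambda>y. real m / real m' * y) at_top at_top"
    using assms by (intro filterlim_tendsto_pos_mult_at_top[OF tendsto_const] filterlim_ident) auto
  hence "filterlim (\<lambda>t. real m / real m' * Im t) at_top ioo"
    by (rule filterlim_compose) (rule filterlim_filtercomap)
  thus "filterlim (Im \<circ> (\<lambda>t. (of_nat m * t + of_int n) / of_nat m')) at_top ioo"
    using Im_divide_of_nat by (simp add: o_def)
qed

definition uf :: "nat \<Rightarrow> complex fls \<Rightarrow> complex fls" where
  "uf p F = Abs_fls (\<lambda>n. fls_nth F (int p * n))"

lemma uf_nth:
  assumes "p > 0"
  shows "fls_nth (uf p F) n = fls_nth F (int p * n)"
proof -
  obtain N where N: "\<And>n. n < - int N \<Longrightarrow> fls_nth F n = 0" using fls_eventually_zero[of F] by blast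
  have "\<forall>n < - int N. fls_nth F (int p * n) = 0"
  proof (intro allI impI N)
    fix n assume "n < - int N"
    moreover have "int p * n \<le> 1 * n" using assms calculation by (intro mult_right_mono_neg) auto
    ultimately show "int p * n < - int N" by linarith
  qed
  thus ?thesis unfolding uf_def by (rule nth_Abs_fls_lower_bound)
qed

definition rootp :: "nat \<Rightarrow> complex" where "rootp p = ee (1 / of_nat p)"

lemma rootp_power_p: "p > 0 \<Longrightarrow> rootp p ^ p = 1"
  by (simp add: rootp_def ee_power)

lemma rootp_sum:
  assumes "p > 0"
  shows "(\<Sum>j<p. (rootp p ^ n) ^ j) = (if p dvd n then of_nat p else 0)"
proof (cases "p dvd n")
  case True
  then obtain k where "n = p * k" by blast
  hence "rootp p ^ n = 1" using rootp_power_p[OF assms] by (simp add: power_mult)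
  thus ?thesis using True by simp
next
  case False
  have "rootp p ^ n \<noteq> 1"
  proof
    assume "rootp p ^ n = 1"
    hence "ee (of_nat n / of_nat p) = 1" by (simp add: rootp_def ee_power)
    then obtain k where k: "of_nat n / of_nat p = (of_int k :: complex)" unfolding ee_eq_1_iff by blast
    hence "of_int (int n) = (of_int (k * int p) :: complex)" using assms by (simp add: field_simps)
    hence "int n = k * int p" by (simp only: of_int_eq_iff)
    hence "int p dvd int n" by simp
    thus False using False by (simp only: int_dvd_int_iff)
  qed
  moreover have "(rootp p ^ n) ^ p = 1"
    using rootp_power_p[OF assms] by (metis mult.commute power_mult power_one)
  ultimately show ?thesis using False by (simp add: geometric_sum)
qed

text \<open>Averaging over the translates by 3 j picks the exponents divisible by \<open>p\<close>,
  by the orthogonality of the p-th roots of unity; the step is 3 since \<open>qq\<close> has period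
  3.\<close>

lemma qexp_U:
  assumes p: "p > 0" and F: "qexp f F"
  shows "qexp (\<lambda>t. (\<Sum>j<p. f ((t + 3 * of_nat j) / of_nat p)) / of_nat p) (uf p F)"
proof -
  define s where "s = (\<lambda>(j::nat) t. (t + 3 * of_nat j) / of_nat p :: complex)"
  obtain N' where N': "\<And>n. n < - int N' \<Longrightarrow> fls_nth F n = 0" using fls_eventually_zero[of F] by blast
  \<comment> \<open>A multiple of \<open>p\<close>: clearing the pole by this power preserves
    divisibility of exponents by \<open>p\<close>, and \<open>qq (s j t) ^ N\<close> does not depend
    on \<open>j\<close>.\<close>
  define N where "N = p * N'"
  have "N' \<le> N" using p by (simp add: N_def)
  hence N: "fls_nth F n = 0" if "n < - int N" for n using that by (intro N') linarith
  define P where "P = Abs_fps (\<lambda>n. fls_nth F (int n - int N))"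
  have "qexp (\<lambda>t. qq t ^ N * f t) (fls_X ^ N * F)" using F by (simp only: qexp_qq_power_iff)
  hence "\<forall>\<^sub>F t in ioo. (\<lambda>n. fps_nth P n * qq t ^ n) sums (qq t ^ N * f t)"
    using fls_X_power_times_fps[of N F, OF N] unfolding P_def by (intro qexp_fps_sums) simp
  moreover have "filterlim (s j) ioo ioo" for j
    using filterlim_ioo_affine[of 1 p "3 * int j"] p by (simp add: s_def)
  ultimately have "\<forall>\<^sub>F t in ioo. (\<lambda>n. fps_nth P n * qq (s j t) ^ n) sums (qq (s j t) ^ N * f (s j t))" for j
    by (rule eventually_compose_filterlim)
  hence "\<forall>\<^sub>F t in ioo. \<forall>j\<in>{..<p}. (\<lambda>n. fps_nth P n * qq (s j t) ^ n) sums (qq (s j t) ^ N * f (s j t))"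
    by (intro eventually_ball_finite) auto
  hence "\<forall>\<^sub>F t in ioo. (\<lambda>m. fps_nth P (p * m) * qq t ^ m) sums (qq t ^ N' * ((\<Sum>j<p. f (s j t)) / of_nat p))"
  proof eventually_elim
    case (elim t)
    define r where "r = qq (t / of_nat p)"
    have rp: "r ^ p = qq t" using p by (simp add: r_def qq_def ee_power)
    have qs: "qq (s j t) = r * rootp p ^ j" for j
    proof -
      have "s j t / 3 = t / of_nat p / 3 + of_nat j * (1 / of_nat p)"
        using p by (simp add: s_def field_simps)
      thus ?thesis unfolding qq_def r_def rootp_def ee_power by (simp only: ee_add)
    qed
    have qsN: "qq (s j t) ^ N = qq t ^ N'" for j
      unfolding N_def power_mult qs power_mult_distrib rp
      using rootp_power_p[OF p] by (simp add: power_mult[symmetric] mult.commute[of j]) (simp add: power_mult)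
    have "(\<lambda>n. \<Sum>j<p. fps_nth P n * qq (s j t) ^ n) sums (\<Sum>j<p. qq (s j t) ^ N * f (s j t))"
      using elim by (intro sums_sum) auto
    hence "(\<lambda>n. (\<Sum>j<p. fps_nth P n * qq (s j t) ^ n) / of_nat p) sums ((\<Sum>j<p. qq (s j t) ^ N * f (s j t)) / of_nat p)"
      by (rule sums_divide)
    moreover have "(\<Sum>j<p. fps_nth P n * qq (s j t) ^ n) / of_nat p = (if p dvd n then fps_nth P n * r ^ n else 0)" for n
    proof -
      have "(\<Sum>j<p. fps_nth P n * qq (s j t) ^ n) = fps_nth P n * r ^ n * (\<Sum>j<p. (rootp p ^ n) ^ j)"
      proof -
        have "(rootp p ^ j) ^ n = (rootp p ^ n) ^ j" for j by (simp only: power_mult[symmetric] mult.commute)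
        thus ?thesis by (simp add: qs power_mult_distrib sum_distrib_left mult_ac)
      qed
      thus ?thesis using p by (simp add: rootp_sum)
    qed
    ultimately have "(\<lambda>n. if p dvd n then fps_nth P n * r ^ n else 0) sums ((\<Sum>j<p. qq (s j t) ^ N * f (s j t)) / of_nat p)"
      by simp
    hence "(\<lambda>m. if p dvd p * m then fps_nth P (p * m) * r ^ (p * m) else 0) sums ((\<Sum>j<p. qq (s j t) ^ N * f (s j t)) / of_nat p)"
      by (subst sums_mono_reindex[of "\<lambda>m. p * m" "\<lambda>n. if p dvd n then fps_nth P n * r ^ n else 0"])
         (use p in \<open>auto simp: strict_mono_def dvd_def\<close>)
    thus ?case by (simp add: qsN power_mult rp sum_distrib_left)
  qed
  hence "\<forall>\<^sub>F t in ioo. (\<lambda>m. fps_nth (Abs_fps (\<lambda>m. fps_nth P (p * m))) m * qq t ^ m) sums (qq t ^ N' * ((\<Sum>j<p. f (s j t)) / of_nat p))"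
    by simp
  hence "qexp (\<lambda>t. qq t ^ N' * ((\<Sum>j<p. f (s j t)) / of_nat p)) (fps_to_fls (Abs_fps (\<lambda>m. fps_nth P (p * m))))"
    by (rule qexp_of_fps_sums)
  also have "fps_to_fls (Abs_fps (\<lambda>m. fps_nth P (p * m))) = fls_X ^ N' * uf p F"
  proof (rule fls_eqI)
    fix n
    show "fls_nth (fps_to_fls (Abs_fps (\<lambda>m. fps_nth P (p * m)))) n = fls_nth (fls_X ^ N' * uf p F) n"
    proof (cases "n < 0")
      case True
      have "int p * (n - int N') \<le> 1 * (n - int N')" using p True by (intro mult_right_mono_neg) auto
      also have "1 * (n - int N') < - int N'" using True by simp
      finally have "int p * (n - int N') < - int N'" .
      thus ?thesis using True by (simp add: fls_X_power_times_nth uf_nth[OF p] N')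
    next
      case False
      have "int p * (n - int N') = int p * n - int N" by (simp add: N_def algebra_simps)
      moreover have "int (p * nat n) = int p * n" using False by simp
      ultimately show ?thesis using False p by (simp add: fls_X_power_times_nth uf_nth P_def del: of_nat_mult)
    qed
  qed
  finally show ?thesis unfolding qexp_qq_power_iff s_def .
qed

lemma qexp_V:
  assumes p: "p > 0" and F: "qexp f F"
  shows "qexp (\<lambda>t. f (of_nat p * t)) (fls_compose_power F p)"
proof -
  obtain N where N: "\<And>n. n < - int N \<Longrightarrow> fls_nth F n = 0" using fls_eventually_zero[of F] by blast
  define P where "P = Abs_fps (\<lambda>n. fls_nth F (int n - int N))"
  have "qexp (\<lambda>t. qq t ^ N * f t) (fls_X ^ N * F)" using F by (simp only: qexp_qq_power_iff)
  hence "\<forall>\<^sub>F t in ioo. (\<lambda>n. fps_nth P n * qq t ^ n) sums (qq t ^ N * f t)"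
    using fls_X_power_times_fps[of N F, OF N] unfolding P_def by (intro qexp_fps_sums) simp
  moreover have "filterlim (\<lambda>t. of_nat p * t) ioo ioo"
    using filterlim_ioo_affine[of p 1 0] p by simp
  ultimately have ev: "\<forall>\<^sub>F t in ioo. (\<lambda>n. fps_nth P n * qq (of_nat p * t) ^ n) sums (qq (of_nat p * t) ^ N * f (of_nat p * t))"
    by (rule eventually_compose_filterlim)
  define Q where "Q = Abs_fps (\<lambda>n. if p dvd n then fps_nth P (n div p) else 0)"
  have "\<forall>\<^sub>F t in ioo. (\<lambda>n. fps_nth Q n * qq t ^ n) sums (qq t ^ (p * N) * f (of_nat p * t))"
    using ev
  proof eventually_elim
    case (elim t)
    have q: "qq (of_nat p * t) = qq t ^ p" by (simp add: qq_def ee_power)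
    have "(\<lambda>n. fps_nth Q (p * n) * qq t ^ (p * n)) sums (qq t ^ (p * N) * f (of_nat p * t))"
      using elim p by (simp add: q Q_def power_mult)
    thus ?case
      by (subst (asm) sums_mono_reindex[of "\<lambda>m. p * m" "\<lambda>n. fps_nth Q n * qq t ^ n"])
         (use p in \<open>auto simp: strict_mono_def dvd_def Q_def\<close>)
  qed
  hence "qexp (\<lambda>t. qq t ^ (p * N) * f (of_nat p * t)) (fps_to_fls Q)" by (rule qexp_of_fps_sums)
  also have "fps_to_fls Q = fls_X ^ (p * N) * fls_compose_power F p"
  proof (rule fls_eqI)
    fix n
    show "fls_nth (fps_to_fls Q) n = fls_nth (fls_X ^ (p * N) * fls_compose_power F p) n"
    proof (cases "int p dvd n")
      case True
      then obtain m where n: "n = int p * m" by blast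
      have "n - int (p * N) = int p * (m - int N)" by (simp add: n algebra_simps)
      moreover have "m \<ge> 0 \<Longrightarrow> nat (int p * m) = p * nat m" using p by (simp add: nat_mult_distrib)
      ultimately show ?thesis using p N
        by (auto simp: fls_X_power_times_nth fls_nth_compose_power n Q_def P_def mult_less_0_iff zero_le_mult_iff)
    next
      case False
      hence "\<not> int p dvd n - int (p * N)" by (simp add: dvd_diff_left_iff)
      moreover have "n \<ge> 0 \<Longrightarrow> \<not> p dvd nat n" using False by (metis int_dvd_int_iff int_nat_eq)
      ultimately show ?thesis using p by (auto simp: fls_X_power_times_nth fls_nth_compose_power Q_def)
    qed
  qed
  finally show ?thesis unfolding qexp_qq_power_iff .
qed


text \<open>
  Forms of weight 4 for \<open>\<Gamma>(3)\<close> that vanish at the three cusps other than \<open>\<infinity>\<close>; at \<open>\<infinity>\<close> nothing is required.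
\<close>

definition hh :: "(complex \<Rightarrow> complex) \<Rightarrow> bool" where
  "hh f \<longleftrightarrow> f holomorphic_on uhp \<and>
     (\<forall>a b c d t. gam3 a b c d \<longrightarrow> Im t > 0 \<longrightarrow> f (mob a b c d t) = (of_int c * t + of_int d) ^ 4 * f t) \<and>
     (\<forall>i\<in>{-1, 0, 1 :: int}. ((\<lambda>t. f (- 1 / t + of_int i) / t ^ 4) \<longlongrightarrow> 0) ioo)"

lemma hh_gam3: "hh f \<Longrightarrow> gam3 a b c d \<Longrightarrow> Im t > 0 \<Longrightarrow> f (mob a b c d t) = (of_int c * t + of_int d) ^ 4 * f t"
  unfolding hh_def by blast

lemma hh_scale_gam3:
  assumes "hh f" "e = 1 \<or> e = - 1" "gam3 (e * a) (e * b) (e * c) (e * d)" "Im t > 0"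
  shows "f (mob a b c d t) = (of_int c * t + of_int d) ^ 4 * f t"
proof -
  have "of_int (e * c) * t + of_int (e * d) = of_int e * (of_int c * t + of_int d)" by (simp add: algebra_simps)
  moreover have "(of_int e :: complex) ^ 4 = 1" using assms(2) by auto
  ultimately show ?thesis
    using hh_gam3[OF assms(1,3,4)] unfolding mob_scale[OF assms(2)] by (simp add: power_mult_distrib)
qed

text \<open>By \<open>gam3_coset_0\<close> a matrix with \<open>c\<close> prime to 3 leads to one of
  the three cusps in the definition of \<open>hh\<close>, after an integral translation, which the
  limit does not notice.\<close>

lemma hh_cusp:
  assumes f: "hh f" and det: "a * d - b * c = 1" and c: "\<not> 3 dvd c"
  shows "((\<lambda>t. f (mob a b c d t) / (of_int c * t + of_int d) ^ 4) \<longlongrightarrow> 0) ioo"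
proof -
  from gam3_coset_0[OF det c] obtain e i where e: "e = 1 \<or> e = - 1" "i \<in> {-1, 0, 1 :: int}"
    "gam3 (e * (a * (e * d) - b)) (e * (a * (1 - i * (e * d)) + b * i))
          (e * (c * (e * d) - d)) (e * (c * (1 - i * (e * d)) + d * i))" .
  define j where "j = e * d"
  have "((\<lambda>t. f (- 1 / t + of_int i) / t ^ 4) \<longlongrightarrow> 0) ioo" using f e(2) by (auto simp: hh_def)
  moreover have "filterlim (\<lambda>t. t + of_int j) ioo ioo" using filterlim_ioo_affine[of 1 1 j] by simp
  ultimately have "((\<lambda>t. f (- 1 / (t + of_int j) + of_int i) / (t + of_int j) ^ 4) \<longlongrightarrow> 0) ioo"
    by (rule filterlim_compose)
  moreover have "\<forall>\<^sub>F t in ioo. f (- 1 / (t + of_int j) + of_int i) / (t + of_int j) ^ 4 =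
      f (mob a b c d t) / (of_int c * t + of_int d) ^ 4"
    using eventually_ioo_gt[of 0]
  proof eventually_elim
    case (elim t)
    define s' where "s' = t + of_int j"
    have s': "Im s' > 0" using elim by (simp add: s'_def)
    have nz: "s' \<noteq> 0" "of_int c * t + of_int d \<noteq> 0" using s' Im_mob_pos(2)[OF det elim] by auto
    define u where "u = - 1 / s' + of_int i"
    have u: "Im u > 0" using Im_minus_inverse[OF s'] by (simp add: u_def)
    have *: "of_int (x * j - y) * u + of_int (x * (1 - i * j) + y * i) = (of_int x * t + of_int y) / s'" for x y :: int
      using nz by (simp add: u_def s'_def field_simps)
    have "mob (a * j - b) (a * (1 - i * j) + b * i) (c * j - d) (c * (1 - i * j) + d * i) u = mob a b c d t"
      unfolding mob_def * using nz by simp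
    hence "f (mob a b c d t) = ((of_int c * t + of_int d) / s') ^ 4 * f u"
      using hh_scale_gam3[OF f e(1) e(3) u] unfolding j_def[symmetric] * by simp
    thus ?case using nz by (simp add: power_divide u_def s'_def)
  qed
  ultimately show ?thesis by (rule Lim_transform_eventually)
qed

text \<open>The triples are the matrices (m, n; 0, m') of determinant p. The offsets are 3 j, which
  still represent all residues modulo p, so that every representative is diagonal modulo 3.\<close>

definition heckeR :: "nat \<Rightarrow> (int \<times> int \<times> int) set" where
  "heckeR p = insert (int p, 0, 1) ((\<lambda>j. (1, 3 * int j, int p)) ` {..<p})"

text \<open>The weight 4 action with the normalization p^3 m'^(-4), for which the expansion is U(p)
  + p^3 V(p).\<close>

definition hterm :: "nat \<Rightarrow> (complex \<Rightarrow> complex) \<Rightarrow> int \<times> int \<times> int \<Rightarrow> complex \<Rightarrow> complex" where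
  "hterm p f = (\<lambda>(m, n, m') t. of_nat p ^ 3 / of_int m' ^ 4 * f ((of_int m * t + of_int n) / of_int m'))"

definition hecke :: "nat \<Rightarrow> (complex \<Rightarrow> complex) \<Rightarrow> complex \<Rightarrow> complex" where
  "hecke p f t = (\<Sum>M\<in>heckeR p. hterm p f M t)"

section \<open>Coset representatives of determinant p\<close>

locale hecke_prime =
  fixes p :: nat
  assumes prime: "prime p" and mod3: "p mod 3 = 2"
begin

lemma p_gt_1: "p > 1" using prime by (rule prime_gt_1_nat)

lemma p_not_3_dvd: "\<not> 3 dvd int p" using mod3 by presburger

lemma prime_int: "prime (int p)" using prime by simp

lemma coprime_3_p: "coprime 3 (int p)"
proof -
  have "prime (3 :: int)" by simp
  thus ?thesis using p_not_3_dvd prime_imp_coprime by blast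
qed

lemma finite_R: "finite (heckeR p)" by (simp add: heckeR_def)

lemma hecke_altdef: "hecke p f t = of_nat p ^ 3 * f (of_nat p * t) + (\<Sum>j<p. f ((t + 3 * of_nat j) / of_nat p)) / of_nat p"
proof -
  have inj: "inj_on (\<lambda>j. (1 :: int, 3 * int j, int p)) {..<p}" by (auto simp: inj_on_def)
  have "(int p, 0, 1) \<notin> (\<lambda>j. (1 :: int, 3 * int j, int p)) ` {..<p}" using p_gt_1 by auto
  hence "hecke p f t = hterm p f (int p, 0, 1) t + (\<Sum>j<p. hterm p f (1, 3 * int j, int p) t)"
    unfolding hecke_def heckeR_def by (simp add: sum.reindex[OF inj])
  moreover have "of_nat p ^ 3 * x / of_nat p ^ 4 = (x / of_nat p :: complex)" for x
    using p_gt_1 by (simp add: eval_nat_numeral)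
  ultimately show ?thesis by (simp add: hterm_def sum_distrib_left sum_divide_distrib)
qed

lemma linear_residue:
  assumes "\<not> int p dvd y"
  obtains j where "j < p" "int p dvd (z - y * (3 * int j))"
proof -
  have "coprime (3 * y) (int p)"
    using assms coprime_3_p prime_int by (metis coprime_commute coprime_mult_left_iff prime_imp_coprime)
  then obtain x where x: "[3 * y * x = 1] (mod int p)" using cong_solve_coprime_int by blast
  define j where "j = nat ((x * z) mod int p)"
  have j: "int j = (x * z) mod int p" "j < p"
    using p_gt_1 by (auto simp: j_def nat_less_iff)
  have "[y * (3 * int j) = y * (3 * (x * z))] (mod int p)"
    unfolding j by (intro cong_mult cong_refl) (simp add: cong_def)
  also have "y * (3 * (x * z)) = (3 * y * x) * z" by simp
  also have "[(3 * y * x) * z = 1 * z] (mod int p)" by (intro cong_mult x cong_refl)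
  finally have "[z = y * (3 * int j)] (mod int p)" by (simp add: cong_sym)
  thus ?thesis using that j(2) cong_iff_dvd_diff by blast
qed

text \<open>The four equations are the entries of (m, n; 0, m') gamma = gamma' (r, s; 0, r'). The
  representative on the right is (p, 0, 1) when \<open>p\<close> divides the first column of the
  left side; otherwise a linear congruence modulo \<open>p\<close> determines its offset.\<close>

lemma coset_exists:
  assumes M: "(m, n, m') \<in> heckeR p" and det: "a * d - b * c = 1"
  obtains r s r' a' b' c' d' where "(r, s, r') \<in> heckeR p" "a' * d' - b' * c' = 1"
    "a' * r = m * a + n * c" "a' * s + b' * r' = m * b + n * d"
    "c' * r = m' * c" "c' * s + d' * r' = m' * d"
proof -
  have p0: "int p \<noteq> 0" using p_gt_1 by simp
  have R1: "(1, 3 * int j, int p) \<in> heckeR p" if "j < p" for j using that by (auto simp: heckeR_def)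
  have R2: "(int p, 0, 1) \<in> heckeR p" by (simp add: heckeR_def)
  from M consider "m = int p" "n = 0" "m' = 1" | j where "m = 1" "n = 3 * int j" "m' = int p"
    by (auto simp: heckeR_def)
  thus ?thesis
  proof cases
    case 1
    show ?thesis
    proof (cases "int p dvd c")
      case True
      then obtain k where k: "c = int p * k" by blast
      show ?thesis by (rule that[OF R2, of a d "int p * b" k]) (use det in \<open>simp_all add: 1 k algebra_simps\<close>)
    next
      case False
      then obtain j where j: "j < p" "int p dvd (d - c * (3 * int j))" by (rule linear_residue)
      then obtain k where k: "d = int p * k + c * (3 * int j)" by (metis dvd_def diff_add_cancel)
      show ?thesis by (rule that[OF R1[OF j(1)], of "int p * a" k "b - 3 * int j * a" c])
         (use det in \<open>simp_all add: 1 k algebra_simps\<close>)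
    qed
  next
    case 2
    define x where "x = a + n * c"
    show ?thesis
    proof (cases "int p dvd x")
      case True
      then obtain k where k: "x = int p * k" by blast
      hence a: "a = int p * k - n * c" by (simp add: x_def algebra_simps)
      show ?thesis by (rule that[OF R2, of k "int p * d" "b + n * d" c]) (use det in \<open>simp_all add: 2(1,3) a algebra_simps\<close>)
    next
      case False
      then obtain j' where j': "j' < p" "int p dvd (b + n * d - x * (3 * int j'))" by (rule linear_residue)
      then obtain k where k: "b + n * d = int p * k + x * (3 * int j')" by (metis dvd_def diff_add_cancel)
      have "x * (d - 3 * int j' * c) - k * (int p * c) = x * d - c * (b + n * d)"
        unfolding k by (simp add: algebra_simps)
      also have "\<dots> = 1" using det by (simp add: x_def algebra_simps)
      finally show ?thesis
        by (intro that[OF R1[OF j'(1)], of x "d - 3 * int j' * c" k "int p * c"])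
           (use k in \<open>simp_all add: 2(1,3) x_def algebra_simps\<close>)
    qed
  qed
qed

text \<open>If two left sides end in the same representative, every minor made of one row of each is
  divisible by its determinant \<open>p\<close>. This separates the representatives.\<close>

lemma coset_unique:
  assumes M1: "(m1, n1, m1') \<in> heckeR p" and M2: "(m2, n2, m2') \<in> heckeR p" and R: "(r, s, r') \<in> heckeR p"
    and det: "a * d - b * c = 1"
    and eq1: "a1 * r = m1 * a + n1 * c" "a1 * s + b1 * r' = m1 * b + n1 * d" "c1 * r = m1' * c" "c1 * s + d1 * r' = m1' * d"
    and eq2: "a2 * r = m2 * a + n2 * c" "a2 * s + b2 * r' = m2 * b + n2 * d" "c2 * r = m2' * c" "c2 * s + d2 * r' = m2' * d"
  shows "(m1, n1, m1') = (m2, n2, m2')"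
proof -
  have rr: "r * r' = int p" using R by (auto simp: heckeR_def)
  have "m1 * m2' = (m1 * a + n1 * c) * (m2' * d) - (m1 * b + n1 * d) * (m2' * c)"
    using det by (simp add: algebra_simps) (metis add_diff_cancel_left' diff_add_eq distrib_left mult.commute mult.left_commute mult_1 right_diff_distrib)
  also have "\<dots> = (r * r') * (a1 * d2 - b1 * c2)"
    unfolding eq1[symmetric] eq2[symmetric] by (simp add: algebra_simps)
  finally have 1: "int p dvd m1 * m2'" by (simp add: rr)
  have "m2 * m1' = (m2 * a + n2 * c) * (m1' * d) - (m2 * b + n2 * d) * (m1' * c)"
    using det by (simp add: algebra_simps) (metis add_diff_cancel_left' diff_add_eq distrib_left mult.commute mult.left_commute mult_1 right_diff_distrib)
  also have "\<dots> = (r * r') * (a2 * d1 - b2 * c1)"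
    unfolding eq1[symmetric] eq2[symmetric] by (simp add: algebra_simps)
  finally have 2: "int p dvd m2 * m1'" by (simp add: rr)
  have "n1 * m2 - m1 * n2 = (n1 * m2 - m1 * n2) * (a * d - b * c)" by (simp add: det)
  also have "\<dots> = (m1 * b + n1 * d) * (m2 * a + n2 * c) - (m1 * a + n1 * c) * (m2 * b + n2 * d)"
    by (simp add: algebra_simps)
  also have "\<dots> = (r * r') * (b1 * a2 - a1 * b2)"
    unfolding eq1[symmetric] eq2[symmetric] by (simp add: algebra_simps)
  finally have 3: "int p dvd n1 * m2 - m1 * n2" by (simp add: rr)
  have not1: "\<not> int p dvd 1" using p_gt_1 by simp
  from M1 M2 1 2 not1 consider "m1 = int p" "n1 = 0" "m1' = 1" "m2 = int p" "n2 = 0" "m2' = 1"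
    | i j where "i < p" "j < p" "m1 = 1" "n1 = 3 * int i" "m1' = int p" "m2 = 1" "n2 = 3 * int j" "m2' = int p"
    unfolding heckeR_def by auto
  thus ?thesis
  proof cases
    case 2
    have "int p dvd 3 * (int i - int j)" using 3 by (simp add: 2 algebra_simps)
    hence "int p dvd int i - int j" using coprime_3_p by (metis coprime_commute coprime_dvd_mult_right_iff)
    hence "int i - int j = 0" using 2(1,2) dvd_imp_le_int[of "int i - int j" "int p"] by linarith
    thus ?thesis by (simp add: 2)
  qed simp
qed


lemma R_pos: "(m, n, m') \<in> heckeR p \<Longrightarrow> m > 0 \<and> m' > 0 \<and> 3 dvd n \<and> \<not> 3 dvd m \<and> \<not> 3 dvd m'"
  using p_gt_1 p_not_3_dvd by (auto simp: heckeR_def)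

lemma Im_R_pos: "(m, n, m') \<in> heckeR p \<Longrightarrow> Im t > 0 \<Longrightarrow> Im ((of_int m * t + of_int n) / of_int m') > 0"
  using R_pos[of m n m'] Im_divide_of_real[of "of_int m * t + of_int n" "of_int m'"] by simp

lemma coset_action:
  assumes M: "(m, n, m') \<in> heckeR p" "(r, s, r') \<in> heckeR p"
    and det: "a * d - b * c = 1" and det': "a' * d' - b' * c' = 1" and t: "Im t > 0"
    and eq: "a' * r = m * a + n * c" "a' * s + b' * r' = m * b + n * d" "c' * r = m' * c" "c' * s + d' * r' = m' * d"
  defines "u \<equiv> (of_int r * t + of_int s) / of_int r'"
  shows "(of_int m * mob a b c d t + of_int n) / of_int m' = mob a' b' c' d' u"
    and "of_int m' * (of_int c * t + of_int d) = of_int r' * (of_int c' * u + of_int d')"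
proof -
  have nz: "of_int c * t + of_int d \<noteq> 0" "of_int m' \<noteq> (0 :: complex)" "of_int r' \<noteq> (0 :: complex)"
    using Im_mob_pos(2)[OF det t] R_pos[OF M(1)] R_pos[OF M(2)] by auto
  have e: "of_int a' * of_int r = of_int m * of_int a + of_int n * (of_int c :: complex)"
     "of_int a' * of_int s + of_int b' * of_int r' = of_int m * of_int b + of_int n * (of_int d :: complex)"
     "of_int c' * of_int r = of_int m' * (of_int c :: complex)"
     "of_int c' * of_int s + of_int d' * of_int r' = of_int m' * (of_int d :: complex)"
    using eq by (metis of_int_add of_int_mult)+
  have num: "of_int r' * (of_int a' * u + of_int b') = of_int m * (of_int a * t + of_int b) + of_int n * (of_int c * t + of_int d)"
  proof -
    have "of_int r' * (of_int a' * u + of_int b') = (of_int a' * of_int r) * t + (of_int a' * of_int s + of_int b' * of_int r')"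
      using nz by (simp add: u_def field_simps)
    thus ?thesis unfolding e by (simp add: algebra_simps)
  qed
  show den: "of_int m' * (of_int c * t + of_int d) = of_int r' * (of_int c' * u + of_int d')"
  proof -
    have "of_int r' * (of_int c' * u + of_int d') = (of_int c' * of_int r) * t + (of_int c' * of_int s + of_int d' * of_int r')"
      using nz by (simp add: u_def field_simps)
    thus ?thesis unfolding e by (simp add: algebra_simps)
  qed
  have "mob a' b' c' d' u = (of_int r' * (of_int a' * u + of_int b')) / (of_int r' * (of_int c' * u + of_int d'))"
    using nz by (simp add: mob_def)
  also have "\<dots> = (of_int m * mob a b c d t + of_int n) / of_int m'"
    unfolding num den[symmetric] using nz by (simp add: mob_def field_simps)
  finally show "(of_int m * mob a b c d t + of_int n) / of_int m' = mob a' b' c' d' u" ..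
qed

text \<open>Modulo 3 all representatives are diagonal, so gamma' is diagonal of determinant 1, that
  is, plus or minus the identity. The sign is harmless in even weight.\<close>

lemma coset_gam3:
  assumes M: "(m, n, m') \<in> heckeR p" "(r, s, r') \<in> heckeR p"
    and g: "gam3 a b c d" and det': "a' * d' - b' * c' = 1"
    and eq: "a' * r = m * a + n * c" "a' * s + b' * r' = m * b + n * d" "c' * r = m' * c" "c' * s + d' * r' = m' * d"
  obtains e where "e = 1 \<or> e = - 1" "gam3 (e * a') (e * b') (e * c') (e * d')"
proof -
  have p3: "prime (3 :: int)" by simp
  have "3 dvd c' * r" using g by (simp add: eq gam3_def)
  hence c3: "3 dvd c'" using R_pos[OF M(2)] p3 prime_dvd_mult_iff by blast
  have "3 dvd m * b + n * d" using g R_pos[OF M(1)] by (simp add: gam3_def)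
  hence "3 dvd a' * s + b' * r'" by (simp add: eq)
  hence "3 dvd b' * r'" using R_pos[OF M(2)] by (metis dvd_add_right_iff dvd_mult)
  hence b3: "3 dvd b'" using R_pos[OF M(2)] p3 prime_dvd_mult_iff by blast
  from c3 b3 obtain b0 c0 where bc: "b' = 3 * b0" "c' = 3 * c0" by (elim dvdE)
  have "(a' * d') mod 3 = (1 + 3 * (b0 * c')) mod 3" using det' by (simp add: bc(1) algebra_simps)
  hence ad: "((a' mod 3) * (d' mod 3)) mod 3 = 1" by (simp add: mod_mult_eq)
  have "a' mod 3 = 0 \<or> a' mod 3 = 1 \<or> a' mod 3 = 2" "d' mod 3 = 0 \<or> d' mod 3 = 1 \<or> d' mod 3 = 2" by linarith+
  with ad consider "a' mod 3 = 1" "d' mod 3 = 1" | "a' mod 3 = 2" "d' mod 3 = 2" by auto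
  thus ?thesis
  proof cases
    case 1 thus ?thesis using b3 c3 det' by (intro that[of 1]) (simp_all add: gam3_def)
  next
    case 2
    hence "(- a') mod 3 = 1" "(- d') mod 3 = 1" by presburger+
    thus ?thesis using b3 c3 det' by (intro that[of "-1"]) (simp_all add: gam3_def)
  qed
qed

lemma hterm_transform:
  assumes M: "(m, n, m') \<in> heckeR p" "(r, s, r') \<in> heckeR p"
    and det: "a * d - b * c = 1" and det': "a' * d' - b' * c' = 1" and t: "Im t > 0"
    and eq: "a' * r = m * a + n * c" "a' * s + b' * r' = m * b + n * d" "c' * r = m' * c" "c' * s + d' * r' = m' * d"
  defines "u \<equiv> (of_int r * t + of_int s) / of_int r'"
  shows "hterm p f (m, n, m') (mob a b c d t) =
    (of_int c * t + of_int d) ^ 4 * (of_nat p ^ 3 / of_int r' ^ 4 * (f (mob a' b' c' d' u) / (of_int c' * u + of_int d') ^ 4))"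
proof -
  note act = coset_action[OF M det det' t eq, folded u_def]
  have nz: "of_int c * t + of_int d \<noteq> 0" "of_int m' \<noteq> (0 :: complex)" "of_int r' \<noteq> (0 :: complex)"
    using Im_mob_pos(2)[OF det t] R_pos[OF M(1)] R_pos[OF M(2)] by auto
  have "of_int m' * (of_int c * t + of_int d) \<noteq> 0" using nz by simp
  hence nz': "of_int c' * u + of_int d' \<noteq> 0" unfolding act(2) by simp
  have "of_int m' ^ 4 * (of_int c * t + of_int d) ^ 4 = of_int r' ^ 4 * (of_int c' * u + of_int d') ^ 4"
    unfolding power_mult_distrib[symmetric] act(2) ..
  hence "1 / of_int m' ^ 4 = (of_int c * t + of_int d) ^ 4 / (of_int r' ^ 4 * (of_int c' * u + of_int d') ^ 4)"
    using nz nz' by (simp add: field_simps)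
  thus ?thesis unfolding hterm_def prod.case act(1)
    by (simp add: divide_inverse mult_ac)
qed

lemma holomorphic_hterm:
  assumes "hh f" "M \<in> heckeR p"
  shows "hterm p f M holomorphic_on uhp"
proof -
  obtain m n m' where M: "M = (m, n, m')" by (metis prod_cases3)
  have "m' > 0" using R_pos assms(2) M by blast
  hence aff: "(\<lambda>t. (of_int m * t + of_int n) / of_int m') holomorphic_on uhp"
    by (intro holomorphic_intros) auto
  have "f holomorphic_on uhp" using assms(1) by (simp add: hh_def)
  hence "(\<lambda>t. f ((of_int m * t + of_int n) / of_int m')) holomorphic_on uhp"
    by (rule holomorphic_comp_uhp[OF _ aff Im_R_pos[OF assms(2)[unfolded M]]])
  thus ?thesis unfolding M hterm_def prod.case using \<open>m' > 0\<close> by (intro holomorphic_intros) auto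
qed

text \<open>Right multiplication by gamma permutes the representatives up to plus or minus Gamma(3),
  so the terms of the sum are permuted. The map \<open>P\<close> comes from mere existence; it is
  bijective because it is injective on a finite set.\<close>

lemma hecke_gam3:
  assumes f: "hh f" and g: "gam3 a b c d" and t: "Im t > 0"
  shows "hecke p f (mob a b c d t) = (of_int c * t + of_int d) ^ 4 * hecke p f t"
proof -
  have det: "a * d - b * c = 1" using g by (simp add: gam3_def)
  define rel where "rel = (\<lambda>M R. \<exists>a' b' c' d'. case M of (m, n, m') \<Rightarrow> case R of (r, s, r') \<Rightarrow>
     a' * d' - b' * c' = 1 \<and> a' * r = m * a + n * c \<and> a' * s + b' * r' = m * b + n * d \<and>
     c' * r = m' * c \<and> c' * s + d' * r' = m' * d)"
  have "\<exists>R\<in>heckeR p. rel M R" if "M \<in> heckeR p" for M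
  proof -
    obtain m n m' where M: "M = (m, n, m')" by (metis prod_cases3)
    from coset_exists[OF that[unfolded M] det] obtain r s r' a' b' c' d' where
      "(r, s, r') \<in> heckeR p" "a' * d' - b' * c' = 1" "a' * r = m * a + n * c" "a' * s + b' * r' = m * b + n * d"
      "c' * r = m' * c" "c' * s + d' * r' = m' * d" .
    thus ?thesis unfolding M rel_def by (intro bexI[of _ "(r, s, r')"]) auto
  qed
  then obtain P where P: "\<And>M. M \<in> heckeR p \<Longrightarrow> P M \<in> heckeR p \<and> rel M (P M)" by metis
  have "inj_on P (heckeR p)"
  proof
    fix M1 M2 assume M: "M1 \<in> heckeR p" "M2 \<in> heckeR p" "P M1 = P M2"
    obtain m1 n1 m1' m2 n2 m2' r s r' where eq: "M1 = (m1, n1, m1')" "M2 = (m2, n2, m2')" "P M2 = (r, s, r')"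
      by (metis prod_cases3)
    note M' = M(1,2)[unfolded eq(1,2)]
    from P[OF M(1)] P[OF M(2)] have R: "(r, s, r') \<in> heckeR p" "rel M1 (r, s, r')" "rel M2 (r, s, r')"
      unfolding M(3) eq(3) by auto
    from R(2) obtain a1 b1 c1 d1 where 1: "a1 * r = m1 * a + n1 * c" "a1 * s + b1 * r' = m1 * b + n1 * d"
      "c1 * r = m1' * c" "c1 * s + d1 * r' = m1' * d" unfolding rel_def eq(1) by auto
    from R(3) obtain a2 b2 c2 d2 where 2: "a2 * r = m2 * a + n2 * c" "a2 * s + b2 * r' = m2 * b + n2 * d"
      "c2 * r = m2' * c" "c2 * s + d2 * r' = m2' * d" unfolding rel_def eq(2) by auto
    show "M1 = M2" unfolding eq(1,2) by (rule coset_unique[OF M' R(1) det 1 2])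
  qed
  moreover have "P ` heckeR p \<subseteq> heckeR p" using P by auto
  ultimately have bij: "bij_betw P (heckeR p) (heckeR p)"
    using finite_R by (simp add: bij_betw_def endo_inj_surj)
  have "hterm p f M (mob a b c d t) = (of_int c * t + of_int d) ^ 4 * hterm p f (P M) t" if M: "M \<in> heckeR p" for M
  proof -
    obtain m n m' r s r' where eq: "M = (m, n, m')" "P M = (r, s, r')" by (metis prod_cases3)
    from P[OF M] have "(r, s, r') \<in> heckeR p" "rel (m, n, m') (r, s, r')"
      unfolding eq(2)[symmetric] eq(1)[symmetric] by auto
    then obtain a' b' c' d' where R: "(r, s, r') \<in> heckeR p" "a' * d' - b' * c' = 1"
      "a' * r = m * a + n * c" "a' * s + b' * r' = m * b + n * d" "c' * r = m' * c" "c' * s + d' * r' = m' * d"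
      unfolding rel_def by auto
    note M' = M[unfolded eq(1)]
    obtain e where e: "e = 1 \<or> e = - 1" "gam3 (e * a') (e * b') (e * c') (e * d')"
      by (rule coset_gam3[OF M' R(1) g R(2-6)])
    define u where "u = (of_int r * t + of_int s) / (of_int r' :: complex)"
    have u: "Im u > 0" unfolding u_def by (rule Im_R_pos[OF R(1) t])
    have "of_int c' * u + of_int d' \<noteq> 0" by (rule Im_mob_pos(2)[OF R(2) u])
    hence "f (mob a' b' c' d' u) / (of_int c' * u + of_int d') ^ 4 = f u"
      using hh_scale_gam3[OF f e u] by simp
    thus ?thesis unfolding eq(2) unfolding eq(1) hterm_transform[OF M' R(1) det R(2) t R(3-6)] u_def[symmetric]
      by (simp add: hterm_def u_def)
  qed
  hence "hecke p f (mob a b c d t) = (of_int c * t + of_int d) ^ 4 * (\<Sum>M\<in>heckeR p. hterm p f (P M) t)"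
    unfolding hecke_def sum_distrib_left by (intro sum.cong) auto
  also have "(\<Sum>M\<in>heckeR p. hterm p f (P M) t) = hecke p f t"
    unfolding hecke_def by (rule sum.reindex_bij_betw[OF bij])
  finally show ?thesis .
qed

text \<open>At the other cusps the matrix (i, -1; 1, 0) is carried through each representative. The
  relation c' r = m' with \<open>m'\<close> prime to 3 shows that 3 does not divide
  \<open>c'\<close>, so no representative takes such a cusp to infinity.\<close>

lemma hh_hecke:
  assumes f: "hh f"
  shows "hh (hecke p f)"
  unfolding hh_def
proof (intro conjI allI impI ballI)
  show "hecke p f holomorphic_on uhp"
    unfolding hecke_def[abs_def] by (intro holomorphic_on_sum holomorphic_hterm f)
  show "hecke p f (mob a b c d t) = (of_int c * t + of_int d) ^ 4 * hecke p f t"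
    if "gam3 a b c d" "Im t > 0" for a b c d t by (rule hecke_gam3[OF f that])
  fix i :: int assume "i \<in> {-1, 0, 1}"
  have det: "i * 0 - (-1) * 1 = (1 :: int)" by simp
  have mob1: "mob i (-1) 1 0 t = - 1 / t + of_int i" if "Im t > 0" for t
  proof -
    have "t \<noteq> 0" using that by auto
    thus ?thesis by (simp add: mob_def field_simps)
  qed
  have "((\<lambda>t. hterm p f M (- 1 / t + of_int i) / t ^ 4) \<longlongrightarrow> 0) ioo" if M: "M \<in> heckeR p" for M
  proof -
    obtain m n m' where eq: "M = (m, n, m')" by (metis prod_cases3)
    note M' = M[unfolded eq]
    obtain r s r' a' b' c' d' where R: "(r, s, r') \<in> heckeR p" "a' * d' - b' * c' = 1"
      "a' * r = m * i + n * 1" "a' * s + b' * r' = m * (-1) + n * 0" "c' * r = m' * 1" "c' * s + d' * r' = m' * 0"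
      by (rule coset_exists[OF M' det])
    have "\<not> 3 dvd c'" using R(5) R_pos[OF M'] by auto
    define u where "u = (\<lambda>t. (of_int r * t + of_int s) / (of_int r' :: complex))"
    have "filterlim u ioo ioo"
      using filterlim_ioo_affine[of "nat r" "nat r'" s] R_pos[OF R(1)] by (simp add: u_def)
    from filterlim_compose[OF hh_cusp[OF f R(2) \<open>\<not> 3 dvd c'\<close>] this]
    have "((\<lambda>t. of_nat p ^ 3 / of_int r' ^ 4 * (f (mob a' b' c' d' (u t)) / (of_int c' * u t + of_int d') ^ 4)) \<longlongrightarrow> of_nat p ^ 3 / of_int r' ^ 4 * 0) ioo"
      by (rule tendsto_mult[OF tendsto_const])
    moreover have "\<forall>\<^sub>F t in ioo. of_nat p ^ 3 / of_int r' ^ 4 * (f (mob a' b' c' d' (u t)) / (of_int c' * u t + of_int d') ^ 4) =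
       hterm p f M (- 1 / t + of_int i) / t ^ 4"
      using eventually_ioo_gt[of 0]
    proof eventually_elim
      case (elim t)
      have "t \<noteq> 0" using elim by auto
      thus ?case using hterm_transform[OF M' R(1) det R(2) elim R(3-6), of f]
        unfolding mob1[OF elim] eq u_def by simp
    qed
    ultimately show ?thesis by (simp add: Lim_transform_eventually)
  qed
  hence "((\<lambda>t. \<Sum>M\<in>heckeR p. hterm p f M (- 1 / t + of_int i) / t ^ 4) \<longlongrightarrow> (\<Sum>M\<in>heckeR p. 0)) ioo"
    by (rule tendsto_sum)
  thus "((\<lambda>t. hecke p f (- 1 / t + of_int i) / t ^ 4) \<longlongrightarrow> 0) ioo"
    by (simp add: hecke_def sum_divide_distrib)
qed

lemma qexp_hecke:
  assumes "qexp f F"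
  shows "qexp (hecke p f) (fls_const (of_nat p ^ 3) * fls_compose_power F p + uf p F)"
  unfolding hecke_altdef[abs_def] using p_gt_1
  by (intro qexp_add qexp_cmult qexp_V qexp_U assms) auto

end

section \<open>Congruences for the coefficients\<close>

lemma dL_nz: "Im t > 0 \<Longrightarrow> dL t \<noteq> 0"
  using gH_dL[of t] bH_nz[of t] by auto

text \<open>This expression gives \<open>gH\<close> its transformation law in weight 4 without
  recourse to the multiplier of eta.\<close>

lemma gH_altdef: "Im t > 0 \<Longrightarrow> gH t = - (bH t)\<^sup>2 / dL t"
  using gH_dL[of t] dL_nz[of t] by (simp add: field_simps)

lemma gH_gam3:
  assumes "gam3 a b c d" "Im t > 0"
  shows "gH (mob a b c d t) = (of_int c * t + of_int d) ^ 4 * gH t"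
proof -
  have det: "a * d - b * c = 1" using assms(1) by (simp add: gam3_def)
  define J where "J = of_int c * t + (of_int d :: complex)"
  have "J \<noteq> 0" unfolding J_def by (rule Im_mob_pos(2)[OF det assms(2)])
  thus ?thesis
    unfolding gH_altdef[OF Im_mob_pos(1)[OF det assms(2)]] gH_altdef[OF assms(2)] dL_gam3[OF assms] bH_gam3[OF assms] J_def[symmetric]
    using dL_nz[OF assms(2)] by (simp add: field_simps eval_nat_numeral)
qed

lemma gH_S:
  assumes "Im t > 0"
  shows "gH (- 1 / t) = t ^ 4 * gH t"
proof -
  have nz: "t \<noteq> 0" "wH t \<noteq> 0" "dL t \<noteq> 0" using assms wH_nz dL_nz by auto
  have "gH (- 1 / t) = - (t ^ 3 * kc * bH t / wH t)\<^sup>2 / (- 27 * t\<^sup>2 * dL t / wH t ^ 2)"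
    by (simp only: gH_altdef[OF Im_minus_inverse[OF assms]] dL_S[OF assms] bH_S[OF assms])
  also have "\<dots> = t ^ 4 * kc\<^sup>2 * (bH t)\<^sup>2 / (27 * dL t)"
    using nz by (simp add: field_simps eval_nat_numeral)
  finally show ?thesis by (simp add: kc_square gH_altdef[OF assms])
qed

lemma lH_gam3: "gam3 a b c d \<Longrightarrow> Im t > 0 \<Longrightarrow> lH (mob a b c d t) = lH t"
  by (simp add: lH_def wH_gam3)

lemma shift_eigen:
  assumes i: "i \<in> {-1, 0, 1 :: int}"
  obtains x y where "x \<noteq> 0" "\<And>s. Im s > 0 \<Longrightarrow> gH (s + of_int i) = x * gH s"
    "\<And>s. Im s > 0 \<Longrightarrow> lH (s + of_int i) = y * lH s"
proof -
  from i consider "i = -1" | "i = 0" | "i = 1" by auto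
  thus ?thesis
  proof cases
    case 1
    have "gH (s - 1) = omg\<^sup>2 * gH s" "lH (s - 1) = omg * lH s" if "Im s > 0" for s
      using gH_T[of "s - 1"] lH_T[of "s - 1"] that by (simp_all add: mult.assoc[symmetric] omg_cube' mult.commute[of "omg\<^sup>2"])
    thus ?thesis using 1 by (intro that[of "omg\<^sup>2" omg]) auto
  next
    case 2 thus ?thesis by (intro that[of 1 1]) auto
  next
    case 3 thus ?thesis by (intro that[of omg "omg\<^sup>2"]) (auto simp: gH_T lH_T)
  qed
qed

text \<open>\<open>gH\<close> is carried to itself by S in weight 4 and vanishes at infinity, and L
  is finite at the other cusps.\<close>

lemma hh_gH_lH: "hh (\<lambda>t. gH t * lH t ^ n)"
  unfolding hh_def
proof (intro conjI allI impI ballI)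
  show "(\<lambda>t. gH t * lH t ^ n) holomorphic_on uhp"
    by (intro holomorphic_intros holomorphic_gH holomorphic_lH)
  fix i :: int assume "i \<in> {-1, 0, 1}"
  then obtain x y where xy: "x \<noteq> 0" "\<And>s. Im s > 0 \<Longrightarrow> gH (s + of_int i) = x * gH s"
    "\<And>s. Im s > 0 \<Longrightarrow> lH (s + of_int i) = y * lH s" using shift_eigen by blast
  have "((\<lambda>t. (gH t / qq t) * qq t) \<longlongrightarrow> 1 * 0) ioo" by (intro tendsto_intros lim_gH_qq lim_qq)
  hence "(gH \<longlongrightarrow> 0) ioo" by simp
  hence "((\<lambda>t. x * gH t * (y * (27 * inverse (wH t) + 3)) ^ n) \<longlongrightarrow> x * 0 * (y * (27 * 0 + 3)) ^ n) ioo"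
    by (intro tendsto_intros lim_inverse_wH)
  moreover have "\<forall>\<^sub>F t in ioo. x * gH t * (y * (27 * inverse (wH t) + 3)) ^ n =
      gH (- 1 / t + of_int i) * lH (- 1 / t + of_int i) ^ n / t ^ 4"
    using eventually_ioo_gt[of 0]
  proof eventually_elim
    case (elim t)
    have "t \<noteq> 0" using elim by auto
    thus ?case unfolding xy(2,3)[OF Im_minus_inverse[OF elim]] gH_S[OF elim] lH_S[OF elim] by simp
  qed
  ultimately show "((\<lambda>t. gH (- 1 / t + of_int i) * lH (- 1 / t + of_int i) ^ n / t ^ 4) \<longlongrightarrow> 0) ioo"
    by (simp add: Lim_transform_eventually)
qed (simp add: gH_gam3 lH_gam3)

lemma hh_diff_cmult:
  assumes "hh f" "hh g"
  shows "hh (\<lambda>t. f t - k * g t)"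
  unfolding hh_def
proof (intro conjI allI impI ballI)
  show "(\<lambda>t. f t - k * g t) holomorphic_on uhp"
    using assms by (intro holomorphic_intros) (auto simp: hh_def)
  fix i :: int assume "i \<in> {-1, 0, 1}"
  hence "((\<lambda>t. f (- 1 / t + of_int i) / t ^ 4) \<longlongrightarrow> 0) ioo" "((\<lambda>t. g (- 1 / t + of_int i) / t ^ 4) \<longlongrightarrow> 0) ioo"
    using assms by (auto simp: hh_def)
  hence "((\<lambda>t. f (- 1 / t + of_int i) / t ^ 4 - k * (g (- 1 / t + of_int i) / t ^ 4)) \<longlongrightarrow> 0 - k * 0) ioo"
    by (intro tendsto_intros)
  thus "((\<lambda>t. (f (- 1 / t + of_int i) - k * g (- 1 / t + of_int i)) / t ^ 4) \<longlongrightarrow> 0) ioo"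
    by (simp add: diff_divide_distrib)
qed (simp add: hh_gam3[OF assms(1)] hh_gam3[OF assms(2)] algebra_simps)

lemma gf_lf_nth: "fls_nth (gf * lf ^ i) n = (if n < 1 - int i then 0 else fps_nth (et 3 ^ 8 * lfps ^ i) (nat (n - 1 + int i)))"
proof -
  have "gf * lf ^ i = fls_X * (fls_X_inv ^ i * fps_to_fls (et 3 ^ 8 * lfps ^ i))"
    by (simp add: gf_def lf_lfps power_mult_distrib fps_to_fls_power fls_times_fps_to_fls mult_ac)
  thus ?thesis by (simp add: fls_X_times_conv_shift fls_X_inv_power_times_conv_shift) (simp add: algebra_simps)
qed

lemma gf_lf_lead: "fls_nth (gf * lf ^ i) (1 - int i) = 1"
  by (simp add: gf_lf_nth fps_power_zeroth lfps_coeffs)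

definition gspan :: "nat \<Rightarrow> (nat \<Rightarrow> complex) \<Rightarrow> complex fls" where
  "gspan n c = (\<Sum>i<n. fls_const (c i) * (gf * lf ^ i))"

text \<open>Elimination from the lowest exponent upwards; the range ends with q^1, where
  \<open>gf\<close> itself has its leading term.\<close>

lemma gspan_principal_part:
  assumes "\<And>k. k < 2 - int n \<Longrightarrow> fls_nth F k = 0"
  obtains c where "\<And>k. k \<le> 1 \<Longrightarrow> fls_nth (F - gspan n c) k = 0"
  using assms
proof (induction n arbitrary: F thesis)
  case 0
  show ?case by (rule "0.prems"(1)) (use 0 in \<open>auto simp: gspan_def\<close>)
next
  case (Suc n)
  define x where "x = fls_nth F (1 - int n)"
  define F' where "F' = F - fls_const x * (gf * lf ^ n)"
  have "fls_nth F' k = 0" if "k < 2 - int n" for k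
  proof (cases "k = 1 - int n")
    case True
    thus ?thesis by (simp only: F'_def x_def True fls_minus_nth fls_mult_const_nth gf_lf_lead) simp
  next
    case False
    hence "k < 1 - int n" using that by simp
    thus ?thesis using Suc.prems(2)[of k] by (simp add: F'_def gf_lf_nth)
  qed
  then obtain c where c: "\<And>k. k \<le> 1 \<Longrightarrow> fls_nth (F' - gspan n c) k = 0" using Suc.IH by blast
  have "gspan (Suc n) (c(n := x)) = gspan n c + fls_const x * (gf * lf ^ n)"
    unfolding gspan_def by simp
  hence "F - gspan (Suc n) (c(n := x)) = F' - gspan n c" by (simp add: F'_def)
  with c show ?case by (intro Suc.prems(1)[of "c(n := x)"]) (simp only:)
qed

text \<open>After subtraction the quotient by \<open>gH\<close> tends to 0 at infinity, because
  agreement reaches the exponent 1 at which \<open>gH\<close> vanishes. At the other cusps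
  \<open>gH\<close> has order 1 and \<open>f\<close> tends to 0, so the quotient grows more slowly
  than 1/q. Liouville's theorem leaves the constant 0.\<close>

theorem hh_structure:
  assumes f: "hh f" and F: "qexp f F"
  obtains n c where "F = gspan n c"
proof -
  obtain N where N: "\<And>k. k < - int N \<Longrightarrow> fls_nth F k = 0" using fls_eventually_zero[of F] by blast
  define n where "n = N + 2"
  obtain c where c: "\<And>k. k \<le> 1 \<Longrightarrow> fls_nth (F - gspan n c) k = 0"
    by (rule gspan_principal_part[of n F]) (use N in \<open>auto simp: n_def\<close>)
  define S where "S = (\<lambda>x. \<Sum>i<n. c i * x ^ i)"
  define Z where "Z = (\<lambda>t. f t / gH t - S (lH t))"
  have qS: "qexp (\<lambda>t. gH t * S (lH t)) (gspan n c)"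
  proof -
    have "qexp (\<lambda>t. \<Sum>i<n. c i * (gH t * lH t ^ i)) (gspan n c)"
      unfolding gspan_def by (intro qexp_sum qexp_cmult qexp_mult qexp_power qexp_gH qexp_lH)
    thus ?thesis by (simp add: S_def sum_distrib_left mult_ac)
  qed
  have limZ: "(Z \<longlongrightarrow> 0) ioo"
  proof -
    have q: "qexp (\<lambda>t. (f t - gH t * S (lH t)) / qq t) ((F - gspan n c) / fls_X)"
      by (intro qexp_divide qexp_diff F qS qexp_qq)
    have nth: "fls_nth ((F - gspan n c) / fls_X) k = fls_nth (F - gspan n c) (k + 1)" for k
      by (simp add: fls_divide_X)
    have "fls_subdegree ((F - gspan n c) / fls_X) \<ge> 0"
      by (rule fls_subdegree_ge_nthI) (auto simp only: nth, rule c, simp)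
    from qexp_tendsto[OF q this] have "((\<lambda>t. (f t - gH t * S (lH t)) / qq t) \<longlongrightarrow> 0) ioo"
      using c[of 1] by (simp only: nth) simp
    hence "((\<lambda>t. ((f t - gH t * S (lH t)) / qq t) / (gH t / qq t)) \<longlongrightarrow> 0 / 1) ioo"
      by (intro tendsto_divide lim_gH_qq) auto
    moreover have "\<forall>\<^sub>F t in ioo. ((f t - gH t * S (lH t)) / qq t) / (gH t / qq t) = Z t"
      using eventually_ioo_gt[of 0] 
    proof eventually_elim
      case (elim t)
      have "((f t - gH t * S (lH t)) / qq t) / (gH t / qq t) = (f t - gH t * S (lH t)) / gH t" by simp
      thus ?case using gH_nz[OF elim] by (simp add: Z_def diff_divide_distrib)
    qed
    ultimately show ?thesis by (simp add: Lim_transform_eventually)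
  qed
  obtain k where k: "\<And>t. Im t > 0 \<Longrightarrow> Z t = k"
  proof (rule gam3_liouville[of Z])
    show "Z holomorphic_on uhp" unfolding Z_def S_def using f
      by (intro holomorphic_intros holomorphic_gH holomorphic_lH) (auto simp: hh_def gH_nz)
    show "Z (mob a b c d t) = Z t" if "gam3 a b c d" "Im t > 0" for a b c d t
    proof -
      have "of_int c * t + of_int d \<noteq> 0" using Im_mob_pos(2)[of a d b c t] that by (simp add: gam3_def)
      thus ?thesis by (simp add: Z_def hh_gam3[OF f that] gH_gam3[OF that] lH_gam3[OF that])
    qed
    show "((\<lambda>t. qq t * Z t) \<longlongrightarrow> 0) ioo" using tendsto_mult[OF lim_qq limZ] by simp
    show "((\<lambda>t. qq t * Z (- 1 / t + of_int i)) \<longlongrightarrow> 0) ioo" if i: "i \<in> {-1, 0, 1 :: int}" for i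
    proof -
      obtain x y where xy: "x \<noteq> 0" "\<And>s. Im s > 0 \<Longrightarrow> gH (s + of_int i) = x * gH s"
        "\<And>s. Im s > 0 \<Longrightarrow> lH (s + of_int i) = y * lH s" using shift_eigen[OF i] by blast
      have "((\<lambda>t. f (- 1 / t + of_int i) / t ^ 4) \<longlongrightarrow> 0) ioo" using f i by (auto simp: hh_def)
      hence "((\<lambda>t. (f (- 1 / t + of_int i) / t ^ 4) / (x * (gH t / qq t)) - qq t * S (y * (27 * inverse (wH t) + 3))) \<longlongrightarrow>
          0 / (x * 1) - 0 * S (y * (27 * 0 + 3))) ioo"
        unfolding S_def using xy(1) by (intro tendsto_intros lim_qq lim_gH_qq lim_inverse_wH) auto
      moreover have "\<forall>\<^sub>F t in ioo. (f (- 1 / t + of_int i) / t ^ 4) / (x * (gH t / qq t)) - qq t * S (y * (27 * inverse (wH t) + 3)) =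
          qq t * Z (- 1 / t + of_int i)"
        using eventually_ioo_gt[of 0]
      proof eventually_elim
        case (elim t)
        have "t \<noteq> 0" using elim by auto
        thus ?case unfolding Z_def xy(2,3)[OF Im_minus_inverse[OF elim]] gH_S[OF elim] lH_S[OF elim]
          by (simp add: right_diff_distrib mult_ac)
      qed
      ultimately show ?thesis by (simp add: Lim_transform_eventually)
    qed
  qed blast
  have "(Z \<longlongrightarrow> k) ioo"
    using k by (auto intro!: tendsto_eventually eventually_mono[OF eventually_ioo_gt[of 0]])
  hence "k = 0" using limZ tendsto_unique[OF ioo_neq_bot] by blast
  hence "f t = gH t * S (lH t)" if "Im t > 0" for t
    using k[OF that] gH_nz[OF that] by (simp add: Z_def field_simps)
  hence "qexp f (gspan n c)" by (intro qexp_cong[OF _ qS]) simp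
  with F have "F = gspan n c" by (rule qexp_unique)
  thus ?thesis by (rule that)
qed

section \<open>Integrality and divisibility of coefficients\<close>

definition intmult :: "int \<Rightarrow> complex set" where "intmult N = {of_int (N * z) |z. True}"

lemma intmultI: "x = of_int (N * z) \<Longrightarrow> x \<in> intmult N"
  by (auto simp: intmult_def)

lemma intmult_0 [simp]: "0 \<in> intmult N"
  by (rule intmultI[of _ _ 0]) simp

lemma intmult_add: "x \<in> intmult N \<Longrightarrow> y \<in> intmult N \<Longrightarrow> x + y \<in> intmult N"
  unfolding intmult_def by (auto simp flip: of_int_add distrib_left)

lemma intmult_diff: "x \<in> intmult N \<Longrightarrow> y \<in> intmult N \<Longrightarrow> x - y \<in> intmult N"
  unfolding intmult_def by (auto simp flip: of_int_diff right_diff_distrib)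

lemma intmult_mult: "x \<in> intmult M \<Longrightarrow> y \<in> intmult N \<Longrightarrow> x * y \<in> intmult (M * N)"
proof -
  assume "x \<in> intmult M" "y \<in> intmult N"
  then obtain a b where "x = of_int (M * a)" "y = of_int (N * b)" by (auto simp: intmult_def)
  thus ?thesis by (intro intmultI[of _ _ "a * b"]) simp
qed

lemma intmult_1: "intmult 1 = \<int>"
  by (auto simp: intmult_def Ints_def)

lemma intmult_Ints: "x \<in> intmult N \<Longrightarrow> y \<in> \<int> \<Longrightarrow> x * y \<in> intmult N"
  using intmult_mult[of x N y 1] by (simp add: intmult_1)

lemma intmult_sum: "(\<And>i. i \<in> I \<Longrightarrow> f i \<in> intmult N) \<Longrightarrow> sum f I \<in> intmult N"
  by (induction I rule: infinite_finite_induct) (auto intro: intmult_add)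

definition int_fps :: "complex fps \<Rightarrow> bool" where "int_fps F \<longleftrightarrow> (\<forall>n. fps_nth F n \<in> \<int>)"

lemma int_fps_mult: "int_fps F \<Longrightarrow> int_fps H \<Longrightarrow> int_fps (F * H)"
  by (auto simp: int_fps_def fps_mult_nth intro!: Ints_sum Ints_mult)

lemma int_fps_1 [simp]: "int_fps 1" by (auto simp: int_fps_def)

lemma int_fps_power: "int_fps F \<Longrightarrow> int_fps (F ^ n)"
  by (induction n) (auto intro: int_fps_mult)

lemma int_fps_prod: "(\<And>i. i \<in> I \<Longrightarrow> int_fps (f i)) \<Longrightarrow> int_fps (prod f I)"
  by (induction I rule: infinite_finite_induct) (auto intro: int_fps_mult)

lemma int_fps_inverse:
  assumes "int_fps F" "fps_nth F 0 = 1"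
  shows "int_fps (inverse F)"
  unfolding int_fps_def
proof
  fix n show "fps_nth (inverse F) n \<in> \<int>"
  proof (induction n rule: less_induct)
    case (less n)
    show ?case
    proof (cases n)
      case (Suc m)
      have "inverse F * F = 1" using assms(2) by (intro inverse_mult_eq_1) simp
      hence "fps_nth (inverse F * F) n = 0" using Suc by simp
      hence "fps_nth (inverse F) n = - (\<Sum>i<n. fps_nth (inverse F) i * fps_nth F (n - i))"
        using assms(2) unfolding fps_mult_nth atLeast0AtMost
        by (subst (asm) lessThan_Suc_atMost[symmetric]) (simp add: add_eq_0_iff2)
      thus ?thesis using less assms(1) by (auto simp: int_fps_def intro!: Ints_sum Ints_mult)
    qed (use assms in simp)
  qed
qed

lemma int_fps_et: "int_fps (et d)"
proof -
  have "int_fps (\<Prod>k\<in>{1..n}. 1 - fps_X ^ (d * k))" for n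
    by (rule int_fps_prod) (auto simp: int_fps_def fps_X_power_iff)
  moreover have "fps_nth (et d) n = fps_nth (\<Prod>k\<in>{1..n}. 1 - fps_X ^ (d * k)) n" for n
    unfolding et_def cmap_nth eta_prod_def fps_nth_Abs_fps
    by (simp flip: cmap_nth add: cmap_prod cmap_diff)
  ultimately show ?thesis by (auto simp: int_fps_def)
qed

lemma int_fps_psi: "int_fps psi_fps"
  unfolding psi_fps_def by (intro int_fps_mult int_fps_power int_fps_inverse int_fps_et) (simp add: fps_power_zeroth)

lemma int_fps_lfps: "int_fps lfps"
  using int_fps_psi by (auto simp: int_fps_def lfps_def fps_numeral_nth intro!: Ints_add)

lemma gf_lf_Ints: "fls_nth (gf * lf ^ i) n \<in> \<int>"
  using int_fps_mult[OF int_fps_power[OF int_fps_et] int_fps_power[OF int_fps_lfps], of 3 8 i]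
  by (simp add: gf_lf_nth int_fps_def)

text \<open>The generators are integral with leading coefficient 1 at the distinct exponents
  \<open>1 - i\<close>, all at most 1, so the constants are recovered one by one from the low
  coefficients, starting at the lowest.\<close>

lemma gspan_intmult:
  assumes "\<And>k. k \<le> 1 \<Longrightarrow> fls_nth (gspan n c) k \<in> intmult N"
  shows "fls_nth (gspan n c) k \<in> intmult N"
  using assms
proof (induction n arbitrary: k)
  case (Suc n)
  have split: "gspan (Suc n) c = gspan n c + fls_const (c n) * (gf * lf ^ n)" by (simp add: gspan_def)
  have "fls_nth (gspan n c) (1 - int n) = 0"
    unfolding gspan_def fls_nth_sum by (rule sum.neutral) (auto simp: gf_lf_nth)
  hence "c n = fls_nth (gspan (Suc n) c) (1 - int n)"
    by (simp only: split fls_plus_nth fls_mult_const_nth gf_lf_lead) simp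
  hence cn: "c n \<in> intmult N" using Suc.prems[of "1 - int n"] by simp
  hence *: "fls_nth (fls_const (c n) * (gf * lf ^ n)) k \<in> intmult N" for k
    unfolding fls_mult_const_nth by (intro intmult_Ints gf_lf_Ints)
  have "fls_nth (gspan n c) k \<in> intmult N" for k
  proof (rule Suc.IH)
    fix k :: int assume "k \<le> 1"
    from intmult_diff[OF Suc.prems[OF this] *[of k]] show "fls_nth (gspan n c) k \<in> intmult N"
      by (simp add: split)
  qed
  thus ?case unfolding split fls_plus_nth by (intro intmult_add *)
qed (simp add: gspan_def)

definition Cc :: "int \<Rightarrow> complex" where "Cc n = fls_nth (gf * lf ^ 2) n"

lemma Cc_Ints: "Cc n \<in> \<int>" unfolding Cc_def by (rule gf_lf_Ints)

lemma Cc_below: "n < -1 \<Longrightarrow> Cc n = 0" by (simp add: Cc_def gf_lf_nth)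

lemma omg_power_eq_1: "omg ^ n = 1 \<Longrightarrow> 3 dvd n"
proof -
  assume 1: "omg ^ n = 1"
  have "omg ^ n = omg ^ (n mod 3) * (omg ^ 3) ^ (n div 3)"
    by (simp flip: power_mult power_add)
  hence "omg ^ (n mod 3) = 1" using 1 by (simp add: omg_cube)
  moreover have "n mod 3 = 0 \<or> n mod 3 = 1 \<or> n mod 3 = 2" by linarith
  moreover have "omg\<^sup>2 \<noteq> 1" using omg_cube' omg_ne by (metis mult.right_neutral)
  ultimately show "3 dvd n" by auto
qed

text \<open>Translation by 1 multiplies q and \<open>gH\<close> by \<open>omg\<close> and
  \<open>lH\<close> by its square, so q G is invariant, while q^n acquires
  \<open>omg ^ n\<close>.\<close>

lemma Cc_support:
  assumes "n mod 3 \<noteq> 2"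
  shows "Cc n = 0"
proof (cases "n < -1")
  case False
  define P where "P = et 3 ^ 8 * lfps\<^sup>2"
  define f where "f = (\<lambda>t. qq t * (gH t * lH t ^ 2))"
  have "fls_X * (gf * lf ^ 2) = fps_to_fls P"
    by (rule fls_eqI) (auto simp: fls_X_times_conv_shift gf_lf_nth P_def)
  hence q: "qexp f (fps_to_fls P)"
    unfolding f_def using qexp_mult[OF qexp_qq qexp_mult[OF qexp_gH qexp_power[OF qexp_lH, of 2]]] by simp
  have "filterlim (\<lambda>t. t + 1) ioo ioo" using filterlim_ioo_affine[of 1 1 1] by simp
  with qexp_fps_sums[OF q] have "\<forall>\<^sub>F t in ioo. (\<lambda>n. fps_nth P n * qq (t + 1) ^ n) sums f (t + 1)"
    by (rule eventually_compose_filterlim)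
  with eventually_ioo_gt[of 0] have "\<forall>\<^sub>F t in ioo. (\<lambda>n. fps_nth (Abs_fps (\<lambda>n. fps_nth P n * omg ^ n)) n * qq t ^ n) sums f t"
  proof eventually_elim
    case (elim t)
    have "f (t + 1) = (omg ^ 3)\<^sup>2 * f t"
      by (simp add: f_def qq_T gH_T lH_T[OF elim(1)] power_mult_distrib eval_nat_numeral mult_ac)
    thus ?case using elim(2) by (simp add: omg_cube qq_T power_mult_distrib mult_ac)
  qed
  hence "qexp f (fps_to_fls (Abs_fps (\<lambda>n. fps_nth P n * omg ^ n)))" by (rule qexp_of_fps_sums)
  with q have "fps_to_fls P = fps_to_fls (Abs_fps (\<lambda>n. fps_nth P n * omg ^ n))" by (rule qexp_unique)
  hence "P = Abs_fps (\<lambda>n. fps_nth P n * omg ^ n)" by (simp only: fps_to_fls_eq_iff)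
  hence "fps_nth P m = fps_nth P m * omg ^ m" for m by (metis fps_nth_Abs_fps)
  hence zero: "fps_nth P m = 0" if "\<not> 3 dvd m" for m using omg_power_eq_1[of m] that by (metis mult_cancel_left1)
  have "\<not> 3 dvd n + 1" using assms by presburger
  moreover have "int (nat (n + 1)) = n + 1" using False by simp
  ultimately have "\<not> 3 dvd nat (n + 1)" by (metis int_dvd_int_iff of_nat_numeral)
  thus ?thesis using zero[of "nat (n + 1)"] False by (simp add: Cc_def gf_lf_nth P_def add.commute)
qed (simp add: Cc_below)

definition heckeT :: "nat \<Rightarrow> complex fls \<Rightarrow> complex fls" where
  "heckeT p F = fls_const (of_nat p ^ 3) * fls_compose_power F p + uf p F"

text \<open>The expansion of \<open>G | T(p\<^sup>k)\<close>, by the Hecke recursion in weight 4.\<close>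

fun heckeA :: "nat \<Rightarrow> nat \<Rightarrow> complex fls" where
  "heckeA p 0 = gf * lf ^ 2"
| "heckeA p (Suc 0) = heckeT p (heckeA p 0)"
| "heckeA p (Suc (Suc k)) = heckeT p (heckeA p (Suc k)) - fls_const (of_nat p ^ 3) * heckeA p k"

section \<open>Coefficients of G under T(p^k)\<close>

context hecke_prime
begin

lemma heckeT_nth:
  "fls_nth (heckeT p F) n = of_nat p ^ 3 * (if int p dvd n then fls_nth F (n div int p) else 0) + fls_nth F (int p * n)"
  using p_gt_1 by (simp add: heckeT_def uf_nth fls_nth_compose_power)

lemma qexp_heckeT: "qexp f F \<Longrightarrow> qexp (hecke p f) (heckeT p F)"
  unfolding heckeT_def by (rule qexp_hecke)

lemma heckeA_hh: "\<exists>f. hh f \<and> qexp f (heckeA p k)"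
proof -
  have "(\<exists>f. hh f \<and> qexp f (heckeA p k)) \<and> (\<exists>f. hh f \<and> qexp f (heckeA p (Suc k)))"
  proof (induction k)
    case 0
    have "hh (\<lambda>t. gH t * lH t ^ 2)" "qexp (\<lambda>t. gH t * lH t ^ 2) (gf * lf ^ 2)"
      by (intro hh_gH_lH) (intro qexp_mult qexp_power qexp_gH qexp_lH)
    thus ?case using hh_hecke qexp_heckeT by (metis heckeA.simps(1,2))
  next
    case (Suc k)
    then obtain f g where "hh f" "qexp f (heckeA p k)" "hh g" "qexp g (heckeA p (Suc k))" by blast
    hence "hh (\<lambda>t. hecke p g t - of_nat p ^ 3 * f t)"
      "qexp (\<lambda>t. hecke p g t - of_nat p ^ 3 * f t) (heckeA p (Suc (Suc k)))"
      by (auto intro!: hh_diff_cmult hh_hecke qexp_diff qexp_heckeT qexp_cmult)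
    thus ?case using Suc by blast
  qed
  thus ?thesis ..
qed

lemma heckeA_gspan: obtains n c where "heckeA p k = gspan n c"
  using heckeA_hh hh_structure by metis

text \<open>In operators, T(p^(k+1)) = U(p)^(k+1) + p^3 V(p) T(p^k): since U(p) V(p) is the
  identity, the term subtracted in the recursion cancels the contribution of p^3 U(p) V(p).\<close>

lemma heckeA_Suc_nth:
  "fls_nth (heckeA p (Suc k)) n = Cc (int p ^ Suc k * n) +
     of_nat p ^ 3 * (if int p dvd n then fls_nth (heckeA p k) (n div int p) else 0)"
proof (induction k arbitrary: n)
  case 0
  show ?case by (simp add: heckeT_nth Cc_def)
next
  case (Suc k)
  have "fls_nth (heckeA p (Suc k)) (int p * n) = Cc (int p ^ Suc k * (int p * n)) + of_nat p ^ 3 * fls_nth (heckeA p k) n"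
    unfolding Suc.IH using p_gt_1 by simp
  moreover have "int p ^ Suc k * (int p * n) = int p ^ Suc (Suc k) * n" by simp
  ultimately show ?case unfolding heckeA.simps(3) by (simp add: heckeT_nth mult_ac del: heckeA.simps)
qed

lemma Cc_nonpos: "n \<le> 0 \<Longrightarrow> n \<noteq> -1 \<Longrightarrow> Cc n = 0"
  using Cc_below[of n] Cc_support[of 0] by (cases "n = 0") auto

lemma heckeA_nonpos:
  assumes "n \<le> 0"
  shows "fls_nth (heckeA p k) n \<in> intmult (int p ^ (3 * k))"
  using assms
proof (induction k arbitrary: n)
  case 0
  thus ?case using Cc_Ints by (simp add: intmult_1 Cc_def)
next
  case (Suc k)
  have "int p ^ Suc k * n \<noteq> -1"
  proof
    assume "int p ^ Suc k * n = -1"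
    hence "int p dvd -1" by (metis dvd_mult2 dvd_triv_left power_Suc mult.assoc)
    thus False using p_gt_1 by simp
  qed
  moreover have "int p ^ Suc k * n \<le> 0" using Suc.prems p_gt_1 by (intro mult_nonneg_nonpos) auto
  ultimately have 0: "Cc (int p ^ Suc k * n) = 0" by (intro Cc_nonpos)
  have p3: "of_nat p ^ 3 \<in> intmult (int p ^ 3)" by (rule intmultI[of _ _ 1]) simp
  have e: "int p ^ (3 * Suc k) = int p ^ 3 * int p ^ (3 * k)" by (simp add: power_add[symmetric])
  show ?case
  proof (cases "int p dvd n")
    case True
    have "n div int p \<le> 0" using Suc.prems p_gt_1 by (simp add: div_nonpos_pos_le0)
    hence "of_nat p ^ 3 * fls_nth (heckeA p k) (n div int p) \<in> intmult (int p ^ 3 * int p ^ (3 * k))"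
      by (intro intmult_mult p3 Suc.IH)
    thus ?thesis unfolding heckeA_Suc_nth 0 e using True by simp
  qed (simp add: heckeA_Suc_nth 0 del: power_Suc)
qed

lemma heckeA_1: "fls_nth (heckeA p k) 1 = Cc (int p ^ k)"
proof (cases k)
  case (Suc j)
  have "\<not> int p dvd 1" using p_gt_1 by simp
  thus ?thesis unfolding Suc heckeA_Suc_nth by simp
qed (simp add: Cc_def)

lemma power_mod3: "int p ^ k mod 3 = (if even k then 1 else 2)"
proof (induction k)
  case (Suc k)
  have "int p mod 3 = 2" using mod3 by presburger
  hence "int p ^ Suc k mod 3 = (2 * (int p ^ k mod 3)) mod 3" by (metis mod_mult_eq power_Suc)
  thus ?case using Suc by (auto split: if_splits)
qed simp

lemma heckeA_even:
  assumes "even k"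
  shows "fls_nth (heckeA p k) n \<in> intmult (int p ^ (3 * k))"
proof -
  have one: "fls_nth (heckeA p k) 1 = 0"
    unfolding heckeA_1 by (rule Cc_support) (use assms in \<open>simp add: power_mod3\<close>)
  obtain m c where mc: "heckeA p k = gspan m c" by (rule heckeA_gspan)
  show ?thesis unfolding mc
  proof (rule gspan_intmult)
    fix j :: int assume "j \<le> 1"
    thus "fls_nth (gspan m c) j \<in> intmult (int p ^ (3 * k))"
      using heckeA_nonpos[of j k] one unfolding mc by (cases "j = 1") auto
  qed
qed

lemma gf_nonpos: "n \<le> 0 \<Longrightarrow> fls_nth gf n = 0" and gf_1: "fls_nth gf 1 = 1"
  using gf_lf_nth[of 0 n] gf_lf_lead[of 0] by simp_all

lemma gspan_minus_gf:
  assumes "n > 0"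
  shows "gspan n c - fls_const x * gf = gspan n (c(0 := c 0 - x))"
proof -
  obtain m where n: "n = Suc m" using assms by (cases n) auto
  have "fls_const (c 0 - x) * gf = fls_const (c 0) * gf - fls_const x * gf"
    by (simp add: left_diff_distrib flip: fls_minus_const)
  thus ?thesis unfolding gspan_def n by (simp only: sum.lessThan_Suc_shift) simp
qed

lemma gspan_extend: "\<exists>m c'. m > 0 \<and> gspan n c = gspan m c'"
proof -
  have "gspan (Suc n) (c(n := 0)) = gspan n c" by (simp add: gspan_def)
  thus ?thesis by (metis zero_less_Suc)
qed

lemma heckeA_congruence:
  "fls_nth (heckeA p k) n - Cc (int p ^ k) * fls_nth gf n \<in> intmult (int p ^ (3 * k))"
proof -
  obtain m c where mc: "heckeA p k = gspan m c" "m > 0" using heckeA_gspan gspan_extend by metis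
  define x where "x = Cc (int p ^ k)"
  have eq: "heckeA p k - fls_const x * gf = gspan m (c(0 := c 0 - x))"
    unfolding mc(1) by (rule gspan_minus_gf[OF mc(2)])
  have "fls_nth (gspan m (c(0 := c 0 - x))) n \<in> intmult (int p ^ (3 * k))"
  proof (rule gspan_intmult)
    fix j :: int assume "j \<le> 1"
    thus "fls_nth (gspan m (c(0 := c 0 - x))) j \<in> intmult (int p ^ (3 * k))"
      unfolding eq[symmetric] using heckeA_nonpos[of j k]
      by (cases "j = 1") (simp_all add: gf_nonpos gf_1 heckeA_1 x_def)
  qed
  thus ?thesis unfolding eq[symmetric] by (simp add: x_def)
qed

lemma p3_intmult: "x \<in> intmult (int p ^ j) \<Longrightarrow> of_nat p ^ 3 * x \<in> intmult (int p ^ (3 + j))"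
proof -
  assume "x \<in> intmult (int p ^ j)"
  moreover have "of_nat p ^ 3 \<in> intmult (int p ^ 3)" by (rule intmultI[of _ _ 1]) simp
  ultimately show ?thesis unfolding power_add by (intro intmult_mult)
qed

text \<open>U(p^(2m+1)) differs from T(p^(2m+1)) by p^3 V(p) T(p^(2m)), and the even case makes this
  divisible by p^3 p^(6m), which is the modulus.\<close>

theorem Cc_congruence:
  "Cc (int p ^ (2*m+1) * n) - Cc (int p ^ (2*m+1)) * fls_nth gf n \<in> intmult (int p ^ (6*m+3))"
proof -
  define y where "y = of_nat p ^ 3 * (if int p dvd n then fls_nth (heckeA p (2*m)) (n div int p) else 0)"
  have "fls_nth (heckeA p (2*m)) (n div int p) \<in> intmult (int p ^ (3 * (2 * m)))" by (intro heckeA_even) simp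
  hence "y \<in> intmult (int p ^ (3 + 3 * (2 * m)))" unfolding y_def by (intro p3_intmult) auto
  moreover have "fls_nth (heckeA p (2*m+1)) n = Cc (int p ^ (2*m+1) * n) + y"
    using heckeA_Suc_nth[of "2*m" n] by (simp add: y_def)
  moreover have "fls_nth (heckeA p (2*m+1)) n - Cc (int p ^ (2*m+1)) * fls_nth gf n \<in> intmult (int p ^ (3 * (2*m+1)))"
    by (rule heckeA_congruence)
  moreover have e: "3 * (2 * m + 1) = 6 * m + 3" "3 + 3 * (2 * m) = 6 * m + 3" by simp_all
  ultimately have "Cc (int p ^ (2*m+1) * n) + y - Cc (int p ^ (2*m+1)) * fls_nth gf n \<in> intmult (int p ^ (6*m+3))"
    "y \<in> intmult (int p ^ (6*m+3))" by (simp_all only:)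
  from intmult_diff[OF this] show ?thesis by simp
qed

text \<open>This is the coefficient of q^p in G | T(p^(2m+2)), a series that vanishes as a whole
  modulo p^(6m+6). The two terms come from \<open>heckeA_Suc_nth\<close> and
  \<open>heckeA_1\<close>.\<close>

theorem Cc_recurrence:
  "Cc (int p ^ (2*m+3)) + of_nat p ^ 3 * Cc (int p ^ (2*m+1)) \<in> intmult (int p ^ (6*m+6))"
proof -
  have "fls_nth (heckeA p (2*m+2)) (int p) = Cc (int p ^ Suc (2*m+1) * int p) + of_nat p ^ 3 * fls_nth (heckeA p (2*m+1)) 1"
    using heckeA_Suc_nth[of "2*m+1" "int p"] p_gt_1 by simp
  also have "int p ^ Suc (2*m+1) * int p = int p ^ (2*m+3)" by (simp add: eval_nat_numeral)
  finally have "Cc (int p ^ (2*m+3)) + of_nat p ^ 3 * Cc (int p ^ (2*m+1)) = fls_nth (heckeA p (2*m+2)) (int p)"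
    by (simp only: heckeA_1)
  also have "\<dots> \<in> intmult (int p ^ (3 * (2*m+2)))" by (rule heckeA_even) simp
  finally show ?thesis by (simp add: algebra_simps)
qed

end

section \<open>The hypergeometric parametrization\<close>

lemma ftheta_add: "ftheta (F + H) = ftheta F + ftheta H"
  and ftheta_diff: "ftheta (F - H) = ftheta F - ftheta H"
  and ftheta_uminus: "ftheta (- F) = - ftheta F"
  and ftheta_mult: "ftheta (F * H) = ftheta F * H + F * ftheta H"
  by (simp_all add: ftheta_def algebra_simps)

lemma ftheta_inverse:
  assumes "F \<noteq> 0"
  shows "ftheta (inverse F) = - ftheta F / F\<^sup>2"
proof -
  have "ftheta (F * inverse F) = 0" using assms by (simp add: ftheta_def)
  thus ?thesis using assms unfolding ftheta_mult
    by (simp add: field_simps power2_eq_square add_eq_0_iff2)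
qed

lemma ftheta_eq_0_imp_const:
  assumes "ftheta F = 0"
  shows "F = fls_const (fls_nth F 0)"
proof (rule fls_eqI)
  fix n
  have "of_int n * fls_nth F n = 0" using assms by (metis ftheta_nth fls_zero_nth)
  thus "fls_nth F n = fls_nth (fls_const (fls_nth F 0)) n" by auto
qed

lemma ftheta_compose:
  assumes "fps_nth U 0 = 0"
  shows "ftheta (fps_to_fls (F oo U)) = fps_to_fls (fps_deriv F oo U) * ftheta (fps_to_fls U)"
  unfolding ftheta_def fls_deriv_fps_to_fls fps_compose_deriv[OF assms]
  by (simp add: fls_times_fps_to_fls mult_ac)

text \<open>(3n)! / n!^3 as a product of binomial coefficients, so that it is a natural number by
  construction.\<close>

definition trin :: "nat \<Rightarrow> nat" where "trin n = ((3 * n) choose n) * ((2 * n) choose n)"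

lemma trin_fact: "trin n * fact n ^ 3 = fact (3 * n)"
proof -
  have "fact n * fact (3 * n - n) * ((3 * n) choose n) = (fact (3 * n) :: nat)"
    by (rule binomial_fact_lemma) simp
  moreover have "fact n * fact (2 * n - n) * ((2 * n) choose n) = (fact (2 * n) :: nat)"
    by (rule binomial_fact_lemma) simp
  moreover have "3 * n - n = 2 * n" "2 * n - n = n" by simp_all
  ultimately have "fact (3 * n) = fact n * (fact n * fact n * ((2 * n) choose n)) * ((3 * n) choose n)" by (simp only:)
  thus ?thesis unfolding trin_def power3_eq_cube by (simp only: mult_ac)
qed

lemma trin_rec: "(n + 1)\<^sup>2 * trin (n + 1) = 3 * (3 * n + 1) * (3 * n + 2) * trin n"
proof -
  have "trin (n + 1) * (fact n ^ 3 * (n + 1) ^ 3) = trin (n + 1) * fact (n + 1) ^ 3"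
  proof -
    have "fact (n + 1) = fact n * (n + 1 :: nat)" by simp
    thus ?thesis by (simp only: power_mult_distrib)
  qed
  also have "\<dots> = fact (3 * n + 3)" unfolding trin_fact by (simp add: algebra_simps)
  also have "\<dots> = (3 * n + 3) * (3 * n + 2) * (3 * n + 1) * fact (3 * n)"
    by (simp add: eval_nat_numeral algebra_simps)
  also have "\<dots> = (3 * n + 3) * (3 * n + 2) * (3 * n + 1) * (trin n * fact n ^ 3)" by (simp only: trin_fact)
  finally have "(fact n ^ 3 * (n + 1)) * ((n + 1)\<^sup>2 * trin (n + 1)) = (fact n ^ 3 * (n + 1)) * (3 * (3 * n + 1) * (3 * n + 2) * trin n)"
    by (simp add: power2_eq_square power3_eq_cube algebra_simps)
  thus ?thesis by (subst (asm) mult_cancel_left) simp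
qed

text \<open>The hypergeometric series \<open>\<^sub>2F\<^sub>1(1/3, 2/3; 1; 27 X\<^sup>3)\<close>.\<close>

definition hyp :: "complex fps" where
  "hyp = Abs_fps (\<lambda>m. if 3 dvd m then of_nat (trin (m div 3)) else 0)"

lemma hyp_0 [simp]: "fps_nth hyp 0 = 1"
  by (simp add: hyp_def trin_def)

lemma hyp_Ints: "fps_nth hyp m \<in> \<int>"
  by (simp add: hyp_def)

lemma hyp_rec:
  "of_nat m ^ 2 * fps_nth hyp m = (if m \<ge> 3 then 27 * of_nat (m - 1) * of_nat (m - 2) * fps_nth hyp (m - 3) else 0)"
proof (cases "3 dvd m \<and> m \<noteq> 0")
  case True
  then obtain k where k: "m = 3 * k" "k > 0" by auto
  then obtain n where m: "m = 3 * (n + 1)" by (metis Suc_eq_plus1 gr0_implies_Suc)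
  have "of_nat m ^ 2 * fps_nth hyp m = 9 * of_nat ((n + 1)\<^sup>2 * trin (n + 1))"
    by (simp add: m hyp_def power2_eq_square algebra_simps)
  also have "\<dots> = 27 * of_nat (3 * n + 2) * of_nat (3 * n + 1) * of_nat (trin n)"
    unfolding trin_rec by (simp add: algebra_simps)
  also have "of_nat (trin n) = fps_nth hyp (m - 3)" by (simp add: m hyp_def)
  finally have "of_nat m ^ 2 * fps_nth hyp m = 27 * of_nat (3 * n + 2) * of_nat (3 * n + 1) * fps_nth hyp (m - 3)" .
  moreover have "3 * n + 2 = m - 1" "3 * n + 1 = m - 2" "m \<ge> 3" by (simp_all add: m)
  ultimately show ?thesis by (simp only: if_True)
next
  case False
  hence "m = 0 \<or> \<not> 3 dvd m" by auto
  moreover have "\<not> 3 dvd m \<Longrightarrow> m \<ge> 3 \<Longrightarrow> \<not> 3 dvd (m - 3)" by presburger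
  ultimately show ?thesis by (auto simp: hyp_def)
qed

text \<open>
  With \<open>u = 1 / L\<close> and \<open>v = L\<^sup>3 - 27\<close>, \<open>Psi (u) = - (v / L) d/dL Phi (u)\<close>, and the equation below reads
  \<open>d/dL (v d/dL Phi (u)) = - L Phi (u)\<close>.
\<close>

definition Phi :: "complex fps" where "Phi = fps_X * hyp"
definition Psi :: "complex fps" where "Psi = (1 - 27 * fps_X ^ 3) * fps_deriv Phi"

lemma Phi_ode: "fps_X * Psi - fps_X\<^sup>2 * fps_deriv Psi = Phi"
proof (rule fps_ext)
  fix n
  have P: "fps_nth (fps_deriv Phi) k = of_nat (k + 1) * fps_nth hyp k" for k
    by (simp add: Phi_def algebra_simps)
  have Psi: "fps_nth Psi k = of_nat (k + 1) * fps_nth hyp k - (if k \<ge> 3 then 27 * of_nat (k - 2) * fps_nth hyp (k - 3) else 0)" for k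
  proof -
    have "Psi = fps_deriv Phi - 27 * (fps_X ^ 3 * fps_deriv Phi)" by (simp add: Psi_def algebra_simps)
    hence "fps_nth Psi k = fps_nth (fps_deriv Phi - 27 * (fps_X ^ 3 * fps_deriv Phi)) k" by (rule arg_cong)
    also have "\<dots> = of_nat (k + 1) * fps_nth hyp k - 27 * (if k < 3 then 0 else of_nat (k - 3 + 1) * fps_nth hyp (k - 3))"
      by (simp only: P fps_sub_nth fps_mult_numeral_left fps_X_power_mult_nth)
    finally have "fps_nth Psi k = of_nat (k + 1) * fps_nth hyp k - 27 * (if k < 3 then 0 else of_nat (k - 3 + 1) * fps_nth hyp (k - 3))" .
    moreover have "k \<ge> 3 \<Longrightarrow> k - 3 + 1 = k - 2" by simp
    ultimately show ?thesis by (cases "k \<ge> 3") (simp_all only: if_True if_False not_less mult_zero_right mult.assoc, simp_all add: not_le)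
  qed
  show "fps_nth (fps_X * Psi - fps_X\<^sup>2 * fps_deriv Psi) n = fps_nth Phi n"
  proof (cases n)
    case (Suc m)
    have "fps_nth (fps_X * Psi - fps_X\<^sup>2 * fps_deriv Psi) n = (1 - of_nat m) * fps_nth Psi m"
    proof (cases m)
      case (Suc k)
      thus ?thesis using \<open>n = Suc m\<close> by (simp add: fps_X_power_mult_nth) (simp add: algebra_simps)
    qed (use Suc in \<open>simp add: fps_X_power_mult_nth\<close>)
    also have "\<dots> = fps_nth hyp m"
      using hyp_rec[of m] unfolding Psi
      by (cases "m \<ge> 3") (simp_all add: of_nat_diff power2_eq_square algebra_simps)
    finally show ?thesis using Suc by (simp add: Phi_def)
  qed (simp add: Phi_def)
qed

definition ufps :: "complex fps" where "ufps = fps_X * inverse lfps"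

lemma ufps_coeffs: "fps_nth ufps 0 = 0" "fps_nth ufps (Suc 0) = 1"
  by (simp_all add: ufps_def lfps_coeffs)

lemma ufps_lf: "fps_to_fls ufps = inverse lf"
proof -
  have "lf * fps_to_fls ufps = fls_X_inv * fls_X * fps_to_fls (lfps * inverse lfps)"
    by (simp add: lf_lfps ufps_def fls_times_fps_to_fls mult_ac)
  also have "lfps * inverse lfps = 1" using lfps_coeffs by (subst mult.commute) (intro inverse_mult_eq_1, simp)
  also have "fls_X_inv * fls_X = (1 :: complex fls)" by (simp add: fls_X_inv_times_conv_shift)
  finally show ?thesis using inverse_unique by fastforce
qed

lemma int_fps_ufps: "int_fps ufps"
proof -
  have "int_fps (fps_X :: complex fps)" by (auto simp: int_fps_def)
  thus ?thesis unfolding ufps_def by (intro int_fps_mult int_fps_inverse int_fps_lfps lfps_coeffs)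
qed

text \<open>
  Both \<open>1 / ff\<close> and \<open>Phi (1 / lf)\<close> solve the equation \<open>d/dL (v d\<kappa>/dL) = - L \<kappa>\<close> with \<open>v = L\<^sup>3 - 27\<close>, and their
  Wronskian vanishes because its constant term does.
\<close>

lemma ff_eq: "inverse ff = fps_to_fls (Phi oo ufps)"
proof -
  define k where "k = inverse ff"
  define K where "K = fps_to_fls (Phi oo ufps)"
  define P where "P = fps_to_fls (Psi oo ufps)"
  define v where "v = lf ^ 3 - 27"
  have ff0: "ff \<noteq> 0" using ff_m1 by auto
  have k0: "k \<noteq> 0" using ff0 by (simp add: k_def)
  have bk: "bf = - k * ftheta lf" using nz_fls by (simp add: k_def ff_def field_simps)
  \<comment> \<open>With \<open>bf = - k * ftheta lf\<close> the cubic identity contains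
    \<open>ftheta lf ^ 2\<close> on both sides; what remains expresses q dL/dq by L and
    \<open>k\<close>.\<close>
  have vk: "ftheta lf = - v * k\<^sup>2"
  proof -
    have "ftheta lf ^ 3 = (- v * k\<^sup>2) * ftheta lf ^ 2"
      unfolding ftheta_lf_cube v_def[symmetric] bk by (simp add: power_mult_distrib)
    hence "ftheta lf * ftheta lf ^ 2 = (- v * k\<^sup>2) * ftheta lf ^ 2"
      by (simp only: power3_eq_cube power2_eq_square mult.assoc)
    moreover have "ftheta lf ^ 2 \<noteq> 0" using nz_fls by simp
    ultimately show ?thesis by (simp only: mult_cancel_right) simp
  qed
  have tff: "ftheta ff = - ftheta k / k\<^sup>2"
    using ftheta_inverse[OF k0] by (simp add: k_def)
  have t2ff: "ftheta (ftheta ff) = - k * ftheta lf * lf" unfolding ftheta_ftheta_ff bk by simp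
  have tu: "ftheta (fps_to_fls ufps) = - ftheta lf / lf\<^sup>2"
    unfolding ufps_lf by (rule ftheta_inverse) (rule nz_fls)
  have Pv: "P = (1 - 27 / lf ^ 3) * fps_to_fls (fps_deriv Phi oo ufps)"
  proof -
    have "Psi oo ufps = (1 - 27 * ufps ^ 3) * (fps_deriv Phi oo ufps)"
      unfolding Psi_def by (simp add: fps_compose_mult_distrib ufps_coeffs fps_compose_sub_distrib fps_compose_power[symmetric])
    thus ?thesis by (simp add: P_def fls_times_fps_to_fls fps_to_fls_power ufps_lf power_inverse divide_inverse)
  qed
  have tK: "ftheta K = fps_to_fls (fps_deriv Phi oo ufps) * (- ftheta lf / lf\<^sup>2)"
    unfolding K_def ftheta_compose[OF ufps_coeffs(1)] tu ..
  \<comment> \<open>This is v times the derivative of \<open>K\<close> with respect to L, as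
    \<open>WK\<close> shows.\<close>
  define W where "W = - lf * P"
  have WK: "W * ftheta lf = v * ftheta K"
    unfolding W_def tK Pv v_def using nz_fls by (simp add: field_simps power2_eq_square power3_eq_cube)
  have ode: "P / lf - fps_to_fls (fps_deriv Psi oo ufps) / lf\<^sup>2 = K"
  proof -
    have "(fps_X * Psi - fps_X\<^sup>2 * fps_deriv Psi) oo ufps = ufps * (Psi oo ufps) - ufps\<^sup>2 * (fps_deriv Psi oo ufps)"
      by (simp add: fps_compose_mult_distrib ufps_coeffs fps_compose_sub_distrib fps_compose_power[symmetric])
    hence "K = inverse lf * P - (inverse lf)\<^sup>2 * fps_to_fls (fps_deriv Psi oo ufps)"
      unfolding Phi_ode K_def P_def ufps_lf[symmetric] by (simp add: fls_times_fps_to_fls fps_to_fls_power)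
    thus ?thesis by (simp add: divide_inverse power_inverse mult_ac)
  qed
  have tP: "ftheta P = fps_to_fls (fps_deriv Psi oo ufps) * (- ftheta lf / lf\<^sup>2)"
    unfolding P_def ftheta_compose[OF ufps_coeffs(1)] tu ..
  have tW: "ftheta W = - ftheta lf * lf * K"
    unfolding W_def ftheta_mult ftheta_uminus tP ode[symmetric] using nz_fls
    by (simp add: field_simps power2_eq_square)
  \<comment> \<open>The Wronskian times v: by \<open>vk\<close>, \<open>ftheta ff\<close> is v
    dk/dL, just as \<open>W\<close> is v dK/dL.\<close>
  define Om where "Om = k * W - K * ftheta ff"
  have W: "W = - ftheta K / k\<^sup>2"
  proof -
    have "W * (- v * k\<^sup>2) = v * ftheta K" using WK unfolding vk .
    hence "v * (W * k\<^sup>2) = v * (- ftheta K)" by (simp add: mult_ac minus_equation_iff eq_commute)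
    moreover have "v \<noteq> 0" using vk nz_fls by auto
    ultimately have "W * k\<^sup>2 = - ftheta K" by (simp only: mult_cancel_left) simp
    thus ?thesis using k0 by (simp add: field_simps)
  qed
  have "ftheta Om = 0"
  proof -
    have "ftheta Om = (ftheta k * W - ftheta K * ftheta ff) + (k * ftheta W - K * ftheta (ftheta ff))"
      by (simp add: Om_def ftheta_diff ftheta_mult)
    also have "ftheta k * W - ftheta K * ftheta ff = 0" unfolding W tff by simp
    also have "k * ftheta W - K * ftheta (ftheta ff) = 0" unfolding tW t2ff by simp
    finally show ?thesis by simp
  qed
  hence Om: "Om = fls_const (fls_nth Om 0)" by (rule ftheta_eq_0_imp_const)
  have monic: "fls_subdegree (F * H) = m + n \<and> fls_nth (F * H) (m + n) = 1"
    if "fls_subdegree F = m \<and> fls_nth F m = 1" "fls_subdegree H = n \<and> fls_nth H n = 1" for F H :: "complex fls" and m n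
  proof -
    have "F \<noteq> 0" "H \<noteq> 0" using that by auto
    thus ?thesis using that fls_times_base[of F H] by simp
  qed
  have mk: "fls_subdegree k = 1 \<and> fls_nth k 1 = 1"
    using fls_inverse_base2[of ff] by (simp add: k_def subdegree_ff ff_m1)
  have ml: "fls_subdegree lf = -1 \<and> fls_nth lf (-1) = 1"
    by (simp add: subdegree_lf lf_nth lfps_coeffs)
  have mP: "fls_subdegree P = 0 \<and> fls_nth P 0 = 1"
  proof
    have "fps_nth (Psi oo ufps) 0 = 1" by (simp add: Psi_def Phi_def)
    thus "fls_nth P 0 = 1" by (simp add: P_def)
    thus "fls_subdegree P = 0" by (intro fls_subdegree_eqI) (auto simp: P_def)
  qed
  have mK: "fls_subdegree K = 1 \<and> fls_nth K 1 = 1"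
  proof
    have "fps_nth (Phi oo ufps) (Suc 0) = 1"
      by (simp add: fps_compose_nth Phi_def ufps_coeffs atLeastAtMostSuc_conv)
    thus 1: "fls_nth K 1 = 1" by (simp add: K_def)
    have "fls_nth K 0 = 0" by (simp add: K_def Phi_def)
    thus "fls_subdegree K = 1" using 1
      by (intro fls_subdegree_eqI) (auto simp: K_def less_le_trans intro: antisym)
  qed
  have mt: "fls_subdegree (- ftheta ff) = -1 \<and> fls_nth (- ftheta ff) (-1) = 1"
  proof
    show 1: "fls_nth (- ftheta ff) (-1) = 1" by (simp add: ff_m1)
    show "fls_subdegree (- ftheta ff) = -1"
      by (rule fls_subdegree_eqI) (use 1 subdegree_ff in auto)
  qed
  \<comment> \<open>Both products have leading term 1 at exponent 0, so the constant terms
    cancel.\<close>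
  have "Om = K * (- ftheta ff) - k * lf * P" by (simp add: Om_def W_def)
  hence "fls_nth Om 0 = 0"
    using monic[OF monic[OF mk ml] mP] monic[OF mK mt] by simp
  hence "k * W = K * ftheta ff" using Om by (simp add: Om_def)
  hence "ftheta K * k = K * ftheta k"
    unfolding W tff using k0 by (simp add: field_simps power2_eq_square)
  hence "ftheta (K * inverse k) = 0"
    unfolding ftheta_mult ftheta_inverse[OF k0] using k0 by (simp add: field_simps power2_eq_square)
  then obtain c where "K * inverse k = fls_const c" using ftheta_eq_0_imp_const by blast
  hence Kc: "K = fls_const c * k" using k0 by (simp add: field_simps)
  hence "c = 1" using mK mk by simp
  thus ?thesis using Kc by (simp add: k_def K_def)
qed

definition hyp2 :: "complex fps" where "hyp2 = hyp * hyp"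

lemma hyp2_Ints: "fps_nth hyp2 n \<in> \<int>"
  using hyp_Ints by (auto simp: hyp2_def fps_mult_nth intro!: Ints_sum Ints_mult)

text \<open>In the coordinate u = 1/L this reads G dq/q = F(u)^2 du/u^2 with F =
  \<open>hyp\<close>.\<close>

lemma gf_lf2_eq: "gf * lf ^ 2 = - ftheta lf * fps_to_fls (hyp2 oo ufps)"
proof -
  define k where "k = inverse ff"
  have "bf = - k * ftheta lf" using nz_fls by (simp add: k_def ff_def field_simps)
  hence "gf * ftheta lf = - (- k * ftheta lf)\<^sup>2" using gf_ftheta_lf by (simp only:)
  also have "\<dots> = (- k\<^sup>2 * ftheta lf) * ftheta lf" by (simp add: power2_eq_square)
  finally have "gf * ftheta lf = (- k\<^sup>2 * ftheta lf) * ftheta lf" .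
  moreover have "ftheta lf \<noteq> 0" using nz_fls by simp
  ultimately have "gf = - k\<^sup>2 * ftheta lf" by (simp only: mult_cancel_right) simp
  moreover have "k * lf = fps_to_fls (hyp oo ufps)"
  proof -
    have "k = inverse lf * fps_to_fls (hyp oo ufps)"
      unfolding k_def ff_eq Phi_def ufps_lf[symmetric]
      by (simp add: fps_compose_mult_distrib ufps_coeffs fls_times_fps_to_fls)
    thus ?thesis using nz_fls by simp
  qed
  moreover have "fps_to_fls (hyp2 oo ufps) = fps_to_fls (hyp oo ufps) ^ 2"
    by (simp add: hyp2_def fps_compose_mult_distrib ufps_coeffs fls_times_fps_to_fls power2_eq_square)
  moreover have "- k\<^sup>2 * ftheta lf * lf\<^sup>2 = - ftheta lf * (k * lf) ^ 2" by (simp add: power_mult_distrib mult_ac)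
  ultimately show ?thesis by (simp only:)
qed

text \<open>The differential F(u)^2 du/u^2 is integrated: the constant term of \<open>hyp2\<close>
  gives \<open>- ftheta lf\<close>, the linear coefficient is 0 so that no logarithm appears, and
  the rest is q d/dq of a power series in u. The factor n in front comes from q d/dq.\<close>

lemma Cc_expansion:
  assumes "n > 0"
  shows "Cc (int n) = - of_nat n * fls_nth lf (int n) +
     of_nat n * (\<Sum>m=1..n. fps_nth hyp2 (m + 1) / of_nat m * fps_nth (ufps ^ m) n)"
proof -
  define H where "H = fps_shift 2 (hyp2 - 1)"
  have "fps_nth hyp2 0 = 1" "fps_nth hyp2 1 = 0" by (simp_all add: hyp2_def fps_mult_nth hyp_def trin_def)
  note h01 = this
  have "hyp2 = 1 + fps_X ^ 2 * H"
  proof (rule fps_ext)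
    fix n show "fps_nth hyp2 n = fps_nth (1 + fps_X ^ 2 * H) n"
    proof (cases "n < 2")
      case True
      thus ?thesis using h01 by (auto simp: fps_X_power_mult_nth less_2_cases_iff)
    next
      case False
      then obtain m where "n = m + 2" by (metis add.commute le_Suc_ex not_less)
      thus ?thesis by (simp add: H_def fps_X_power_mult_nth)
    qed
  qed
  hence "hyp2 oo ufps = (1 + fps_X ^ 2 * H) oo ufps" by (rule arg_cong)
  also have "\<dots> = 1 + ufps ^ 2 * (H oo ufps)"
    by (simp add: fps_compose_add_distrib fps_compose_mult_distrib ufps_coeffs fps_compose_power[symmetric])
  finally have e: "fps_to_fls (hyp2 oo ufps) = 1 + (inverse lf)\<^sup>2 * fps_to_fls (H oo ufps)"
    by (simp add: fls_times_fps_to_fls fps_to_fls_power ufps_lf)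
  define J where "J = fps_integral0 H"
  have dJ: "fps_deriv J = H" by (simp add: J_def fps_deriv_fps_integral)
  have "gf * lf ^ 2 = - ftheta lf + fps_to_fls (H oo ufps) * (- ftheta lf / lf\<^sup>2)"
    unfolding gf_lf2_eq e by (simp add: algebra_simps power_inverse divide_inverse)
  also have "- ftheta lf / lf\<^sup>2 = ftheta (fps_to_fls ufps)"
    unfolding ufps_lf by (rule ftheta_inverse[symmetric]) (rule nz_fls)
  also have "fps_to_fls (H oo ufps) * \<dots> = ftheta (fps_to_fls (J oo ufps))"
    unfolding ftheta_compose[OF ufps_coeffs(1)] dJ ..
  finally have "Cc (int n) = - of_nat n * fls_nth lf (int n) + of_nat n * fps_nth (J oo ufps) n"
    by (simp add: Cc_def)
  also have "fps_nth (J oo ufps) n = (\<Sum>m=0..n. fps_nth J m * fps_nth (ufps ^ m) n)"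
    by (rule fps_compose_nth)
  also have "\<dots> = (\<Sum>m=1..n. fps_nth J m * fps_nth (ufps ^ m) n)"
    by (simp add: sum.atLeast_Suc_atMost J_def)
  also have "\<dots> = (\<Sum>m=1..n. fps_nth hyp2 (m + 1) / of_nat m * fps_nth (ufps ^ m) n)"
    by (intro sum.cong) (auto simp: J_def H_def fps_integral_def divide_inverse)
  finally show ?thesis .
qed

lemma intmult_cancel:
  assumes p: "prime p" and a: "\<not> p dvd a" and x: "x \<in> \<int>" and ax: "of_int a * x \<in> intmult p"
  shows "x \<in> intmult p"
proof -
  obtain z where z: "x = of_int z" using x by (auto elim: Ints_cases)
  obtain y where "of_int a * x = of_int (p * y)" using ax by (auto simp: intmult_def)
  hence "of_int (a * z) = (of_int (p * y) :: complex)" by (simp add: z)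
  hence "a * z = p * y" by (simp only: of_int_eq_iff)
  hence "p dvd a * z" by simp
  hence "p dvd z" using p a prime_dvd_mult_iff by blast
  thus ?thesis by (auto simp: z intro: intmultI)
qed

context hecke_prime
begin

text \<open>In the expansion of C(p) the factor p survives in the term from L and in every term with
  denominator m < p. What remains is m = p, where p/m is 1 and \<open>ufps ^ p\<close> has
  coefficient 1.\<close>

lemma Cc_p_mod_p: "Cc (int p) - fps_nth hyp2 (p + 1) \<in> intmult (int p)"
proof -
  \<comment> \<open>A common denominator of the terms with m < p, prime to p.\<close>
  define F where "F = (fact (p - 1) :: int)"
  define y where "y = (\<lambda>m. fps_nth hyp2 (m + 1) * fps_nth (ufps ^ m) p)"
  have y: "y m \<in> \<int>" for m unfolding y_def
    using hyp2_Ints int_fps_power[OF int_fps_ufps] by (auto simp: int_fps_def intro: Ints_mult)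
  have "fps_nth (ufps ^ p) p = 1"
    using startsby_zero_power_nth_same[OF ufps_coeffs(1), of p] ufps_coeffs by simp
  hence yp: "y p = fps_nth hyp2 (p + 1)" by (simp add: y_def)
  have "{1..p} = insert p {1..<p}" using p_gt_1 by auto
  hence "Cc (int p) = - of_nat p * fls_nth lf (int p) + of_nat p * (y p / of_nat p + (\<Sum>m\<in>{1..<p}. y m / of_nat m))"
    using p_gt_1 by (simp add: Cc_expansion y_def)
  hence eq: "Cc (int p) - y p = of_nat p * ((\<Sum>m\<in>{1..<p}. y m / of_nat m) - fls_nth lf (int p))"
    using p_gt_1 by (simp add: algebra_simps)
  have "of_int F * (Cc (int p) - y p) = of_nat p * ((\<Sum>m\<in>{1..<p}. of_int F / of_nat m * y m) - of_int F * fls_nth lf (int p))"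
    unfolding eq by (simp add: algebra_simps sum_distrib_left)
  also have "\<dots> \<in> intmult (int p * 1)"
  proof (rule intmult_mult)
    show "of_nat p \<in> intmult (int p)" by (rule intmultI[of _ _ 1]) simp
    have "of_int F / of_nat m \<in> (\<int> :: complex set)" if "m \<in> {1..<p}" for m
    proof -
      have "m dvd fact (p - 1)" using that by (intro dvd_fact) auto
      hence "int m dvd F" unfolding F_def by (metis int_dvd_int_iff of_nat_fact)
      then obtain k where "F = int m * k" by blast
      thus ?thesis using that by simp
    qed
    moreover have "fls_nth lf (int p) \<in> \<int>" using int_fps_lfps by (simp add: lf_nth int_fps_def)
    ultimately show "(\<Sum>m\<in>{1..<p}. of_int F / of_nat m * y m) - of_int F * fls_nth lf (int p) \<in> intmult 1"
      unfolding intmult_1 using y by (intro Ints_diff Ints_sum Ints_mult) auto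
  qed
  finally have *: "of_int F * (Cc (int p) - y p) \<in> intmult (int p)" by simp
  have "\<not> p dvd fact (p - 1)" using prime p_gt_1 by (simp add: prime_dvd_fact_iff)
  hence "\<not> int p dvd int (fact (p - 1))" by (simp only: int_dvd_int_iff not_False_eq_True)
  hence "\<not> int p dvd F" by (simp add: F_def)
  moreover have "Cc (int p) - y p \<in> \<int>" by (intro Ints_diff y Cc_Ints)
  ultimately have "Cc (int p) - y p \<in> intmult (int p)"
    using * by (rule intmult_cancel[OF prime_int, of F])
  thus ?thesis by (simp only: yp)
qed

end

section \<open>The square of the hypergeometric series modulo p\<close>

definition fpsT :: "complex fps \<Rightarrow> complex fps" where "fpsT F = fps_X * fps_deriv F"

lemma fpsT_nth [simp]: "fps_nth (fpsT F) n = of_nat n * fps_nth F n"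
  by (cases n) (simp_all add: fpsT_def)

lemma fpsT_mult: "fpsT (F * H) = fpsT F * H + F * fpsT H"
  and fpsT_add: "fpsT (F + H) = fpsT F + fpsT H"
  and fpsT_diff: "fpsT (F - H) = fpsT F - fpsT H"
  by (simp_all add: fpsT_def algebra_simps)

lemma fpsT_numeral [simp]: "fpsT (numeral n) = 0" and fpsT_1 [simp]: "fpsT 1 = 0"
  by (simp_all add: fpsT_def)

text \<open>The recurrence of the symmetric square of the second-order equation satisfied by \<open>hyp\<close>.\<close>

lemma hyp2_rec:
  assumes "n \<ge> 6"
  shows "of_nat n ^ 3 * fps_nth hyp2 n =
     27 * (2 * of_nat (n - 3) ^ 3 + 9 * of_nat (n - 3) ^ 2 + 17 * of_nat (n - 3) + 12) * fps_nth hyp2 (n - 3)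
     - 729 * of_nat (n - 4) * of_nat (n - 3) * of_nat (n - 2) * fps_nth hyp2 (n - 6)"
proof -
  define c :: "complex fps" where "c = 27 * fps_X ^ 3"
  have c_nth: "fps_nth (c * F) n = (if n < 3 then 0 else 27 * fps_nth F (n - 3))" for F n
    by (simp add: c_def mult.assoc fps_X_power_mult_nth)
  define F1 F2 F3 where "F1 = fpsT hyp" and "F2 = fpsT F1" and "F3 = fpsT F2"
  define E1 E2 E3 where "E1 = fpsT hyp2" and "E2 = fpsT E1" and "E3 = fpsT E2"
  have Tc: "fpsT c = 3 * c"
    by (rule fps_ext) (simp add: c_def fps_X_power_iff)
  have "F2 - c * F2 = 3 * (c * F1) + 2 * (c * hyp)"
  proof (rule fps_ext)
    fix m
    show "fps_nth (F2 - c * F2) m = fps_nth (3 * (c * F1) + 2 * (c * hyp)) m"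
    proof (cases "m \<ge> 3")
      case True
      then obtain j where j: "m = j + 3" by (metis add.commute le_Suc_ex)
      have h: "of_nat (j + 3) ^ 2 * fps_nth hyp (j + 3) = 27 * of_nat (j + 2) * of_nat (j + 1) * fps_nth hyp j"
        using hyp_rec[of "j + 3"] by (simp add: numeral_eq_Suc)
      have "\<not> m < 3" "m - 3 = j" by (simp_all add: j)
      thus ?thesis using h
        by (simp only: fps_add_nth fps_sub_nth fps_mult_numeral_left c_nth if_False F1_def F2_def fpsT_nth)
           (simp add: j power2_eq_square algebra_simps)
    next
      case False
      hence "m < 3" by simp
      thus ?thesis using hyp_rec[of m]
        by (simp only: fps_add_nth fps_sub_nth fps_mult_numeral_left c_nth if_True F1_def F2_def fpsT_nth)
           (simp add: power2_eq_square)
    qed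
  qed
  hence A: "(1 - c) * F2 = 3 * c * F1 + 2 * c * hyp" by (simp add: left_diff_distrib mult.assoc)
  have "fpsT ((1 - c) * F2) = fpsT (3 * c * F1 + 2 * c * hyp)" by (simp only: A)
  hence B: "(1 - c) * F3 = 6 * c * F2 + 11 * c * F1 + 6 * c * hyp"
    by (simp add: fpsT_mult fpsT_add fpsT_diff Tc F1_def[symmetric] F2_def[symmetric] F3_def[symmetric] algebra_simps)
  have E: "E1 = 2 * (hyp * F1)" "E2 = 2 * (F1 * F1) + 2 * (hyp * F2)" "E3 = 6 * (F1 * F2) + 2 * (hyp * F3)"
    by (simp_all add: E1_def E2_def E3_def hyp2_def fpsT_mult fpsT_add F1_def[symmetric] F2_def[symmetric] F3_def[symmetric] algebra_simps)
  have "(1 - c) * E3 = 6 * F1 * ((1 - c) * F2) + 2 * hyp * ((1 - c) * F3)"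
    unfolding E by (simp add: algebra_simps)
  also have "\<dots> = 9 * c * E2 + 17 * c * E1 + 12 * c * hyp2 - 6 * c * hyp * F2"
    unfolding A B E hyp2_def by (simp add: algebra_simps)
  \<comment> \<open>The product \<open>hyp * F2\<close> is not among the derivatives of
    \<open>hyp2\<close>; a second factor \<open>1 - c\<close> allows \<open>A\<close> to eliminate
    it. This is why the recurrence reaches back to n - 6.\<close>
  finally have "(1 - c) * ((1 - c) * E3) = (1 - c) * (9 * c * E2 + 17 * c * E1 + 12 * c * hyp2 - 6 * c * hyp * F2)"
    by (simp only:)
  also have "\<dots> = (1 - c) * (9 * c * E2 + 17 * c * E1 + 12 * c * hyp2) - 6 * c * hyp * ((1 - c) * F2)"
    by (simp add: algebra_simps)
  also have "\<dots> = (1 - c) * (9 * c * E2 + 17 * c * E1 + 12 * c * hyp2) - 9 * c * c * E1 - 12 * c * c * hyp2"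
    unfolding A by (simp add: E hyp2_def algebra_simps)
  finally have "E3 - 2 * (c * E3) + c * (c * E3) = 9 * (c * E2) + 17 * (c * E1) + 12 * (c * hyp2)
     - 9 * (c * (c * E2)) - 26 * (c * (c * E1)) - 24 * (c * (c * hyp2))"
    by (simp add: algebra_simps)
  hence eq: "fps_nth (E3 - 2 * (c * E3) + c * (c * E3)) n = fps_nth (9 * (c * E2) + 17 * (c * E1) + 12 * (c * hyp2)
     - 9 * (c * (c * E2)) - 26 * (c * (c * E1)) - 24 * (c * (c * hyp2))) n" by simp
  obtain j where j: "n = j + 6" using assms by (metis add.commute le_Suc_ex)
  have n: "n - 3 = j + 3" "n - 6 = j" "n - 3 - 3 = j" "n - 4 = j + 2" "n - 2 = j + 4" "\<not> n < 3" "\<not> n - 3 < 3"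
    using j by auto
  show ?thesis using eq
    by (simp only: fps_add_nth fps_sub_nth fps_mult_numeral_left c_nth n if_False E1_def E2_def E3_def fpsT_nth)
       (simp add: j power2_eq_square power3_eq_cube algebra_simps)
qed

context hecke_prime
begin

text \<open>For j = 3 i the prime divides (3i)! but not i!^3. The index p - 1 causes no trouble,
  being 1 modulo 3.\<close>

lemma hyp_dvd:
  assumes "p - 2 < j" "j < 2 * p"
  shows "fps_nth hyp j \<in> intmult (int p)"
proof (cases "3 dvd j")
  case True
  then obtain i where i: "j = 3 * i" by blast
  have "j \<ge> p" using assms(1) True mod3 p_gt_1 by presburger
  hence "p dvd fact j" by (simp add: prime_dvd_fact_iff prime)
  hence "p dvd trin i * fact i ^ 3" unfolding trin_fact i .
  moreover have "i < p" using assms(2) i by simp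
  hence "\<not> p dvd fact i ^ 3" using prime by (simp add: prime_dvd_power_iff prime_dvd_fact_iff)
  ultimately have "p dvd trin i" using prime prime_dvd_mult_iff by blast
  then obtain z where "trin i = p * z" by blast
  thus ?thesis by (intro intmultI[of _ _ "int z"]) (simp add: hyp_def i)
qed (simp add: hyp_def)

text \<open>Starting from p + 1, the recurrence moves upwards in steps of 3 to 2 (p - 2). All
  indices lie strictly between p and 2 p, so the leading factor n^3 can be cancelled modulo
  p.\<close>

lemma hyp2_not_dvd:
  assumes "p \<noteq> 2"
  shows "fps_nth hyp2 (p + 1) \<notin> intmult (int p)"
proof
  assume zero: "fps_nth hyp2 (p + 1) \<in> intmult (int p)"
  have p5: "p \<ge> 5" using assms mod3 p_gt_1 by presburger
  define k where "k = (p - 2) div 3"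
  have k: "p = 3 * k + 2" "k \<ge> 1" using mod3 p5 unfolding k_def by presburger+
  have int: "of_nat m \<in> \<int>" for m by simp
  have chain: "fps_nth hyp2 (p + 1 + 3 * i) \<in> intmult (int p)" if "i < k" for i
    using that
  proof (induction i rule: less_induct)
    case (less i)
    show ?case
    proof (cases "i = 0")
      case False
      define n where "n = p + 1 + 3 * i"
      have n: "n \<ge> 6" "n < 2 * p" "n > p" using False less.prems k p5 by (auto simp: n_def)
      have n3: "n - 3 = p + 1 + 3 * (i - 1)" using False by (simp add: n_def)
      have I1: "fps_nth hyp2 (n - 3) \<in> intmult (int p)"
        unfolding n3 using False less by (intro less.IH) auto
      \<comment> \<open>In the first step the index n - 6 is p - 2, outside the chain, but its
        factor n - 4 equals p.\<close>
      have I2: "of_nat (n - 4) * fps_nth hyp2 (n - 6) \<in> intmult (int p)"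
      proof (cases "i = 1")
        case True
        hence "n - 4 = p" by (simp add: n_def)
        moreover have "(of_nat p :: complex) \<in> intmult (int p)" by (rule intmultI[of _ _ 1]) simp
        ultimately show ?thesis by (simp add: intmult_Ints hyp2_Ints)
      next
        case i1: False
        have "n - 6 = p + 1 + 3 * (i - 2)" using False i1 by (simp add: n_def)
        hence "fps_nth hyp2 (n - 6) \<in> intmult (int p)" using False i1 less by (simp only: less.IH)
        from intmult_Ints[OF this, of "of_nat (n - 4)"] show ?thesis by (simp add: mult.commute)
      qed
      have "of_nat n ^ 3 * fps_nth hyp2 n = fps_nth hyp2 (n - 3) *
          (27 * (2 * of_nat (n - 3) ^ 3 + 9 * of_nat (n - 3) ^ 2 + 17 * of_nat (n - 3) + 12))
         - (of_nat (n - 4) * fps_nth hyp2 (n - 6)) * (729 * of_nat (n - 3) * of_nat (n - 2))"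
        unfolding hyp2_rec[OF n(1)] by (simp only: mult_ac)
      also have "\<dots> \<in> intmult (int p)"
        by (intro intmult_diff intmult_Ints I1 I2 Ints_mult Ints_add Ints_power Ints_of_nat Ints_numeral)
      finally have "of_int (int n ^ 3) * fps_nth hyp2 n \<in> intmult (int p)" by simp
      moreover have "\<not> p dvd n"
        using n nat_dvd_not_less[of "n - p" p] dvd_diff_nat[of p n p] by auto
      hence "\<not> int p dvd int n ^ 3" using prime_int by (simp add: prime_dvd_power_iff)
      ultimately show ?thesis unfolding n_def[symmetric]
        by (intro intmult_cancel[OF prime_int _ hyp2_Ints])
    qed (use zero in simp)
  qed
  have "p + 1 + 3 * (k - 1) = 2 * (p - 2)" "k - 1 < k" using k by simp_all
  hence "fps_nth hyp2 (2 * (p - 2)) \<in> intmult (int p)" using chain[of "k - 1"] by (simp only:)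
  \<comment> \<open>In the convolution one of two different indices exceeds p - 2, where
    \<open>hyp_dvd\<close> applies; the diagonal term remains.\<close>
  moreover have "fps_nth hyp2 (2 * (p - 2)) = fps_nth hyp (p - 2) ^ 2 +
      (\<Sum>i\<in>{0..2 * (p - 2)} - {p - 2}. fps_nth hyp i * fps_nth hyp (2 * (p - 2) - i))"
    unfolding hyp2_def fps_mult_nth by (subst sum.remove[of _ "p - 2"]) (auto simp: power2_eq_square)
  moreover have "(\<Sum>i\<in>{0..2 * (p - 2)} - {p - 2}. fps_nth hyp i * fps_nth hyp (2 * (p - 2) - i)) \<in> intmult (int p)"
  proof (rule intmult_sum)
    fix i assume i: "i \<in> {0..2 * (p - 2)} - {p - 2}"
    show "fps_nth hyp i * fps_nth hyp (2 * (p - 2) - i) \<in> intmult (int p)"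
    proof (cases "p - 2 < i")
      case True
      thus ?thesis using i p5 by (intro intmult_Ints hyp_dvd hyp_Ints) auto
    next
      case False
      hence "fps_nth hyp (2 * (p - 2) - i) * fps_nth hyp i \<in> intmult (int p)"
        using i p5 by (intro intmult_Ints hyp_dvd hyp_Ints) auto
      thus ?thesis by (simp add: mult.commute)
    qed
  qed
  ultimately have "fps_nth hyp (p - 2) ^ 2 \<in> intmult (int p)" using intmult_diff by fastforce
  moreover have "fps_nth hyp (p - 2) = of_nat (trin k)" using k by (simp add: hyp_def)
  ultimately obtain z where "(of_nat (trin k))\<^sup>2 = (of_int (int p * z) :: complex)" by (auto simp: intmult_def)
  hence "of_int ((int (trin k))\<^sup>2) = (of_int (int p * z) :: complex)" by simp
  hence "(int (trin k))\<^sup>2 = int p * z" by (simp only: of_int_eq_iff)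
  hence "int p dvd (int (trin k))\<^sup>2" by simp
  hence "p dvd trin k" using prime_int by (simp add: prime_dvd_power_iff)
  hence "p dvd fact (3 * k)" unfolding trin_fact[symmetric] by simp
  thus False using prime k by (simp add: prime_dvd_fact_iff)
qed

lemma Cc_p_not_dvd: "p \<noteq> 2 \<Longrightarrow> Cc (int p) \<notin> intmult (int p)"
  using Cc_p_mod_p hyp2_not_dvd intmult_diff[of "Cc (int p)" "int p" "Cc (int p) - fps_nth hyp2 (p + 1)"] by auto

end

section \<open>Rational coefficients and valuations\<close>

lemma cmap_inverse: "fps_nth F 0 \<noteq> 0 \<Longrightarrow> cmap (inverse F) = inverse (cmap F)"
proof (rule fps_inverse_unique[symmetric])
  assume "fps_nth F 0 \<noteq> 0"
  hence "F * inverse F = 1" by (rule inverse_mult_eq_1')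
  thus "cmap F * cmap (inverse F) = 1" by (simp flip: cmap_mult)
qed

lemma eta_prod_0 [simp]: "fps_nth (eta_prod d) 0 = 1"
  by (simp add: eta_prod_def)

definition lfps_rat :: "rat fps" where
  "lfps_rat = eta_prod 1 ^ 3 * inverse (eta_prod 9 ^ 3) + 3 * fps_X"

lemma cmap_lfps_rat: "cmap lfps_rat = lfps"
proof -
  have "cmap (3 * fps_X) = 3 * fps_X" by (rule fps_ext) (simp add: fps_numeral_nth)
  thus ?thesis
    by (simp add: lfps_rat_def lfps_def psi_fps_def et_def cmap_add cmap_mult cmap_power cmap_inverse fps_power_zeroth)
qed

lemma L1_lfps_rat: "L1 = fls_X_inv * fps_to_fls lfps_rat"
proof -
  have "fls_X_inv * (fps_to_fls (3 * fps_X) :: rat fls) = 3 * (fls_X_inv * fls_X)"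
    by (simp add: fls_times_fps_to_fls mult_ac)
  also have "fls_X_inv * fls_X = (1 :: rat fls)" by (simp add: fls_X_inv_times_conv_shift)
  finally have X: "fls_X_inv * (fps_to_fls (3 * fps_X) :: rat fls) = 3" by simp
  have "inverse (fps_to_fls (eta_prod 9 ^ 3)) = fps_to_fls (inverse (eta_prod 9 ^ 3))"
    by (rule fls_inverse_fps_to_fls) (simp add: subdegree_eq_0 fps_power_zeroth)
  thus ?thesis using X
    by (simp add: L1_def lfps_rat_def distrib_left fls_times_fps_to_fls divide_inverse mult.assoc)
qed

lemma of_rat_g1: "of_rat (fls_nth g1 n) = fls_nth gf n"
  by (simp add: g1_def gf_nth fls_X_times_conv_shift et_def flip: cmap_nth cmap_power)

lemma of_rat_C: "of_rat (C n) = Cc n"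
proof -
  have "G = fls_X * (fls_X_inv ^ 2 * fps_to_fls (eta_prod 3 ^ 8 * lfps_rat ^ 2))"
    by (simp add: G_def g1_def L1_lfps_rat power_mult_distrib fps_to_fls_power fls_times_fps_to_fls mult_ac)
  hence "C n = fls_nth (fls_X * (fls_X_inv ^ 2 * fps_to_fls (eta_prod 3 ^ 8 * lfps_rat ^ 2))) n" by (simp only: C_def)
  also have "\<dots> = (if n < -1 then 0 else fps_nth (eta_prod 3 ^ 8 * lfps_rat ^ 2) (nat (n + 1)))"
    by (simp add: fls_X_times_conv_shift fls_X_inv_power_times_conv_shift)
  finally show ?thesis
    by (simp add: Cc_def gf_lf_nth et_def algebra_simps flip: cmap_nth cmap_power cmap_mult cmap_lfps_rat)
qed

lemma eta_prod_low_coeffs: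
  "fps_nth (eta_prod 1) 1 = -1" "fps_nth (eta_prod 1) 2 = -1" "fps_nth (eta_prod 1) 3 = 0"
  "fps_nth (eta_prod 3) 1 = 0" "fps_nth (eta_prod 3) 2 = 0" "fps_nth (eta_prod 3) 3 = -1"
  "fps_nth (eta_prod 9) 1 = 0" "fps_nth (eta_prod 9) 2 = 0" "fps_nth (eta_prod 9) 3 = 0"
  by (simp_all add: eta_prod_def numeral_2_eq_2 numeral_3_eq_3 atLeastAtMostSuc_conv fps_mult_nth fps_X_power_iff)

text \<open>The initial value for p = 2: the square of q L contributes 10 and the eighth power of
  the eta product -8.\<close>

lemma Cc_2: "Cc 2 = 2"
proof -
  have cube: "fps_nth (f ^ 3) 1 = 3 * fps_nth f 1" "fps_nth (f ^ 3) 2 = 3 * fps_nth f 2 + 3 * fps_nth f 1 ^ 2"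
      "fps_nth (f ^ 3) 3 = 3 * fps_nth f 3 + 6 * fps_nth f 1 * fps_nth f 2 + fps_nth f 1 ^ 3"
    if "fps_nth f 0 = 1" for f :: "complex fps"
    using that by (simp_all add: power3_eq_cube power2_eq_square fps_mult_nth numeral_2_eq_2 numeral_3_eq_3 algebra_simps)
  have nth3: "fps_nth (f * g) 3 = fps_nth f 0 * fps_nth g 3 + fps_nth f 1 * fps_nth g 2 + fps_nth f 2 * fps_nth g 1 + fps_nth f 3 * fps_nth g 0"
    for f g :: "complex fps" by (simp add: fps_mult_nth numeral_2_eq_2 numeral_3_eq_3)
  have nth2: "fps_nth (f * g) 2 = fps_nth f 0 * fps_nth g 2 + fps_nth f 1 * fps_nth g 1 + fps_nth f 2 * fps_nth g 0"
    for f g :: "complex fps" by (simp add: fps_mult_nth numeral_2_eq_2)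
  have nth1: "fps_nth (f * g) 1 = fps_nth f 0 * fps_nth g 1 + fps_nth f 1 * fps_nth g 0"
    for f g :: "complex fps" by (simp add: fps_mult_nth)
  note et = eta_prod_low_coeffs[THEN arg_cong[of _ _ "of_rat :: rat \<Rightarrow> complex"], folded cmap_nth et_def]
  have et1: "fps_nth (et 1 ^ 3) 3 = 5" "fps_nth (et 1 ^ 3) 2 = 0"
    and et9: "fps_nth (et 9 ^ 3) 1 = 0" "fps_nth (et 9 ^ 3) 2 = 0" "fps_nth (et 9 ^ 3) 3 = 0"
    unfolding cube[OF et_0] et by simp_all
  have "psi_fps * et 9 ^ 3 = et 1 ^ 3"
    unfolding psi_fps_def by (simp add: mult.assoc inverse_mult_eq_1 fps_power_zeroth)
  hence "fps_nth (psi_fps * et 9 ^ 3) 3 = 5" "fps_nth (psi_fps * et 9 ^ 3) 2 = 0" by (simp_all only: et1)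
  hence "fps_nth psi_fps 3 = 5" "fps_nth psi_fps 2 = 0"
    unfolding nth3 nth2 et9 by (simp_all add: fps_power_zeroth)
  hence l: "fps_nth lfps 3 = 5" "fps_nth lfps 2 = 0" by (simp_all add: lfps_def fps_numeral_nth)
  have l1: "fps_nth lfps 1 = 0" using lfps_coeffs by simp
  have l2: "fps_nth (lfps ^ 2) 3 = 10"
    unfolding power2_eq_square nth3 l1 l lfps_coeffs by simp
  have e8: "fps_nth (et 3 ^ k) 1 = 0 \<and> fps_nth (et 3 ^ k) 2 = 0 \<and> fps_nth (et 3 ^ k) 3 = - of_nat k" for k
  proof (induction k)
    case (Suc k)
    thus ?case unfolding power_Suc nth1 nth2 nth3 et et_0 by (simp add: fps_power_zeroth)
  qed (simp_all add: fps_one_def)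
  have "Cc 2 = fps_nth (et 3 ^ 8 * lfps ^ 2) 3" by (simp add: Cc_def gf_lf_nth)
  also have "\<dots> = 2"
    unfolding nth3 l2 using e8[of 8] by (simp add: fps_power_zeroth lfps_coeffs)
  finally show ?thesis .
qed

context hecke_prime
begin

text \<open>The second term of the recurrence has valuation 3m + 3, or 3m + 4 for p = 2, strictly
  less than the exponent 6m + 6 of the modulus, so it determines the valuation of
  C(p^(2m+3)).\<close>

lemma Cc_valuation:
  "\<exists>z. Cc (int p ^ (2 * m + 1)) = of_int (int p ^ (3 * m + (if p = 2 then 1 else 0)) * z) \<and> \<not> int p dvd z"
proof (induction m)
  case 0
  show ?case
  proof (cases "p = 2")
    case True
    thus ?thesis using Cc_2 by (intro exI[of _ 1]) simp
  next
    case False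
    obtain z where z: "Cc (int p) = of_int z" using Cc_Ints by (auto elim: Ints_cases)
    have "\<not> int p dvd z"
    proof
      assume "int p dvd z"
      then obtain w where "z = int p * w" by blast
      hence "Cc (int p) \<in> intmult (int p)" using z by (intro intmultI[of _ _ w]) simp
      thus False using Cc_p_not_dvd[OF False] by blast
    qed
    thus ?thesis using z False by (intro exI[of _ z]) simp
  qed
next
  case (Suc m)
  define d :: nat where "d = (if p = 2 then 1 else 0)"
  define P where "P = int p"
  obtain z where z: "Cc (P ^ (2 * m + 1)) = of_int (P ^ (3 * m + d) * z)" "\<not> P dvd z"
    using Suc unfolding d_def P_def by blast
  obtain w where w: "Cc (P ^ (2 * m + 3)) + of_nat p ^ 3 * Cc (P ^ (2 * m + 1)) = of_int (P ^ (6 * m + 6) * w)"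
    using Cc_recurrence[of m] unfolding P_def intmult_def by blast
  \<comment> \<open>The last summand 1 is the strict surplus; the natural subtraction is exact
    because \<open>d\<close> is at most 1.\<close>
  have "6 * m + 6 = (3 * Suc m + d) + (3 * m + 2 - d) + 1" by (simp add: d_def)
  hence e: "P ^ (6 * m + 6) = P ^ (3 * Suc m + d) * (P * P ^ (3 * m + 2 - d))" by (simp only: power_add power_one_right mult_ac)
  have "Cc (P ^ (2 * m + 3)) = of_int (P ^ (6 * m + 6) * w) - of_int (P ^ 3 * (P ^ (3 * m + d) * z))"
    using w z by (simp add: P_def algebra_simps)
  also have "P ^ 3 * (P ^ (3 * m + d) * z) = P ^ (3 * Suc m + d) * z" by (simp add: power_add mult_ac)
  also have "of_int (P ^ (6 * m + 6) * w) - of_int (P ^ (3 * Suc m + d) * z) =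
      (of_int (P ^ (3 * Suc m + d) * (P * P ^ (3 * m + 2 - d) * w - z)) :: complex)"
    unfolding of_int_diff[symmetric] e by (simp only: right_diff_distrib mult.assoc)
  finally have "Cc (P ^ (2 * m + 3)) = of_int (P ^ (3 * Suc m + d) * (P * P ^ (3 * m + 2 - d) * w - z))" .
  moreover have "\<not> P dvd P * P ^ (3 * m + 2 - d) * w - z"
    using z(2) by (simp add: dvd_diff_right_iff mult.assoc)
  moreover have "2 * Suc m + 1 = 2 * m + 3" by simp
  ultimately show ?case unfolding d_def P_def by metis
qed

end

text \<open>Cross-multiplication compares an arbitrary fraction with the reduced one given by
  \<open>quotient_of\<close>.\<close>

lemma vp_rat_quotient:
  assumes "prime p" "x \<noteq> 0" "y \<noteq> 0"
  shows "vp_rat p (of_int x / of_int y) = int (multiplicity (int p) x) - int (multiplicity (int p) y)"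
proof -
  obtain a b where ab: "quotient_of (of_int x / of_int y) = (a, b)" by force
  have b: "b > 0" using quotient_of_denom_pos[OF ab] .
  have q: "of_int x / of_int y = (of_int a / of_int b :: rat)" using quotient_of_div[OF ab] .
  hence "of_int (x * b) = (of_int (a * y) :: rat)" using b assms by (simp add: field_simps)
  hence eq: "x * b = a * y" by (simp only: of_int_eq_iff)
  hence "a \<noteq> 0" using assms b by auto
  have pe: "prime_elem (int p)" using assms by simp
  have "multiplicity (int p) x + multiplicity (int p) b = multiplicity (int p) a + multiplicity (int p) y"
    using eq assms b \<open>a \<noteq> 0\<close> prime_elem_multiplicity_mult_distrib[OF pe, of x b]
      prime_elem_multiplicity_mult_distrib[OF pe, of a y] by simp
  thus ?thesis unfolding vp_rat_def ab by simp
qed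

theorem theorem4p1:
  fixes p m :: nat
  assumes "prime p" and "p mod 3 = 2"
  shows "C (int (p ^ (2*m+1))) \<noteq> 0
    \<and> vp_rat p (C (int (p ^ (2*m+1)))) = (if p = 2 then 3*int m + 1 else 3*int m)
    \<and> vp_series_ge p (\<lambda>n. U_op G (p ^ (2*m+1)) n / C (int (p ^ (2*m+1))) - fls_nth g1 n)
        (if p = 2 then 3*int m + 2 else 3*int m + 3)"
proof -
  interpret hecke_prime p by unfold_locales (rule assms)+
  define P where "P = int p"
  define d :: nat where "d = (if p = 2 then 1 else 0)"
  have pP: "int (p ^ (2 * m + 1)) = P ^ (2 * m + 1)" by (simp add: P_def)
  have pe: "prime_elem P" using prime_int by (simp add: P_def)
  have P0: "P \<noteq> 0" using p_gt_1 by (simp add: P_def)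
  have mult: "multiplicity P (P ^ k * z) = k + multiplicity P z" if "z \<noteq> 0" for k z
  proof (induction k)
    case (Suc k)
    have "multiplicity P (P * (P ^ k * z)) = Suc (multiplicity P (P ^ k * z))"
      using that P0 pe by (intro multiplicity_times_same) (auto simp: prime_elem_not_unit)
    thus ?case using Suc by (simp add: mult.assoc)
  qed simp
  obtain z where "Cc (P ^ (2 * m + 1)) = of_int (P ^ (3 * m + d) * z)" and z: "\<not> P dvd z"
    using Cc_valuation[of m] unfolding P_def d_def by blast
  hence "(of_rat (C (P ^ (2 * m + 1))) :: complex) = of_rat (of_int (P ^ (3 * m + d) * z))"
    by (simp only: of_rat_C of_rat_of_int_eq)
  hence Cp: "C (P ^ (2 * m + 1)) = of_int (P ^ (3 * m + d) * z)" by (simp only: of_rat_eq_iff)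
  have z0: "z \<noteq> 0" using z by auto
  have mz: "multiplicity P (P ^ (3 * m + d) * z) = 3 * m + d"
    unfolding mult[OF z0] using z by (simp add: not_dvd_imp_multiplicity_0)
  have c0: "P ^ (3 * m + d) * z \<noteq> 0" using z0 P0 by simp
  have v1: "vp_rat p (C (P ^ (2 * m + 1))) = 3 * int m + int d"
    using vp_rat_quotient[OF prime c0, of 1] mz unfolding Cp by (simp add: P_def)
  \<comment> \<open>The difference is a multiple of p^(6m+3) divided by C(p^(2m+1)), whose valuation
    3m + d is lost.\<close>
  have v2: "vp_rat p (U_op G (p ^ (2 * m + 1)) n / C (P ^ (2 * m + 1)) - fls_nth g1 n) \<ge> 3 * int m + 3 - int d"
    if nz: "U_op G (p ^ (2 * m + 1)) n / C (P ^ (2 * m + 1)) - fls_nth g1 n \<noteq> 0" for n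
  proof -
    obtain w where w: "Cc (P ^ (2 * m + 1) * n) - Cc (P ^ (2 * m + 1)) * fls_nth gf n = of_int (P ^ (6 * m + 3) * w)"
      using Cc_congruence[of m n] unfolding P_def intmult_def by blast
    hence "(of_rat (C (P ^ (2 * m + 1) * n) - C (P ^ (2 * m + 1)) * fls_nth g1 n) :: complex) =
        of_rat (of_int (P ^ (6 * m + 3) * w))"
      by (simp only: of_rat_diff of_rat_mult of_rat_C of_rat_g1 of_rat_of_int_eq)
    hence "C (P ^ (2 * m + 1) * n) - C (P ^ (2 * m + 1)) * fls_nth g1 n = of_int (P ^ (6 * m + 3) * w)"
      by (simp only: of_rat_eq_iff)
    moreover have "U_op G (p ^ (2 * m + 1)) n = C (P ^ (2 * m + 1) * n)" by (simp only: U_op_def C_def pP)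
    moreover have "C (P ^ (2 * m + 1)) \<noteq> 0" unfolding Cp using c0 by (simp only: of_int_eq_0_iff not_False_eq_True)
    ultimately have q: "U_op G (p ^ (2 * m + 1)) n / C (P ^ (2 * m + 1)) - fls_nth g1 n =
        of_int (P ^ (6 * m + 3) * w) / of_int (P ^ (3 * m + d) * z)"
      unfolding Cp[symmetric] by (simp add: field_simps)
    hence w0: "w \<noteq> 0" using nz by auto
    hence "P ^ (6 * m + 3) * w \<noteq> 0" using P0 by simp
    from vp_rat_quotient[OF prime this c0] show ?thesis
      unfolding q mult[OF w0, folded P_def] P_def[symmetric] mz by simp
  qed
  have "C (P ^ (2 * m + 1)) \<noteq> 0" unfolding Cp using c0 by (simp only: of_int_eq_0_iff not_False_eq_True)
  moreover have "3 * int m + int d = (if p = 2 then 3 * int m + 1 else 3 * int m)"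
    "3 * int m + 3 - int d = (if p = 2 then 3 * int m + 2 else 3 * int m + 3)" by (simp_all add: d_def)
  ultimately show ?thesis unfolding pP vp_series_ge_def using v1 v2 by (simp only:) blast
qed

end
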